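(* Let $m \in \mathbb{N}$ ($m\ge1$), $\ell \in \{m-1,m\}$, and $\alpha \in (0,1)$. For any $A \in \mathbb{C}^{n \times n}$ with no nonpositive real eigenvalues, the iteration $$Y_{k+1} = Y_k\, h_{\ell,m}( Z_k Y_k, \alpha_k),\quad Y_0 = A,$$ $$Z_{k+1} = h_{\ell,m}( Z_k Y_k, \alpha_k )\, Z_k,\quad Z_0 = I,$$ $$\alpha_{k+1} = \alpha_k\, h_{\ell,m}(\alpha_k^2,\alpha_k),\quad \alpha_0 = \alpha,$$ is stable, and $Y_k \rightarrow A^{1/2}$, $Z_k \rightarrow A^{-1/2}$, and $\alpha_k \rightarrow 1$ with order of convergence $m+\ell+1$.
   Context: $A^{1/2}$ is the principal square root of $A$ and $A^{-1/2}$ its inverse. A rational function is of type $(m,\ell)$ if it is a ratio of polynomials (with real coefficients) of degree at most $m$ (numerator) and $\ell$ (denominator); $\mathcal{R}_{m,\ell}$ is the set of these. For $m \ge 1$, $\ell \in \{m-1,m\}$, $\alpha \in (0,1)$, $r_{m,\ell}(z,\alpha)$ is the (unique) $r\in\mathcal{R}_{m,\ell}$ minimizing $\max_{z \in [\alpha^2,1]} |(r(z)-\sqrt{z})/\sqrt{z}|$, and $\hat{r}_{m,\ell}(z,\alpha)$ is the unique scalar multiple of $r_{m,\ell}(z,\alpha)$ with $\min_{z \in [\alpha^2,1]} (\hat{r}_{m,\ell}(z,\alpha)-\sqrt{z})/\sqrt{z} = 0$. Put $h_{\ell,m}(z,\alpha) = \hat{r}_{m,\ell}(z,\alpha)^{-1}$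 (a rational function of $z$). Stability: an iteration $W_{k+1}=g(W_k)$ with fixed point $W$, where $g$ is Fréchet differentiable at $W$, is stable (in a neighborhood of $W$) if the Fréchet derivative $L_g(W)$ has bounded powers, i.e. there is a constant $c$ with $\|L_g(W)^i\|\le c$ for all $i\ge 1$. For the iteration in the claim, in which $\alpha_k\to1$, stability refers to the limiting map obtained as $\alpha_k \to 1$, namely $g(Y,Z)=(Y\,q_{\ell,m}(ZY),\ q_{\ell,m}(ZY)\,Z)$ at the fixed point $(A^{1/2},A^{-1/2})$, where $q_{\ell,m}(z)=p_{m,\ell}(z)^{-1}$ and $p_{m,\ell}\in\mathcal{R}_{m,\ell}$ is the type $(m,\ell)$ Padé approximant of $\sqrt z$ at $z=1$ (i.e. $\sqrt z-p_{m,\ell}(z)=O((z-1)^{m+\ell+1})$ as $z\to1$), which is the coefficient-wise limit of $\hat r_{m,\ell}(z,\alpha)$ as $\alpha\uparrow1$. *)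

theory Defs
  imports
    "HOL-Analysis.Analysis"
    "HOL-Library.Landau_Symbols"
    "HOL-Computational_Algebra.Computational_Algebra"
    "HOL-Computational_Algebra.Field_as_Ring"
begin

section \<open>Complex matrices\<close>

definition eigenvalue :: "complex^'n^'n \<Rightarrow> complex \<Rightarrow> bool" where
  "eigenvalue A \<mu> \<longleftrightarrow> (\<exists>v. v \<noteq> 0 \<and> A *v v = \<mu> *s v)"

definition principal_sqrt :: "complex^'n^'n \<Rightarrow> complex^'n^'n" where
  "principal_sqrt A = (THE X. X ** X = A \<and> (\<forall>\<mu>. eigenvalue X \<mu> \<longrightarrow> Re \<mu> > 0))"

(* The operations * and ^ on type vec act entrywise, so powers with respect to the
   matrix product have to be written out. *)
definition mat_power :: "complex^'n^'n \<Rightarrow> nat \<Rightarrow> complex^'n^'n" where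
  "mat_power X k = ((\<lambda>B. X ** B) ^^ k) (mat 1)"

definition mat_poly :: "real poly \<Rightarrow> complex^'n^'n \<Rightarrow> complex^'n^'n" where
  "mat_poly p X = (\<Sum>i\<le>degree p. coeff p i *\<^sub>R mat_power X i)"

section \<open>Real rational functions\<close>

type_synonym ratfun = "real poly fract"

(* quot_of_fract yields the coprime representation with monic denominator. *)
definition rat_num :: "ratfun \<Rightarrow> real poly" where
  "rat_num r = fst (quot_of_fract r)"

definition rat_den :: "ratfun \<Rightarrow> real poly" where
  "rat_den r = snd (quot_of_fract r)"

definition ratfuns :: "nat \<Rightarrow> nat \<Rightarrow> ratfun set" where
  "ratfuns m l = {Fract p q | p q. q \<noteq> 0 \<and> degree p \<le> m \<and> degree q \<le> l}"

(* At a pole the value is 0 by the convention x / 0 = 0. *)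
definition rat_eval :: "ratfun \<Rightarrow> real \<Rightarrow> real" where
  "rat_eval r x = poly (rat_num r) x / poly (rat_den r) x"

definition defined_at :: "ratfun \<Rightarrow> real \<Rightarrow> bool" where
  "defined_at r x \<longleftrightarrow> poly (rat_den r) x \<noteq> 0"

(* Meaningful only under mat_defined_at; matrix_inv is unspecified on singular matrices. *)
definition mat_eval :: "ratfun \<Rightarrow> complex^'n^'n \<Rightarrow> complex^'n^'n" where
  "mat_eval r X = mat_poly (rat_num r) X ** matrix_inv (mat_poly (rat_den r) X)"

definition mat_defined_at :: "ratfun \<Rightarrow> complex^'n^'n \<Rightarrow> bool" where
  "mat_defined_at r X \<longleftrightarrow> invertible (mat_poly (rat_den r) X)"

section \<open>Zolotarev and Pade approximants of the square root\<close>

definition rel_err :: "ratfun \<Rightarrow> real \<Rightarrow> real" where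
  "rel_err r z = (rat_eval r z - sqrt z) / sqrt z"

definition max_rel_err :: "real \<Rightarrow> ratfun \<Rightarrow> real" where
  "max_rel_err \<alpha> r = (SUP z\<in>{\<alpha>\<^sup>2..1}. \<bar>rel_err r z\<bar>)"

(* The error is infinite for a function with a pole in the interval. Such functions are
   excluded as competitors, because the real-valued SUP of an unbounded set is unspecified;
   for the remaining ones the SUP is attained. *)
definition minimax :: "nat \<Rightarrow> nat \<Rightarrow> real \<Rightarrow> ratfun \<Rightarrow> bool" where
  "minimax m l \<alpha> r \<longleftrightarrow>
     r \<in> ratfuns m l \<and> (\<forall>z\<in>{\<alpha>\<^sup>2..1}. defined_at r z) \<and>
     (\<forall>s\<in>ratfuns m l. (\<forall>z\<in>{\<alpha>\<^sup>2..1}. defined_at s z) \<longrightarrow> max_rel_err \<alpha> r \<le> max_rel_err \<alpha> s)"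

definition zolo :: "nat \<Rightarrow> nat \<Rightarrow> real \<Rightarrow> ratfun" where
  "zolo m l \<alpha> = (THE r. minimax m l \<alpha> r)"

definition zolo_hat :: "nat \<Rightarrow> nat \<Rightarrow> real \<Rightarrow> ratfun" where
  "zolo_hat m l \<alpha> = (THE s. (\<exists>c. s = Fract [:c:] 1 * zolo m l \<alpha>) \<and>
                            (INF z\<in>{\<alpha>\<^sup>2..1}. rel_err s z) = 0)"

definition zolo_h :: "nat \<Rightarrow> nat \<Rightarrow> real \<Rightarrow> ratfun" where
  "zolo_h l m \<alpha> = inverse (zolo_hat m l \<alpha>)"

definition pade_sqrt :: "nat \<Rightarrow> nat \<Rightarrow> ratfun" where
  "pade_sqrt m l = (THE p. p \<in> ratfuns m l \<and> defined_at p 1 \<and>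
     (\<lambda>z. sqrt z - rat_eval p z) \<in> O[at 1](\<lambda>z. (z - 1) ^ (m + l + 1)))"

definition pade_q :: "nat \<Rightarrow> nat \<Rightarrow> ratfun" where
  "pade_q l m = inverse (pade_sqrt m l)"

definition pade_map ::
  "nat \<Rightarrow> nat \<Rightarrow> (complex^'n^'n) \<times> (complex^'n^'n) \<Rightarrow> (complex^'n^'n) \<times> (complex^'n^'n)" where
  "pade_map l m = (\<lambda>(Y, Z). (Y ** mat_eval (pade_q l m) (Z ** Y),
                             mat_eval (pade_q l m) (Z ** Y) ** Z))"

section \<open>Stability and order of convergence\<close>

definition stable_at :: "('a::real_normed_vector \<Rightarrow> 'a) \<Rightarrow> 'a \<Rightarrow> bool" where
  "stable_at g W \<longleftrightarrow> g W = W \<and>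
     (\<exists>L. (g has_derivative L) (at W) \<and> (\<exists>c. \<forall>i\<ge>1. onorm (L ^^ i) \<le> c))"

definition order_bound :: "(nat \<Rightarrow> 'a::metric_space) \<Rightarrow> 'a \<Rightarrow> real \<Rightarrow> bool" where
  "order_bound X x p \<longleftrightarrow>
     (\<exists>c. \<forall>\<^sub>F k in sequentially. dist (X (Suc k)) x \<le> c * dist (X k) x powr p)"

(* The order is the largest admissible exponent. *)
definition converges_with_order :: "(nat \<Rightarrow> 'a::metric_space) \<Rightarrow> 'a \<Rightarrow> real \<Rightarrow> bool" where
  "converges_with_order X x p \<longleftrightarrow>
     X \<longlonglongrightarrow> x \<and> order_bound X x p \<and> (\<forall>q>p. \<not> order_bound X x q)"

(* Order in the root sense: the errors are dominated by a null sequence of order p. *)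
definition converges_with_R_order :: "(nat \<Rightarrow> 'a::metric_space) \<Rightarrow> 'a \<Rightarrow> real \<Rightarrow> bool" where
  "converges_with_R_order X x p \<longleftrightarrow>
     (\<exists>\<epsilon>::nat \<Rightarrow> real. converges_with_order \<epsilon> 0 p \<and> (\<forall>k. dist (X k) x \<le> \<epsilon> k))"

end

theory Submission
  imports Defs
begin

text \<open>
Write \<open>z = x * x\<close>, and let \<open>h\<close> be the reciprocal of the scaled best approximant of type \<open>(m, l)\<close>. On
eigenvalues, the iteration is the iteration of the odd rational map \<open>x \<mapsto> x * h(x * x)\<close> of degree
\<open>n = m + l + 1\<close>, which in the Cayley coordinate
\<open>w = (1 - x) / (1 + x)\<close> is a Blaschke product with real zeros. This makes it possible to avoid the
elliptic functions in Zolotarev's explicit solution.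

For zeros \<open>x\<^sub>j\<close> between \<open>\<alpha>\<close> and 1 let \<open>B(x)\<close> be the product of the quotients
\<open>(x\<^sub>j - x) / (x\<^sub>j + x)\<close>. Then \<open>x * (1 + B) / (1 - B)\<close> is an even function of \<open>x\<close>, hence a rational function
of \<open>z\<close>, and counting degrees shows that it has type \<open>(m, l)\<close>. Its relative error is
\<open>2 * B / (1 - B)\<close>. A compactness argument with an elementary exchange step yields zeros for which \<open>B\<close>
takes the values \<open>B(\<alpha>)\<close>, its maximum, and 0 alternately at \<open>n + 1\<close> points (\<open>equioscillating_refl_prod\<close>), and an
alternation argument identifies a multiple of the resulting function as the unique best approximant
(\<open>alternating_poly_eq_0\<close>, \<open>best_unique\<close>, \<open>zolo_h_structure\<close>). With all zeros equal to 1 the same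
formulas give the Pade approximant (\<open>pade_q_eq\<close>).

For \<open>\<omega> = (1 - \<alpha>) / (1 + \<alpha>)\<close> the recurrence is \<open>\<omega>' = B(\<alpha>)\<close>. Each factor of \<open>B(\<alpha>)\<close> is
at most \<open>\<omega>\<close>, and \<open>B(\<alpha>)\<close> is the maximum of a product with \<open>n\<close> zeros over an interval of length
\<open>1 - \<alpha>\<close>, so \<open>\<omega>'\<close> is comparable to \<open>\<omega> ^ n\<close> from both sides. The lower bound also limits the order of
the coupled iteration (\<open>not_order_bound\<close>).

With \<open>X\<close> the principal square root of \<open>A\<close> (\<open>principal_sqrt_props\<close>) and \<open>V = X Z\<close>, both
sequences are multiples of \<open>V\<close>, and the Cayley transform of \<open>V\<close> is mapped by the Blaschke product in
each step (\<open>coupled_step\<close>). Initially it has spectral radius less than 1, hence norm less than 1 in a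
suitable inner product (\<open>initial_cayley_le\<close>). By von Neumann's inequality its norm \<open>t\<close> then obeys
\<open>t' \<le> ((t + \<omega>) / (1 + t * \<omega>)) ^ n\<close> (\<open>cayley_le_step\<close>), which rules out poles, and \<open>t\<close> tends to 0
because the \<open>\<omega>\<close> are summable (\<open>hypsum_iteration_tendsto_0\<close>). Close to the limit the same inequality in
the standard norm gives the order \<open>n\<close>. Stability holds because the derivative of the limiting map at
its fixed point is idempotent (\<open>pade_map_stable\<close>).
\<close>

section \<open>Products of reflected linear factors\<close>

text \<open>In the coordinate \<open>w = (1 - x) / (1 + x)\<close>, which maps the right half-plane to the unit disk, this is
the Blaschke product with zeros \<open>(1 - t) / (1 + t)\<close>.\<close>

definition refl_prod :: "real list \<Rightarrow> real \<Rightarrow> real" where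
  "refl_prod ts x = (\<Prod>t\<leftarrow>ts. (t - x) / (t + x))"

lemma refl_prod_simps [simp]:
  "refl_prod [] x = 1" "refl_prod (t # ts) x = (t - x) / (t + x) * refl_prod ts x"
  "refl_prod (ts @ us) x = refl_prod ts x * refl_prod us x"
  by (simp_all add: refl_prod_def)

lemma refl_prod_mset_cong: "mset ts = mset us \<Longrightarrow> refl_prod ts x = refl_prod us x"
proof -
  assume "mset ts = mset us"
  then have "prod_mset (mset (map (\<lambda>t. (t - x) / (t + x)) ts)) = prod_mset (mset (map (\<lambda>t. (t - x) / (t + x)) us))"
    by simp
  then show ?thesis unfolding refl_prod_def by (simp only: prod_mset_prod_list)
qed

lemma abs_factor_le_one:
  fixes t x :: real
  assumes "0 < t" "0 < x"
  shows "\<bar>(t - x) / (t + x)\<bar> \<le> 1"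
  using assms by (auto simp: abs_le_iff divide_simps)

lemma abs_refl_prod_le_one:
  assumes "\<And>t. t \<in> set ts \<Longrightarrow> 0 < t" "0 < x"
  shows "\<bar>refl_prod ts x\<bar> \<le> 1"
  using assms
proof (induction ts)
  case (Cons t ts)
  have "\<bar>(t - x) / (t + x)\<bar> * \<bar>refl_prod ts x\<bar> \<le> 1 * 1"
    using Cons by (intro mult_mono abs_factor_le_one) auto
  then show ?case by (simp add: abs_mult)
qed simp

lemma refl_prod_eq_0_iff:
  assumes "\<And>t. t \<in> set ts \<Longrightarrow> 0 < t" "0 < x"
  shows "refl_prod ts x = 0 \<longleftrightarrow> x \<in> set ts"
  using assms
proof (induction ts)
  case (Cons t ts)
  from Cons.prems have "t + x > 0" by (simp add: add_pos_pos)
  with Cons show ?case by auto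
qed simp

lemma continuous_on_refl_prod:
  assumes "\<And>t. t \<in> set ts \<Longrightarrow> 0 < t" "\<And>x. x \<in> S \<Longrightarrow> 0 < x"
  shows "continuous_on S (refl_prod ts)"
  using assms
proof (induction ts)
  case (Cons t ts)
  have "t + x \<noteq> 0" if "x \<in> S" for x using Cons.prems(1)[of t] Cons.prems(2)[OF that] by simp
  with Cons show ?case by (auto intro!: continuous_intros)
next
  case Nil
  have "refl_prod [] = (\<lambda>_. 1)" by auto
  then show ?case by simp
qed

lemma factor_lipschitz:
  fixes t u x :: real
  assumes "0 < \<alpha>" "\<alpha> \<le> x" "x \<le> 1" "0 < t" "0 < u"
  shows "\<bar>(t - x) / (t + x) - (u - x) / (u + x)\<bar> \<le> 2 / \<alpha>\<^sup>2 * \<bar>t - u\<bar>"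
proof -
  have "(t - x) / (t + x) - (u - x) / (u + x) = 2 * x * (t - u) / ((t + x) * (u + x))"
    using assms by (simp add: field_simps)
  then have "\<bar>(t - x) / (t + x) - (u - x) / (u + x)\<bar> = 2 * x * \<bar>t - u\<bar> / ((t + x) * (u + x))"
    using assms by (simp add: abs_mult)
  also have "\<dots> \<le> 2 * 1 * \<bar>t - u\<bar> / (\<alpha> * \<alpha>)"
    using assms by (intro frac_le mult_mono) auto
  finally show ?thesis by (simp add: power2_eq_square)
qed

lemma refl_prod_lipschitz:
  assumes "0 < \<alpha>" "\<alpha> \<le> x" "x \<le> 1" "length us = length ts"
    and "\<And>t. t \<in> set ts \<Longrightarrow> 0 < t" "\<And>t. t \<in> set us \<Longrightarrow> 0 < t"
  shows "\<bar>refl_prod ts x - refl_prod us x\<bar> \<le> 2 / \<alpha>\<^sup>2 * (\<Sum>i<length ts. \<bar>ts ! i - us ! i\<bar>)"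
  using assms(4-6)
proof (induction us ts rule: list_induct2)
  case (Cons u us t ts)
  let ?f = "\<lambda>t. (t - x) / (t + x)"
  have IH: "\<bar>refl_prod ts x - refl_prod us x\<bar> \<le> 2 / \<alpha>\<^sup>2 * (\<Sum>i<length ts. \<bar>ts ! i - us ! i\<bar>)"
    using Cons by auto
  have "a * c - b * d = a * (c - d) + (a - b) * d" for a b c d :: real
    by (simp add: algebra_simps)
  from this[of "?f t" _ "?f u"]
  have "\<bar>?f t * refl_prod ts x - ?f u * refl_prod us x\<bar>
      = \<bar>?f t * (refl_prod ts x - refl_prod us x) + (?f t - ?f u) * refl_prod us x\<bar>"
    by simp
  also have "\<dots> \<le> \<bar>?f t\<bar> * \<bar>refl_prod ts x - refl_prod us x\<bar> + \<bar>?f t - ?f u\<bar> * \<bar>refl_prod us x\<bar>"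
    by (metis abs_mult abs_triangle_ineq)
  also have "\<dots> \<le> 1 * \<bar>refl_prod ts x - refl_prod us x\<bar> + \<bar>?f t - ?f u\<bar> * 1"
    using assms Cons.prems
    by (intro add_mono mult_right_mono mult_left_mono abs_factor_le_one abs_refl_prod_le_one) auto
  also have "\<dots> \<le> 2 / \<alpha>\<^sup>2 * (\<Sum>i<length ts. \<bar>ts ! i - us ! i\<bar>) + 2 / \<alpha>\<^sup>2 * \<bar>t - u\<bar>"
    using IH factor_lipschitz[of \<alpha> x t u] assms Cons.prems by simp
  finally show ?case
    by (simp del: sum.lessThan_Suc add: sum.lessThan_Suc_shift algebra_simps)
qed simp

section \<open>The extremal reflected product\<close>

definition maxabs :: "real \<Rightarrow> (real \<Rightarrow> real) \<Rightarrow> real" where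
  "maxabs \<alpha> f = (SUP x\<in>{\<alpha>..1}. \<bar>f x\<bar>)"

lemma maxabs_props:
  assumes "\<alpha> \<le> 1" "continuous_on {\<alpha>..1} f"
  shows "x \<in> {\<alpha>..1} \<Longrightarrow> \<bar>f x\<bar> \<le> maxabs \<alpha> f" "\<exists>x\<in>{\<alpha>..1}. \<bar>f x\<bar> = maxabs \<alpha> f"
proof -
  have "continuous_on {\<alpha>..1} (\<lambda>x. \<bar>f x\<bar>)" using assms by (intro continuous_intros)
  then obtain c where c: "c \<in> {\<alpha>..1}" "\<forall>x\<in>{\<alpha>..1}. \<bar>f x\<bar> \<le> \<bar>f c\<bar>"
    using continuous_attains_sup[of "{\<alpha>..1}" "\<lambda>x. \<bar>f x\<bar>"] assms by auto
  have "maxabs \<alpha> f = \<bar>f c\<bar>"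
    unfolding maxabs_def using c by (intro cSup_eq_maximum) auto
  then show "x \<in> {\<alpha>..1} \<Longrightarrow> \<bar>f x\<bar> \<le> maxabs \<alpha> f" "\<exists>x\<in>{\<alpha>..1}. \<bar>f x\<bar> = maxabs \<alpha> f"
    using c by auto
qed

lemma maxabs_le_add:
  assumes "\<alpha> \<le> 1" "continuous_on {\<alpha>..1} f" "continuous_on {\<alpha>..1} g"
    and "\<And>x. x \<in> {\<alpha>..1} \<Longrightarrow> \<bar>f x - g x\<bar> \<le> d"
  shows "maxabs \<alpha> f \<le> maxabs \<alpha> g + d"
proof -
  obtain x where x: "x \<in> {\<alpha>..1}" "\<bar>f x\<bar> = maxabs \<alpha> f" using maxabs_props(2)[OF assms(1,2)] by auto
  have "\<bar>f x\<bar> \<le> \<bar>g x\<bar> + \<bar>f x - g x\<bar>" by linarith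
  also have "\<dots> \<le> maxabs \<alpha> g + d"
    using maxabs_props(1)[OF assms(1,3) x(1)] assms(4)[OF x(1)] by linarith
  finally show ?thesis using x by simp
qed

text \<open>The Zolotarev product for \<open>n\<close> factors is the square of a product with \<open>n div 2\<close> factors, times
\<open>(1 - x) / (1 + x)\<close> if \<open>n\<close> is odd. The weight \<open>v\<close> stands for the square root of that extra factor
(or for 1), so that both parities are instances of one minimax problem on the interval from
\<open>\<alpha>\<close> to 1.\<close>

locale extremal_refl =
  fixes \<alpha> :: real and v :: "real \<Rightarrow> real"
  assumes \<alpha>: "0 < \<alpha>" "\<alpha> < 1"
    and v_cont: "continuous_on {\<alpha>..1} v"
    and v_bounds: "\<And>x. x \<in> {\<alpha>..1} \<Longrightarrow> 0 \<le> v x \<and> v x \<le> 1"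
    and v_pos: "\<And>x. \<alpha> \<le> x \<Longrightarrow> x < 1 \<Longrightarrow> 0 < v x"
    and v_antimono: "\<And>x y. \<alpha> \<le> x \<Longrightarrow> x \<le> y \<Longrightarrow> y \<le> 1 \<Longrightarrow> v y \<le> v x"
begin

definition W :: "real list \<Rightarrow> real \<Rightarrow> real" where "W ts x = v x * refl_prod ts x"

lemma cont_W: "(\<And>t. t \<in> set ts \<Longrightarrow> 0 < t) \<Longrightarrow> continuous_on {\<alpha>..1} (W ts)"
  unfolding W_def using \<alpha> by (intro continuous_intros v_cont continuous_on_refl_prod) auto

lemma W_lipschitz:
  assumes "x \<in> {\<alpha>..1}" "length us = length ts"
    and "\<And>t. t \<in> set ts \<Longrightarrow> 0 < t" "\<And>t. t \<in> set us \<Longrightarrow> 0 < t"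
  shows "\<bar>W ts x - W us x\<bar> \<le> 2 / \<alpha>\<^sup>2 * (\<Sum>i<length ts. \<bar>ts ! i - us ! i\<bar>)"
proof -
  have "\<bar>W ts x - W us x\<bar> = v x * \<bar>refl_prod ts x - refl_prod us x\<bar>"
    using v_bounds[OF assms(1)] by (simp add: W_def abs_mult flip: right_diff_distrib)
  also have "\<dots> \<le> 1 * \<bar>refl_prod ts x - refl_prod us x\<bar>"
    using v_bounds[OF assms(1)] by (intro mult_right_mono) auto
  also have "\<dots> \<le> 2 / \<alpha>\<^sup>2 * (\<Sum>i<length ts. \<bar>ts ! i - us ! i\<bar>)"
    using refl_prod_lipschitz[of \<alpha> x us ts] assms \<alpha> by simp
  finally show ?thesis .
qed

lemma minimiser_exists:
  obtains ts where "length ts = m" "set ts \<subseteq> {\<alpha>..1}"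
    "\<And>us. length us = m \<Longrightarrow> set us \<subseteq> {\<alpha>..1} \<Longrightarrow> maxabs \<alpha> (W ts) \<le> maxabs \<alpha> (W us)"
proof -
  define L where "L t = map t [0..<m]" for t :: "nat \<Rightarrow> real"
  define K where "K = (UNIV \<rightarrow>\<^sub>E {\<alpha>..1} :: (nat \<Rightarrow> real) set)"
  have Lset: "set (L t) \<subseteq> {\<alpha>..1}" if "t \<in> K" for t using that by (auto simp: L_def K_def)
  have Lpos: "0 < s" if "t \<in> K" "s \<in> set (L t)" for t s using Lset[OF that(1)] that(2) \<alpha> by auto
  have "compactin (product_topology (\<lambda>_. euclidean) UNIV) K"
    unfolding K_def by (subst compactin_PiE) (auto simp: compactin_euclidean_iff)
  then have K: "compact K"
    by (simp add: euclidean_product_topology compactin_euclidean_iff)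
  have diff: "maxabs \<alpha> (W (L t)) \<le> maxabs \<alpha> (W (L u)) + 2 / \<alpha>\<^sup>2 * (\<Sum>i<m. \<bar>t i - u i\<bar>)"
    if "t \<in> K" "u \<in> K" for t u
  proof (rule maxabs_le_add)
    show "\<alpha> \<le> 1" using \<alpha> by simp
    show "continuous_on {\<alpha>..1} (W (L t))" by (rule cont_W) (rule Lpos[OF that(1)])
    show "continuous_on {\<alpha>..1} (W (L u))" by (rule cont_W) (rule Lpos[OF that(2)])
    fix x assume "x \<in> {\<alpha>..1}"
    then show "\<bar>W (L t) x - W (L u) x\<bar> \<le> 2 / \<alpha>\<^sup>2 * (\<Sum>i<m. \<bar>t i - u i\<bar>)"
      using W_lipschitz[of x "L u" "L t"] Lpos[OF that(1)] Lpos[OF that(2)] by (simp add: L_def)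
  qed
  have "continuous_on K (\<lambda>t. maxabs \<alpha> (W (L t)))"
    unfolding continuous_on_def
  proof
    fix t assume t: "t \<in> K"
    have coord: "((\<lambda>u. u i) \<longlongrightarrow> t i) (at t within K)" for i
      using continuous_on_subset[OF continuous_on_product_coordinates[of i], of K] t
      by (simp add: continuous_on_def)
    have "((\<lambda>u. 2 / \<alpha>\<^sup>2 * (\<Sum>i<m. \<bar>t i - u i\<bar>)) \<longlongrightarrow> 2 / \<alpha>\<^sup>2 * (\<Sum>i<m. \<bar>t i - t i\<bar>)) (at t within K)"
      by (intro tendsto_intros coord)
    then have "((\<lambda>u. 2 / \<alpha>\<^sup>2 * (\<Sum>i<m. \<bar>t i - u i\<bar>)) \<longlongrightarrow> 0) (at t within K)" by simp
    moreover have "\<forall>\<^sub>F u in at t within K.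
        norm (maxabs \<alpha> (W (L u)) - maxabs \<alpha> (W (L t))) \<le> 2 / \<alpha>\<^sup>2 * (\<Sum>i<m. \<bar>t i - u i\<bar>)"
      unfolding eventually_at_filter
    proof (intro always_eventually allI impI)
      fix u assume "u \<in> K"
      then show "norm (maxabs \<alpha> (W (L u)) - maxabs \<alpha> (W (L t))) \<le> 2 / \<alpha>\<^sup>2 * (\<Sum>i<m. \<bar>t i - u i\<bar>)"
        using diff[OF t, of u] diff[OF _ t, of u] by (simp add: abs_le_iff abs_minus_commute)
    qed
    ultimately have "((\<lambda>u. maxabs \<alpha> (W (L u)) - maxabs \<alpha> (W (L t))) \<longlongrightarrow> 0) (at t within K)"
      by (rule Lim_null_comparison[rotated])
    then show "((\<lambda>u. maxabs \<alpha> (W (L u))) \<longlongrightarrow> maxabs \<alpha> (W (L t))) (at t within K)"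
      by (simp add: Lim_null[symmetric])
  qed
  moreover have "K \<noteq> {}" using \<alpha> by (auto simp: K_def PiE_eq_empty_iff)
  ultimately obtain t where t: "t \<in> K" "\<And>u. u \<in> K \<Longrightarrow> maxabs \<alpha> (W (L t)) \<le> maxabs \<alpha> (W (L u))"
    using continuous_attains_inf[OF K] by blast
  show ?thesis
  proof
    show "length (L t) = m" "set (L t) \<subseteq> {\<alpha>..1}" using Lset t by (auto simp: L_def)
    fix us :: "real list" assume us: "length us = m" "set us \<subseteq> {\<alpha>..1}"
    define u where "u i = (if i < m then us ! i else 1)" for i
    have "us ! i \<in> {\<alpha>..1}" if "i < m" for i using us that nth_mem[of i us] by blast
    then have "u \<in> K" using \<alpha> by (simp add: K_def u_def PiE_iff)
    moreover have "L u = us" using us by (auto simp: L_def u_def intro: nth_equalityI)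
    ultimately show "maxabs \<alpha> (W (L t)) \<le> maxabs \<alpha> (W us)" using t(2)[of u] by simp
  qed
qed

end

lemma abs_factor_clamp:
  fixes t x :: real
  assumes "0 < \<alpha>" "\<alpha> \<le> x" "x \<le> 1" "0 < t"
  shows "\<bar>(max \<alpha> (min t 1) - x) / (max \<alpha> (min t 1) + x)\<bar> \<le> \<bar>(t - x) / (t + x)\<bar>"
proof -
  consider "t < \<alpha>" | "\<alpha> \<le> t" "t \<le> 1" | "1 < t" by linarith
  then show ?thesis
  proof cases
    case 1
    then have "(x - \<alpha>) / (\<alpha> + x) \<le> (x - t) / (t + x)"
      using assms by (simp add: divide_simps) (simp add: algebra_simps)
    moreover have "\<bar>\<alpha> - x\<bar> = x - \<alpha>" "\<bar>t - x\<bar> = x - t" using 1 assms by auto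
    ultimately show ?thesis using 1 assms by (simp add: abs_divide)
  next
    case 2
    then show ?thesis by (simp add: max_absorb2 min_absorb1)
  next
    case 3
    then have "(1 - x) / (1 + x) \<le> (t - x) / (t + x)"
      using assms by (simp add: divide_simps) (simp add: algebra_simps)
    moreover have "\<bar>1 - x\<bar> = 1 - x" "\<bar>t - x\<bar> = t - x" using 3 assms by auto
    ultimately show ?thesis using 3 assms by (simp add: abs_divide max_absorb2 min_absorb2)
  qed
qed

lemma factor_less:
  fixes s t x :: real
  assumes "0 < x" "0 < s" "s < t" "t \<le> x \<or> x \<le> s"
  shows "t \<le> x \<Longrightarrow> \<bar>(t - x) / (t + x)\<bar> < \<bar>(s - x) / (s + x)\<bar>"
    and "x \<le> s \<Longrightarrow> \<bar>(s - x) / (s + x)\<bar> < \<bar>(t - x) / (t + x)\<bar>"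
proof -
  have *: "(s - x) / (s + x) < (t - x) / (t + x)"
    using assms by (simp add: divide_simps) (simp add: algebra_simps)
  show "\<bar>(t - x) / (t + x)\<bar> < \<bar>(s - x) / (s + x)\<bar>" if "t \<le> x"
  proof -
    have "(t - x) / (t + x) \<le> 0" using that assms by (simp add: divide_nonpos_pos)
    with * show ?thesis by (simp add: abs_if)
  qed
  show "\<bar>(s - x) / (s + x)\<bar> < \<bar>(t - x) / (t + x)\<bar>" if "x \<le> s"
  proof -
    have "0 \<le> (s - x) / (s + x)" using that assms by simp
    with * show ?thesis by (simp add: abs_if)
  qed
qed

text \<open>Moving two zeros apart by the same amount keeps their sum and lowers their product, and outside the
widened gap the product of the two factors with zeros of sum \<open>S\<close> and product \<open>P\<close> is
\<open>(P - S * x + x * x) / (P + S * x + x * x)\<close>, which is nonnegative there and increasing in \<open>P\<close>.\<close>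

lemma factor_pair_less:
  fixes a b \<epsilon> x :: real
  assumes "0 < x" "0 < \<epsilon>" "\<epsilon> < a" "a \<le> b" and x: "x \<le> a - \<epsilon> \<or> b + \<epsilon> \<le> x"
  shows "\<bar>(a - \<epsilon> - x) / (a - \<epsilon> + x) * ((b + \<epsilon> - x) / (b + \<epsilon> + x))\<bar>
       < \<bar>(a - x) / (a + x) * ((b - x) / (b + x))\<bar>"
proof -
  let ?n = "\<lambda>a b. (a - x) * (b - x)" and ?d = "\<lambda>a b. (a + x) * (b + x)"
  have n0: "0 \<le> ?n (a - \<epsilon>) (b + \<epsilon>)" and n1: "0 \<le> ?n a b"
    using x assms by (auto intro: mult_nonneg_nonneg mult_nonpos_nonpos)
  have d0: "0 < ?d (a - \<epsilon>) (b + \<epsilon>)" and d1: "0 < ?d a b"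
    using assms by (auto intro!: mult_pos_pos)
  have gap: "0 < a * b - (a - \<epsilon>) * (b + \<epsilon>)"
  proof -
    have "a * b - (a - \<epsilon>) * (b + \<epsilon>) = \<epsilon> * (b - a) + \<epsilon> * \<epsilon>" by (simp add: algebra_simps)
    also have "\<dots> > 0" using assms by (intro add_nonneg_pos) auto
    finally show ?thesis .
  qed
  have "?n a b * ?d (a - \<epsilon>) (b + \<epsilon>) - ?n (a - \<epsilon>) (b + \<epsilon>) * ?d a b
      = 2 * x * (a + b) * (a * b - (a - \<epsilon>) * (b + \<epsilon>))"
    by (simp add: algebra_simps)
  also have "\<dots> > 0" using assms gap by (intro mult_pos_pos) auto
  finally have "?n (a - \<epsilon>) (b + \<epsilon>) / ?d (a - \<epsilon>) (b + \<epsilon>) < ?n a b / ?d a b"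
    using d0 d1 by (simp add: divide_simps)
  moreover have "0 \<le> ?n (a - \<epsilon>) (b + \<epsilon>) / ?d (a - \<epsilon>) (b + \<epsilon>)" "0 \<le> ?n a b / ?d a b"
    using n0 n1 d0 d1 by auto
  ultimately show ?thesis by (simp only: times_divide_times_eq abs_of_nonneg)
qed

context extremal_refl
begin

lemma clamp_decreases:
  assumes "x \<in> {\<alpha>..1}" "\<And>t. t \<in> set ts \<Longrightarrow> 0 < t"
  shows "\<bar>W (map (\<lambda>t. max \<alpha> (min t 1)) ts) x\<bar> \<le> \<bar>W ts x\<bar>"
proof -
  have "\<bar>refl_prod (map (\<lambda>t. max \<alpha> (min t 1)) ts) x\<bar> \<le> \<bar>refl_prod ts x\<bar>"
    using assms(2)
  proof (induction ts)
    case (Cons t ts)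
    have "\<bar>(max \<alpha> (min t 1) - x) / (max \<alpha> (min t 1) + x)\<bar>
          * \<bar>refl_prod (map (\<lambda>t. max \<alpha> (min t 1)) ts) x\<bar>
        \<le> \<bar>(t - x) / (t + x)\<bar> * \<bar>refl_prod ts x\<bar>"
      using Cons assms(1) \<alpha> by (intro mult_mono abs_factor_clamp) auto
    then show ?case by (simp only: list.map refl_prod_simps abs_mult)
  qed simp
  then show ?thesis by (simp add: W_def abs_mult mult_left_mono)
qed

text \<open>A zero outside the interval can be clamped to the nearer end point, which only lowers the modulus.
A minimiser under the constraint is therefore a minimiser among all positive zeros, and the
perturbations below may leave the interval.\<close>

lemma minimiser_among_positive:
  obtains ts where "length ts = m" "set ts \<subseteq> {\<alpha>..1}" "sorted ts"
    "\<And>us. length us = m \<Longrightarrow> (\<And>u. u \<in> set us \<Longrightarrow> 0 < u) \<Longrightarrow> maxabs \<alpha> (W ts) \<le> maxabs \<alpha> (W us)"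
proof -
  obtain ts where ts: "length ts = m" "set ts \<subseteq> {\<alpha>..1}"
    "\<And>us. length us = m \<Longrightarrow> set us \<subseteq> {\<alpha>..1} \<Longrightarrow> maxabs \<alpha> (W ts) \<le> maxabs \<alpha> (W us)"
    using minimiser_exists by blast
  have eq: "W (sort ts) = W ts"
    by (rule ext) (simp add: W_def refl_prod_mset_cong[of "sort ts" ts])
  show ?thesis
  proof
    show "length (sort ts) = m" "set (sort ts) \<subseteq> {\<alpha>..1}" "sorted (sort ts)" using ts by auto
    fix us :: "real list" assume us: "length us = m" "\<And>u. u \<in> set us \<Longrightarrow> 0 < u"
    let ?cs = "map (\<lambda>t. max \<alpha> (min t 1)) us"
    have cs: "set ?cs \<subseteq> {\<alpha>..1}" using \<alpha> by auto
    then have "\<And>t. t \<in> set ?cs \<Longrightarrow> 0 < t" using \<alpha> by auto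
    from maxabs_props(2)[OF _ cont_W[OF this]] obtain x
      where x: "x \<in> {\<alpha>..1}" "\<bar>W ?cs x\<bar> = maxabs \<alpha> (W ?cs)" using \<alpha> by (metis less_imp_le)
    have "maxabs \<alpha> (W ts) \<le> maxabs \<alpha> (W ?cs)" using ts(3)[of ?cs] us(1) cs by simp
    also have "\<dots> \<le> \<bar>W us x\<bar>" unfolding x(2)[symmetric] by (rule clamp_decreases[OF x(1) us(2)])
    also have "\<dots> \<le> maxabs \<alpha> (W us)"
      using maxabs_props(1)[OF _ cont_W[OF us(2)]] x(1) \<alpha> by simp
    finally show "maxabs \<alpha> (W (sort ts)) \<le> maxabs \<alpha> (W us)" by (simp add: eq)
  qed
qed

lemma abs_W_pos:
  assumes "\<And>t. t \<in> set ts \<Longrightarrow> 0 < t" "\<alpha> \<le> x" "x < 1" "x \<notin> set ts"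
  shows "0 < \<bar>W ts x\<bar>"
  using assms v_pos[of x] refl_prod_eq_0_iff[of ts x] \<alpha> by (auto simp: W_def)

lemma maxabs_W_pos:
  assumes "\<And>t. t \<in> set ts \<Longrightarrow> 0 < t"
  shows "0 < maxabs \<alpha> (W ts)"
proof -
  have "infinite {\<alpha>..<1}" using \<alpha> by simp
  then have "\<not> {\<alpha>..<1} \<subseteq> set ts" using finite_subset by blast
  then obtain x where "x \<in> {\<alpha>..<1}" "x \<notin> set ts" by blast
  then have x: "\<alpha> \<le> x" "x < 1" "x \<notin> set ts" by auto
  then have "0 < \<bar>W ts x\<bar>" by (intro abs_W_pos assms)
  also have "\<dots> \<le> maxabs \<alpha> (W ts)"
    using x \<alpha> by (intro maxabs_props(1) cont_W assms) auto
  finally show ?thesis .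
qed

lemma widening_decreases:
  assumes "0 < \<epsilon>" "\<epsilon> < \<alpha>" "x \<in> {\<alpha>..1}" "x \<le> lo - \<epsilon> \<or> hi + \<epsilon> \<le> x" "\<alpha> \<le> lo" "lo \<le> hi" "hi \<le> 1"
    and "ps = [] \<and> lo = \<alpha> \<or> ps = [lo]" "qs = [] \<and> hi = 1 \<or> qs = [hi]"
  shows "\<bar>refl_prod (map (\<lambda>t. t - \<epsilon>) ps @ map (\<lambda>t. t + \<epsilon>) qs) x\<bar> < \<bar>refl_prod (ps @ qs) x\<bar>"
proof -
  have "0 < x" using assms \<alpha> by auto
  consider "ps = []" "lo = \<alpha>" "qs = []" "hi = 1" | "ps = []" "lo = \<alpha>" "qs = [hi]"
    | "ps = [lo]" "qs = []" "hi = 1" | "ps = [lo]" "qs = [hi]" using assms by auto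
  then show ?thesis
  proof cases
    case 1
    then show ?thesis using assms by auto
  next
    case 2
    then have "hi + \<epsilon> \<le> x" using assms by auto
    then have "\<bar>(hi + \<epsilon> - x) / (hi + \<epsilon> + x)\<bar> < \<bar>(hi - x) / (hi + x)\<bar>"
      using assms \<alpha> \<open>0 < x\<close> by (intro factor_less) auto
    then show ?thesis using 2 by simp
  next
    case 3
    then have "x \<le> lo - \<epsilon>" using assms by auto
    then have "\<bar>(lo - \<epsilon> - x) / (lo - \<epsilon> + x)\<bar> < \<bar>(lo - x) / (lo + x)\<bar>"
      using assms \<alpha> \<open>0 < x\<close> by (intro factor_less) auto
    then show ?thesis using 3 by simp
  next
    case 4
    then show ?thesis using factor_pair_less[of x \<epsilon> lo hi] assms \<open>0 < x\<close> by simp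
  qed
qed

text \<open>If the maximum were not reached between two consecutive zeros (or between an end point of the
interval and the nearest zero), one could widen that gap slightly: the modulus falls strictly
outside the gap and stays below the maximum inside it, against minimality. With coinciding zeros
the gap is a single point where the product vanishes, so the lemma also makes the zeros distinct.\<close>

lemma max_attained_between_zeros:
  assumes len: "length (as @ bs) = m" and set: "set (as @ bs) \<subseteq> {\<alpha>..1}" and sorted: "sorted (as @ bs)"
    and min: "\<And>us. length us = m \<Longrightarrow> (\<And>u. u \<in> set us \<Longrightarrow> 0 < u) \<Longrightarrow>
                maxabs \<alpha> (W (as @ bs)) \<le> maxabs \<alpha> (W us)"
  shows "\<exists>x\<in>{last (\<alpha> # as)..hd (bs @ [1])}. \<bar>W (as @ bs) x\<bar> = maxabs \<alpha> (W (as @ bs))"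
proof (rule ccontr)
  define ts M lo hi where "ts = as @ bs" and "M = maxabs \<alpha> (W ts)"
    and "lo = last (\<alpha> # as)" and "hi = hd (bs @ [1])"
  assume "\<not> ?thesis"
  then have neq: "\<And>x. x \<in> {lo..hi} \<Longrightarrow> \<bar>W ts x\<bar> \<noteq> M" by (auto simp: ts_def M_def lo_def hi_def)
  have pos: "0 < t" if "t \<in> set ts" for t using set that \<alpha> by (force simp: ts_def)
  have cont: "continuous_on {\<alpha>..1} (W ts)" by (rule cont_W) (rule pos)
  have bound: "\<bar>W ts x\<bar> \<le> M" if "x \<in> {\<alpha>..1}" for x
    unfolding M_def using maxabs_props(1)[OF _ cont that] \<alpha> by simp
  have "0 < M" unfolding M_def by (rule maxabs_W_pos) (rule pos)
  obtain as0 ps where ps: "as = as0 @ ps" "ps = [] \<and> as0 = [] \<and> lo = \<alpha> \<or> ps = [lo]"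
    by (cases as rule: rev_cases) (auto simp: lo_def)
  obtain qs bs0 where qs: "bs = qs @ bs0" "qs = [] \<and> bs0 = [] \<and> hi = 1 \<or> qs = [hi]"
  proof (cases bs)
    case Nil
    then show thesis using that[of "[]" "[]"] by (simp add: hi_def)
  next
    case (Cons b bs')
    then show thesis using that[of "[b]" bs'] by (simp add: hi_def)
  qed
  have lohi: "\<alpha> \<le> lo" "lo \<le> hi" "hi \<le> 1"
    using set sorted ps qs \<alpha> by (auto simp: sorted_append)
  have sub: "{lo..hi} \<subseteq> {\<alpha>..1}" using lohi by auto
  have "continuous_on {lo..hi} (\<lambda>x. \<bar>W ts x\<bar>)"
    by (intro continuous_intros continuous_on_subset[OF cont sub])
  then obtain x0 where x0: "x0 \<in> {lo..hi}" "\<And>x. x \<in> {lo..hi} \<Longrightarrow> \<bar>W ts x\<bar> \<le> \<bar>W ts x0\<bar>"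
    using continuous_attains_sup[of "{lo..hi}" "\<lambda>x. \<bar>W ts x\<bar>"] lohi by fastforce
  define d where "d = M - \<bar>W ts x0\<bar>"
  have "0 < d" using bound[of x0] neq[of x0] x0(1) sub by (fastforce simp: d_def)
  from compact_uniformly_continuous[OF cont] \<open>0 < d\<close> obtain \<delta> where \<delta>: "0 < \<delta>"
    "\<And>x y. x \<in> {\<alpha>..1} \<Longrightarrow> y \<in> {\<alpha>..1} \<Longrightarrow> dist y x < \<delta> \<Longrightarrow> dist (W ts y) (W ts x) < d / 2"
    unfolding uniformly_continuous_on_def by (metis compact_Icc half_gt_zero)
  \<comment> \<open>Half of the slack \<open>d\<close> pays for leaving the gap, the other half for moving the zeros.\<close>
  define \<epsilon> where "\<epsilon> = min (min (\<delta> / 2) (\<alpha> / 2)) (d * \<alpha>\<^sup>2 / (4 * (real m + 1)))"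
  have \<epsilon>: "0 < \<epsilon>" "\<epsilon> < \<delta>" "\<epsilon> < \<alpha>" "\<epsilon> \<le> d * \<alpha>\<^sup>2 / (4 * (real m + 1))"
    using \<delta>(1) \<open>0 < d\<close> \<alpha> by (auto simp: \<epsilon>_def)
  have \<epsilon>m: "2 / \<alpha>\<^sup>2 * (real m * \<epsilon>) \<le> d / 2"
  proof -
    have "real m * \<epsilon> \<le> (real m + 1) * (d * \<alpha>\<^sup>2 / (4 * (real m + 1)))"
      using \<epsilon> by (intro mult_mono) auto
    also have "\<dots> = d * \<alpha>\<^sup>2 / 4" by (simp add: field_simps)
    finally have "2 / \<alpha>\<^sup>2 * (real m * \<epsilon>) \<le> 2 / \<alpha>\<^sup>2 * (d * \<alpha>\<^sup>2 / 4)" by (intro mult_left_mono) auto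
    also have "\<dots> = d / 2" using \<alpha> by simp
    finally show ?thesis .
  qed
  define us where "us = as0 @ (map (\<lambda>t. t - \<epsilon>) ps @ map (\<lambda>t. t + \<epsilon>) qs) @ bs0"
  have len_us: "length us = length ts" by (simp add: us_def ts_def ps qs)
  have pos_us: "0 < u" if "u \<in> set us" for u
    using that pos ps qs lohi \<epsilon> \<alpha> by (fastforce simp: us_def ts_def)
  have "list_all2 (\<lambda>t u. \<bar>t - u\<bar> \<le> \<epsilon>) ts us"
    using \<epsilon>(1) by (auto simp: us_def ts_def ps(1) qs(1) list_all2_map2
        intro!: list_all2_appendI list_all2_refl)
  then have near: "\<bar>ts ! i - us ! i\<bar> \<le> \<epsilon>" if "i < length ts" for i using that by (rule list_all2_nthD)
  have close: "\<bar>W us x - W ts x\<bar> \<le> d / 2" if "x \<in> {\<alpha>..1}" for x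
  proof -
    have "\<bar>W ts x - W us x\<bar> \<le> 2 / \<alpha>\<^sup>2 * (\<Sum>i<length ts. \<bar>ts ! i - us ! i\<bar>)"
      by (rule W_lipschitz[OF that len_us pos pos_us])
    also have "\<dots> \<le> 2 / \<alpha>\<^sup>2 * (real m * \<epsilon>)"
      using near sum_bounded_above[of "{..<length ts}" "\<lambda>i. \<bar>ts ! i - us ! i\<bar>" \<epsilon>] len
      by (intro mult_left_mono) (auto simp: ts_def)
    finally show ?thesis using \<epsilon>m by linarith
  qed
  have less: "\<bar>W us x\<bar> < M" if x: "x \<in> {\<alpha>..1}" for x
  proof (cases "x \<le> lo - \<epsilon> \<or> hi + \<epsilon> \<le> x")
    case True
    let ?c = "v x * refl_prod (as0 @ bs0) x"
    have W_ts: "\<bar>W ts x\<bar> = \<bar>?c\<bar> * \<bar>refl_prod (ps @ qs) x\<bar>"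
      by (simp add: W_def ts_def ps(1) qs(1) abs_mult)
    have W_us: "\<bar>W us x\<bar> = \<bar>?c\<bar> * \<bar>refl_prod (map (\<lambda>t. t - \<epsilon>) ps @ map (\<lambda>t. t + \<epsilon>) qs) x\<bar>"
      by (simp add: W_def us_def abs_mult)
    have "\<bar>refl_prod (map (\<lambda>t. t - \<epsilon>) ps @ map (\<lambda>t. t + \<epsilon>) qs) x\<bar> < \<bar>refl_prod (ps @ qs) x\<bar>"
      using True ps(2) qs(2) lohi \<epsilon> x by (intro widening_decreases[of \<epsilon> x lo hi]) auto
    then have "?c = 0 \<or> \<bar>W us x\<bar> < \<bar>W ts x\<bar>"
      unfolding W_ts W_us by (metis mult_strict_left_mono zero_less_abs_iff)
    then show ?thesis using W_us bound[OF x] \<open>0 < M\<close> by force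
  next
    case False
    define x' where "x' = max lo (min x hi)"
    have x': "x' \<in> {lo..hi}" "dist x' x < \<delta>" using False lohi \<epsilon> by (auto simp: x'_def dist_real_def)
    have "\<bar>W ts x' - W ts x\<bar> < d / 2" using \<delta>(2)[of x x'] x x' sub by (auto simp: dist_real_def)
    moreover have "\<bar>W ts x'\<bar> \<le> M - d" using x0(2)[OF x'(1)] by (simp add: d_def)
    ultimately show ?thesis using close[OF x] by linarith
  qed
  obtain z where "z \<in> {\<alpha>..1}" "\<bar>W us z\<bar> = maxabs \<alpha> (W us)"
    using maxabs_props(2)[OF _ cont_W[OF pos_us]] \<alpha> by (metis less_imp_le)
  then have "maxabs \<alpha> (W us) < M" using less by metis
  moreover have "M \<le> maxabs \<alpha> (W us)" using min[OF _ pos_us] len_us len by (simp add: M_def ts_def)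
  ultimately show False by simp
qed

text \<open>One point of maximal modulus in each of the \<open>m + 1\<close> gaps gives the alternation set. The first one
can be taken to be \<open>\<alpha>\<close>, because the modulus is decreasing up to the first zero; this end point is
what ties the recurrence of \<open>\<alpha>\<close> to the approximation error.\<close>

lemma alternation:
  obtains ts M e where "length ts = m" "set ts \<subseteq> {\<alpha>..1}" "0 < M"
    "\<And>x. x \<in> {\<alpha>..1} \<Longrightarrow> \<bar>W ts x\<bar> \<le> M" "e 0 = \<alpha>"
    "\<And>i. i \<le> m \<Longrightarrow> e i \<in> {\<alpha>..1} \<and> \<bar>W ts (e i)\<bar> = M"
    "\<And>i. i < m \<Longrightarrow> e i < ts ! i \<and> ts ! i < e (Suc i)"
proof -
  obtain ts where ts: "length ts = m" "set ts \<subseteq> {\<alpha>..1}" "sorted ts"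
    "\<And>us. length us = m \<Longrightarrow> (\<And>u. u \<in> set us \<Longrightarrow> 0 < u) \<Longrightarrow> maxabs \<alpha> (W ts) \<le> maxabs \<alpha> (W us)"
    using minimiser_among_positive by blast
  define M where "M = maxabs \<alpha> (W ts)"
  have pos: "0 < t" if "t \<in> set ts" for t using ts(2) that \<alpha> by force
  have nth: "\<alpha> \<le> ts ! i" "ts ! i \<le> 1" if "i < m" for i
    using that ts(1,2) nth_mem[of i ts] by (auto simp del: nth_mem)
  have "0 < M" unfolding M_def by (rule maxabs_W_pos) (rule pos)
  have bound: "\<bar>W ts x\<bar> \<le> M" if "x \<in> {\<alpha>..1}" for x
    unfolding M_def using maxabs_props(1)[OF _ cont_W[OF pos] that] \<alpha> by simp
  define lo hi where "lo i = last (\<alpha> # take i ts)" and "hi i = hd (drop i ts @ [1])" for i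
  have lo0: "lo 0 = \<alpha>" by (simp add: lo_def)
  have loS: "lo (Suc i) = ts ! i" if "i < m" for i
    using that ts(1) by (simp add: lo_def take_Suc_conv_app_nth)
  have hi: "hi i = ts ! i" if "i < m" for i
    using that ts(1) by (simp add: hi_def hd_append hd_drop_conv_nth)
  have him: "hi m = 1" using ts(1) by (simp add: hi_def)
  have ex: "\<exists>x\<in>{lo i..hi i}. \<bar>W ts x\<bar> = M" for i
    using max_attained_between_zeros[of "take i ts" "drop i ts" m] ts by (simp add: M_def lo_def hi_def)
  then obtain e0 where e0: "\<And>i. e0 i \<in> {lo i..hi i}" "\<And>i. \<bar>W ts (e0 i)\<bar> = M" by metis
  \<comment> \<open>Left of the first zero every factor is positive and decreasing.\<close>
  have refl_mono: "0 \<le> refl_prod us y \<and> refl_prod us y \<le> refl_prod us x"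
    if "\<alpha> \<le> x" "x \<le> y" "\<And>u. u \<in> set us \<Longrightarrow> y \<le> u" for us x y
    using that(3)
  proof (induction us)
    case (Cons u us)
    have "0 \<le> (u - y) / (u + y)" "(u - y) / (u + y) \<le> (u - x) / (u + x)"
      using Cons.prems[of u] that(1,2) \<alpha> by (simp_all add: divide_simps) (simp add: algebra_simps mult_left_mono)
    with Cons show ?case by (auto simp del: times_divide_eq_left intro!: mult_mono mult_nonneg_nonneg)
  qed simp
  have first: "\<bar>W ts \<alpha>\<bar> = M"
  proof -
    have z: "\<alpha> \<le> e0 0" "e0 0 \<le> 1" "\<And>u. u \<in> set ts \<Longrightarrow> e0 0 \<le> u"
    proof -
      show "\<alpha> \<le> e0 0" using e0(1)[of 0] lo0 by simp
      have le: "e0 0 \<le> hi 0" using e0(1)[of 0] by simp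
      show "e0 0 \<le> 1"
        using le him hi[of 0] nth(2)[of 0] by (cases m) auto
      show "e0 0 \<le> u" if "u \<in> set ts" for u
        using le that ts(3) by (cases ts) (auto simp: hi_def)
    qed
    have "0 \<le> refl_prod ts (e0 0) \<and> refl_prod ts (e0 0) \<le> refl_prod ts \<alpha>"
      by (rule refl_mono[OF order_refl z(1) z(3)])
    then have "\<bar>W ts (e0 0)\<bar> \<le> \<bar>W ts \<alpha>\<bar>"
      unfolding W_def abs_mult
      using z \<alpha> v_antimono[of \<alpha> "e0 0"] v_bounds[of \<alpha>] v_bounds[of "e0 0"]
      by (intro mult_mono) auto
    then show ?thesis using e0(2)[of 0] bound[of \<alpha>] \<alpha> by simp
  qed
  define e where "e = e0(0 := \<alpha>)"
  have eM: "\<bar>W ts (e i)\<bar> = M" for i using e0(2) first by (simp add: e_def)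
  have W0: "W ts x = 0" if "x \<in> set ts" for x
    using that refl_prod_eq_0_iff[of ts x] pos by (simp add: W_def)
  then have ne: "e i \<noteq> ts ! j" if "j < m" for i j
    using eM[of i] that ts(1) \<open>0 < M\<close> nth_mem[of j ts] by force
  have e_lo: "lo i \<le> e i" for i using e0(1)[of i] lo0 by (auto simp: e_def)
  have e_hi: "e i \<le> hi i" for i
  proof (cases i)
    case 0
    then show ?thesis using hi[of 0] him nth(1)[of 0] \<alpha> by (cases m) (auto simp: e_def)
  qed (use e0(1)[of i] in \<open>simp add: e_def\<close>)
  have e_range: "e i \<in> {\<alpha>..1}" if "i \<le> m" for i
  proof -
    have "\<alpha> \<le> lo i" using that loS lo0 nth by (cases i) auto
    moreover have "hi i \<le> 1" using that hi him nth by (cases "i = m") auto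
    ultimately show ?thesis using e_lo[of i] e_hi[of i] by auto
  qed
  show ?thesis
  proof (rule that[of ts M e])
    fix i assume "i < m"
    then show "e i < ts ! i \<and> ts ! i < e (Suc i)"
      using e_hi[of i] e_lo[of "Suc i"] hi[of i] loS[of i] ne[of i i] ne[of i "Suc i"] by simp
  qed (use ts bound \<open>0 < M\<close> eM e_range in \<open>auto simp: e_def\<close>)
qed

end

text \<open>The squared extremal product is nonnegative, so it oscillates between 0 and \<open>\<mu>\<close>: its maxima are the
alternation points, its zeros are the double zeros between them and, for odd \<open>n\<close>, the simple zero
at 1. That is \<open>n + 1\<close> points for a product of \<open>n\<close> factors.\<close>

theorem equioscillating_refl_prod:
  fixes \<alpha> :: real
  assumes "0 < \<alpha>" "\<alpha> < 1" "0 < n"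
  obtains xs y \<mu> where "length xs = n" "set xs \<subseteq> {\<alpha>..1}" "0 < \<mu>"
    "\<And>x. x \<in> {\<alpha>..1} \<Longrightarrow> refl_prod xs x \<in> {0..\<mu>}" "y 0 = \<alpha>"
    "\<And>i. i \<le> n \<Longrightarrow> y i \<in> {\<alpha>..1} \<and> refl_prod xs (y i) = (if even i then \<mu> else 0)"
    "\<And>i. i < n \<Longrightarrow> y i < (y (Suc i) :: real)"
proof -
  define m where "m = n div 2"
  define v where "v x = (if even n then 1 else sqrt ((1 - x) / (1 + x)))" for x :: real
  have v2: "(v x)\<^sup>2 = (if even n then 1 else (1 - x) / (1 + x))" if "x \<in> {\<alpha>..1}" for x
    using that assms by (simp add: v_def)
  interpret extremal_refl \<alpha> v
  proof
    show "continuous_on {\<alpha>..1} v"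
      using assms by (cases "even n") (auto simp: v_def[abs_def] intro!: continuous_intros)
    show "v y \<le> v x" if "\<alpha> \<le> x" "x \<le> y" "y \<le> 1" for x y
      using that assms by (auto simp: v_def divide_simps) (simp add: algebra_simps)
  qed (use assms in \<open>auto simp: v_def divide_simps\<close>)
  obtain ts M e where ts: "length ts = m" "set ts \<subseteq> {\<alpha>..1}" "0 < M"
    "\<And>x. x \<in> {\<alpha>..1} \<Longrightarrow> \<bar>W ts x\<bar> \<le> M" "e 0 = \<alpha>"
    "\<And>i. i \<le> m \<Longrightarrow> e i \<in> {\<alpha>..1} \<and> \<bar>W ts (e i)\<bar> = M"
    "\<And>i. i < m \<Longrightarrow> e i < ts ! i \<and> ts ! i < e (Suc i)"
    using alternation[of m] by metis
  define xs where "xs = (if even n then [] else [1]) @ ts @ ts"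
  have sq: "refl_prod xs x = (W ts x)\<^sup>2" if "x \<in> {\<alpha>..1}" for x
    using v2[OF that] by (simp add: xs_def W_def power_mult_distrib power2_eq_square)
  define y where "y i = (if even i then e (i div 2) else if i div 2 < m then ts ! (i div 2) else 1)" for i
  have nth: "ts ! j \<in> {\<alpha>..1}" if "j < m" for j using that ts(1,2) nth_mem[of j ts] by blast
  have zero: "refl_prod xs x = 0" if "x \<in> set xs" for x
    using that ts(2) assms by (subst refl_prod_eq_0_iff) (auto simp: xs_def split: if_splits)
  show ?thesis
  proof (rule that[of xs "M\<^sup>2" y])
    show "length xs = n" by (auto simp: xs_def ts(1) m_def elim!: evenE oddE)
    show "set xs \<subseteq> {\<alpha>..1}" using ts(2) assms by (auto simp: xs_def)
    show "0 < M\<^sup>2" "y 0 = \<alpha>" using ts by (auto simp: y_def)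
    show "refl_prod xs x \<in> {0..M\<^sup>2}" if "x \<in> {\<alpha>..1}" for x
      using sq[OF that] ts(3) ts(4)[OF that] by (simp add: abs_le_square_iff[symmetric])
    fix i
    {
      assume "i \<le> n"
      show "y i \<in> {\<alpha>..1} \<and> refl_prod xs (y i) = (if even i then M\<^sup>2 else 0)"
      proof (cases "even i")
        case True
        then have "i div 2 \<le> m" using \<open>i \<le> n\<close> by (auto simp: m_def div_le_mono)
        then have e: "e (i div 2) \<in> {\<alpha>..1}" "\<bar>W ts (e (i div 2))\<bar> = M" using ts(6) by auto
        have "refl_prod xs (e (i div 2)) = M\<^sup>2" using sq[OF e(1)] e(2) by (metis power2_abs)
        then show ?thesis using e(1) True by (simp add: y_def)
      next
        case False
        show ?thesis
        proof (cases "i div 2 < m")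
          case True
          then show ?thesis using False nth[OF True] zero[of "ts ! (i div 2)"] ts(1) by (auto simp: y_def xs_def)
        next
          case f: False
          then have "odd n" using False \<open>i \<le> n\<close> by (auto simp: m_def elim!: evenE oddE)
          then show ?thesis using False f zero[of 1] assms by (auto simp: y_def xs_def)
        qed
      qed
    }
    assume "i < n"
    show "y i < y (Suc i)"
    proof (cases "even i")
      case True
      then obtain j where j: "i = 2 * j" by (rule evenE)
      show ?thesis
      proof (cases "j < m")
        case True
        then show ?thesis using ts(7)[OF True] j by (simp add: y_def)
      next
        case False
        then have jm: "j = m" "odd n" using \<open>i < n\<close> j by (auto simp: m_def elim!: evenE oddE)
        have "refl_prod xs (e m) \<noteq> 0" using ts(3) ts(6)[of m] sq[of "e m"] by auto
        moreover have "refl_prod xs 1 = 0" using jm by (intro zero) (simp add: xs_def)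
        ultimately have "e m \<noteq> 1" by auto
        then show ?thesis using ts(6)[of m] j jm by (auto simp: y_def)
      qed
    next
      case False
      then obtain j where j: "i = 2 * j + 1" by (rule oddE)
      then have "j < m" using \<open>i < n\<close> by (auto simp: m_def)
      then show ?thesis using ts(7)[of j] j by (simp add: y_def)
    qed
  qed
qed

section \<open>Evaluation of rational functions\<close>

lemma Fract_eq_coprime_times:
  assumes "q \<noteq> 0"
  obtains d where "d \<noteq> 0" "p = rat_num (Fract p q) * d" "q = rat_den (Fract p q) * d"
proof -
  have "Fract p q = quot_to_fract (p, q)" using assms by (simp add: quot_to_fract_def)
  then have "quot_of_fract (Fract p q) = normalize_quot (p, q)"
    by (simp add: quot_of_fract_quot_to_fract)
  then show ?thesis using normalize_quotE[OF assms, of p] that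
    unfolding rat_num_def rat_den_def by metis
qed

lemma Fract_rat_num_rat_den [simp]: "Fract (rat_num r) (rat_den r) = r"
  by (simp add: rat_num_def rat_den_def)

lemma rat_den_nonzero [simp]: "rat_den r \<noteq> 0"
  by (simp add: rat_den_def)

lemma eval_Fract:
  assumes "poly q x \<noteq> 0"
  shows "rat_eval (Fract p q) x = poly p x / poly q x" "defined_at (Fract p q) x"
proof -
  have "q \<noteq> 0" using assms by auto
  then obtain d where d: "p = rat_num (Fract p q) * d" "q = rat_den (Fract p q) * d"
    using Fract_eq_coprime_times by blast
  have "poly p x = poly (rat_num (Fract p q)) x * poly d x"
    "poly q x = poly (rat_den (Fract p q)) x * poly d x"
    using d by (metis poly_mult)+
  then show "rat_eval (Fract p q) x = poly p x / poly q x" "defined_at (Fract p q) x"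
    using assms by (auto simp: rat_eval_def defined_at_def)
qed

lemma ratfuns_degrees:
  assumes "r \<in> ratfuns m l"
  shows "degree (rat_num r) \<le> m" "degree (rat_den r) \<le> l"
proof -
  obtain p q where pq: "r = Fract p q" "q \<noteq> 0" "degree p \<le> m" "degree q \<le> l"
    using assms by (auto simp: ratfuns_def)
  obtain d where d: "d \<noteq> 0" "p = rat_num r * d" "q = rat_den r * d"
    using Fract_eq_coprime_times[OF pq(2), of p] pq(1) by metis
  have "degree (f * d) \<ge> degree f" for f :: "real poly"
    using d(1) by (cases "f = 0") (simp_all add: degree_mult_eq)
  then show "degree (rat_num r) \<le> m" "degree (rat_den r) \<le> l"
    using d(2,3) pq(3,4) by (metis le_trans)+
qed

section \<open>Even and odd parts of a product of linear factors\<close>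

text \<open>The product \<open>G(x)\<close> of the factors \<open>t + x\<close> is split as \<open>G(x) = E(x * x) + x * O(x * x)\<close>. The approximant of
the square root is \<open>E / O\<close>; as \<open>G(- x) / G(x)\<close> is the reflected product \<open>B\<close>, its value at \<open>x * x\<close> is
\<open>x * (1 + B) / (1 - B)\<close>.\<close>

fun even_part odd_part :: "real list \<Rightarrow> real poly" where
  "even_part [] = 1"
| "even_part (c # cs) = smult c (even_part cs) + pCons 0 (odd_part cs)"
| "odd_part [] = 0"
| "odd_part (c # cs) = even_part cs + smult c (odd_part cs)"

lemma degree_parts:
  "degree (even_part xs) \<le> length xs div 2 \<and> degree (odd_part xs) \<le> (length xs - 1) div 2
   \<and> (xs = [] \<longrightarrow> odd_part xs = 0)"
proof (induction xs)
  case (Cons c cs)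
  have len: "length cs div 2 \<le> length (c # cs) div 2" "(length cs - 1) div 2 \<le> length cs div 2"
    by (simp_all add: div_le_mono)
  have E: "degree (even_part cs) \<le> length cs div 2" and O: "degree (odd_part cs) \<le> (length cs - 1) div 2"
    using Cons by blast+
  have "degree (pCons 0 (odd_part cs)) \<le> length (c # cs) div 2"
  proof (cases "odd_part cs = 0")
    case False
    then have "cs \<noteq> []" using Cons by blast
    then have "Suc ((length cs - 1) div 2) = length (c # cs) div 2" by (cases cs) auto
    with False O show ?thesis by (simp add: degree_pCons_eq)
  qed simp
  moreover have "degree (smult c (even_part cs)) \<le> length (c # cs) div 2"
    using degree_smult_le[of c "even_part cs"] E len(1) by linarith
  moreover have "degree (even_part cs) \<le> (length (c # cs) - 1) div 2" using E by simp
  moreover have "degree (smult c (odd_part cs)) \<le> (length (c # cs) - 1) div 2"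
    using degree_smult_le[of c "odd_part cs"] O len(2) by simp
  ultimately show ?case by (simp add: degree_add_le)
qed simp

lemma parts_pos:
  assumes "\<And>t. t \<in> set xs \<Longrightarrow> 0 < t" "0 < z"
  shows "0 < poly (even_part xs) z" "0 \<le> poly (odd_part xs) z" "xs \<noteq> [] \<Longrightarrow> 0 < poly (odd_part xs) z"
proof -
  have "0 < poly (even_part xs) z \<and> 0 \<le> poly (odd_part xs) z \<and> (xs \<noteq> [] \<longrightarrow> 0 < poly (odd_part xs) z)"
    using assms
  proof (induction xs)
    case (Cons t ts)
    then have "0 < t" "0 < poly (even_part ts) z" "0 \<le> poly (odd_part ts) z" by auto
    then show ?case using assms(2) by (simp add: add_pos_nonneg)
  qed simp
  then show "0 < poly (even_part xs) z" "0 \<le> poly (odd_part xs) z" "xs \<noteq> [] \<Longrightarrow> 0 < poly (odd_part xs) z"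
    by auto
qed

lemma parts_refl_prod:
  assumes "\<And>t. t \<in> set xs \<Longrightarrow> 0 < t" "0 < x"
  shows "poly (even_part xs) (x\<^sup>2) - x * poly (odd_part xs) (x\<^sup>2)
       = refl_prod xs x * (poly (even_part xs) (x\<^sup>2) + x * poly (odd_part xs) (x\<^sup>2))"
  using assms(1)
proof (induction xs)
  case (Cons t ts)
  let ?E = "poly (even_part ts) (x\<^sup>2)" and ?O = "poly (odd_part ts) (x\<^sup>2)"
  have "t + x \<noteq> 0" using Cons.prems[of t] assms(2) by auto
  have IH: "?E - x * ?O = refl_prod ts x * (?E + x * ?O)" using Cons by simp
  have "poly (even_part (t # ts)) (x\<^sup>2) - x * poly (odd_part (t # ts)) (x\<^sup>2) = (t - x) * (?E - x * ?O)"
    by (simp add: algebra_simps power2_eq_square)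
  also have "\<dots> = (t - x) / (t + x) * refl_prod ts x * ((t + x) * (?E + x * ?O))"
    unfolding IH using \<open>t + x \<noteq> 0\<close> by simp
  also have "(t + x) * (?E + x * ?O)
      = poly (even_part (t # ts)) (x\<^sup>2) + x * poly (odd_part (t # ts)) (x\<^sup>2)"
    by (simp add: algebra_simps power2_eq_square)
  finally show ?case by simp
qed simp

lemma abs_refl_prod_less_one:
  assumes "\<And>t. t \<in> set xs \<Longrightarrow> 0 < t" "0 < x" "xs \<noteq> []"
  shows "\<bar>refl_prod xs x\<bar> < 1"
proof -
  let ?E = "poly (even_part xs) (x\<^sup>2)" and ?O = "poly (odd_part xs) (x\<^sup>2)"
  have "0 < ?E" "0 < x * ?O" using parts_pos[of xs "x\<^sup>2"] assms by auto
  then have "\<bar>?E - x * ?O\<bar> < ?E + x * ?O" by (auto simp: abs_if)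
  then have "\<bar>refl_prod xs x\<bar> * (?E + x * ?O) < 1 * (?E + x * ?O)"
    using parts_refl_prod[of xs x] assms \<open>0 < ?E\<close> \<open>0 < x * ?O\<close> by (simp add: abs_mult)
  then show ?thesis using \<open>0 < ?E\<close> \<open>0 < x * ?O\<close> by (subst (asm) mult_less_cancel_right_pos) auto
qed

lemma parts_quotient:
  assumes "\<And>t. t \<in> set xs \<Longrightarrow> 0 < t" "0 < x" "xs \<noteq> []"
  shows "poly (even_part xs) (x\<^sup>2) / poly (odd_part xs) (x\<^sup>2)
       = x * (1 + refl_prod xs x) / (1 - refl_prod xs x)"
    and "x * (poly (odd_part xs) (x\<^sup>2) / poly (even_part xs) (x\<^sup>2))
       = (1 - refl_prod xs x) / (1 + refl_prod xs x)"
proof -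
  let ?E = "poly (even_part xs) (x\<^sup>2)" and ?O = "poly (odd_part xs) (x\<^sup>2)" and ?B = "refl_prod xs x"
  have pos: "0 < ?E" "0 < ?O" using parts_pos[of xs "x\<^sup>2"] assms by auto
  have B: "1 - ?B \<noteq> 0" "1 + ?B \<noteq> 0" using abs_refl_prod_less_one[of xs x] assms by (auto simp: abs_less_iff)
  have eq: "?E * (1 - ?B) = x * ?O * (1 + ?B)"
    using parts_refl_prod[of xs x] assms by (simp add: algebra_simps)
  then show "?E / ?O = x * (1 + ?B) / (1 - ?B)" "x * (?O / ?E) = (1 - ?B) / (1 + ?B)"
    using pos B by (simp_all add: divide_simps mult_ac)
qed

section \<open>Uniqueness of the best approximant\<close>

text \<open>The divided difference of \<open>p\<close> over the \<open>n + 1\<close> points vanishes for degree reasons. It is the sum of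
\<open>poly p (z i)\<close> divided by a product whose sign is \<open>(- 1) ^ (n - i)\<close>, so weak alternation makes all
summands have the same sign. Hence they vanish, and \<open>p\<close> has more roots than its degree allows.
Allowing zeros at the nodes saves the usual count of double roots.\<close>

lemma alternating_poly_eq_0:
  fixes p :: "real poly" and z :: "nat \<Rightarrow> real"
  assumes deg: "degree p < n"
    and mono: "\<And>i. i < n \<Longrightarrow> z i < z (Suc i)"
    and alt: "\<And>i. i \<le> n \<Longrightarrow> 0 \<le> (- 1) ^ i * poly p (z i)"
  shows "p = 0"
proof -
  have less: "z i < z j" if "i < j" "j \<le> n" for i j
    using that
  proof (induction j)
    case (Suc j)
    then show ?case using mono[of j] by (cases "i = j") auto
  qed simp
  have inj: "inj_on z {..n}" by (rule linorder_inj_onI) (use less in \<open>force+\<close>)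
  have no_roots: "q = 0" if "degree q \<le> n" "\<And>i. i \<le> n \<Longrightarrow> poly q (z i) = 0" for q
  proof (rule ccontr)
    assume "q \<noteq> 0"
    then have "card (z ` {..n}) \<le> card {x. poly q x = 0}"
      using that(2) by (intro card_mono poly_roots_finite) auto
    then show False using card_poly_roots_bound[OF \<open>q \<noteq> 0\<close>] card_image[OF inj] that(1) by simp
  qed
  define R where "R i = (\<Prod>j\<in>{..n} - {i}. [:- z j, 1:])" for i
  have R_eval: "poly (R i) x = (\<Prod>j\<in>{..n} - {i}. x - z j)" for i x
    by (simp add: R_def poly_prod)
  have R_coeff: "coeff (R i) n = 1" "degree (R i) \<le> n" if "i \<le> n" for i
  proof -
    have "degree (R i) = (\<Sum>j\<in>{..n} - {i}. degree [:- z j, 1:])"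
      unfolding R_def by (rule degree_prod_eq_sum_degree) auto
    then have d: "degree (R i) = n" using that by simp
    have "lead_coeff (R i) = 1" unfolding R_def lead_coeff_prod by simp
    with d show "coeff (R i) n = 1" "degree (R i) \<le> n" by auto
  qed
  define w where "w i = poly (R i) (z i)" for i
  have w_sign: "0 < (- 1) ^ (n - i) * w i" if "i \<le> n" for i
  proof -
    have split: "{..n} - {i} = {..<i} \<union> {i<..n}" using that by auto
    have "(\<Prod>j\<in>{i<..n}. z i - z j) = (\<Prod>j\<in>{i<..n}. (- 1) * (z j - z i))" by simp
    also have "\<dots> = (- 1) ^ (n - i) * (\<Prod>j\<in>{i<..n}. z j - z i)"
      by (subst prod.distrib) simp
    finally have "w i = (\<Prod>j<i. z i - z j) * ((- 1) ^ (n - i) * (\<Prod>j\<in>{i<..n}. z j - z i))"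
      unfolding w_def R_eval split by (subst prod.union_disjoint) auto
    then have "(- 1) ^ (n - i) * w i
        = (\<Prod>j<i. z i - z j) * (\<Prod>j\<in>{i<..n}. z j - z i) * ((- 1) ^ (n - i) * (- 1) ^ (n - i))"
      by (simp only: mult_ac)
    also have "\<dots> = (\<Prod>j<i. z i - z j) * (\<Prod>j\<in>{i<..n}. z j - z i)"
      by (simp flip: power_mult_distrib)
    also have "\<dots> > 0" using less that by (intro mult_pos_pos prod_pos) auto
    finally show ?thesis .
  qed
  then have w0: "w i \<noteq> 0" if "i \<le> n" for i using that by force
  define L where "L = (\<Sum>i\<le>n. smult (poly p (z i) / w i) (R i))"
  have "poly L (z k) = poly p (z k)" if "k \<le> n" for k
  proof -
    have "poly L (z k) = (\<Sum>i\<le>n. if i = k then poly p (z k) else 0)"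
      unfolding L_def poly_sum
    proof (intro sum.cong refl)
      fix i assume "i \<in> {..n}"
      show "poly (smult (poly p (z i) / w i) (R i)) (z k) = (if i = k then poly p (z k) else 0)"
      proof (cases "i = k")
        case False
        then have "poly (R i) (z k) = 0" using that by (auto simp: R_eval)
        with False show ?thesis by simp
      qed (use w0 that in \<open>simp add: w_def\<close>)
    qed
    with that show ?thesis by simp
  qed
  moreover have "degree L \<le> n"
    unfolding L_def using R_coeff(2) by (intro degree_sum_le) (auto intro: order.trans[OF degree_smult_le])
  then have "degree (p - L) \<le> n" using deg by (intro degree_diff_le) auto
  ultimately have "p - L = 0" by (intro no_roots) auto
  then have "0 = coeff L n" using deg by (simp add: coeff_eq_0)
  also have "\<dots> = (\<Sum>i\<le>n. poly p (z i) / w i)" using R_coeff(1) by (simp add: L_def coeff_sum)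
  finally have "(\<Sum>i\<le>n. (- 1) ^ n * (poly p (z i) / w i)) = 0" 
    by (metis mult_zero_right sum_distrib_left)
  moreover have nonneg: "0 \<le> (- 1) ^ n * (poly p (z i) / w i)" if "i \<le> n" for i
  proof -
    have "(- 1) ^ n = ((- 1) ^ i * (- 1) ^ (n - i) :: real)" using that by (simp flip: power_add)
    then have "(- 1) ^ n * (poly p (z i) / w i)
        = ((- 1) ^ i * poly p (z i)) * ((- 1) ^ (n - i) * w i) / (w i)\<^sup>2"
      using w0[OF that] by (simp add: field_simps power2_eq_square)
    also have "\<dots> \<ge> 0" using alt[OF that] w_sign[OF that] by simp
    finally show ?thesis .
  qed
  ultimately have "\<forall>i\<in>{..n}. (- 1) ^ n * (poly p (z i) / w i) = 0"
    by (subst (asm) sum_nonneg_eq_0_iff) auto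
  then have roots: "poly p (z i) = 0" if "i \<le> n" for i using that w0[OF that] by auto
  show "p = 0" using roots deg by (intro no_roots) auto
qed

section \<open>The minimax approximant and its scaling\<close>

lemma continuous_on_rel_err:
  assumes "\<And>z. z \<in> S \<Longrightarrow> 0 < z" "\<And>z. z \<in> S \<Longrightarrow> defined_at r z"
  shows "continuous_on S (rel_err r)"
  unfolding rel_err_def[abs_def] rat_eval_def
  using assms by (intro continuous_intros) (auto simp: defined_at_def)

lemma poly_no_root_same_sign:
  fixes q :: "real poly"
  assumes "\<And>z. z \<in> {a..b} \<Longrightarrow> poly q z \<noteq> 0" "x \<in> {a..b}" "y \<in> {a..b}"
  shows "0 < poly q x * poly q y"
proof (rule ccontr)
  assume "\<not> ?thesis"
  moreover have "poly q x * poly q y \<noteq> 0" using assms by auto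
  ultimately have neg: "poly q x * poly q y < 0" by linarith
  have no: False if xy: "x \<le> y" "poly q x * poly q y < 0" "x \<in> {a..b}" "y \<in> {a..b}" for x y
  proof -
    have cont: "continuous_on {x..y} (poly q)"
      by (intro continuous_at_imp_continuous_on ballI poly_isCont)
    have "poly q x \<le> 0 \<and> 0 \<le> poly q y \<or> 0 \<le> poly q x \<and> poly q y \<le> 0"
      using xy(2) by (auto simp: mult_less_0_iff)
    then obtain z where "x \<le> z" "z \<le> y" "poly q z = 0"
      using IVT'[OF _ _ xy(1) cont] IVT2'[OF _ _ xy(1) cont] by blast
    then show False using assms(1)[of z] xy by auto
  qed
  show False
    using no[of x y] no[of y x] neg assms(2,3) by (cases "x \<le> y") (auto simp: mult.commute)
qed

text \<open>The data produced by \<open>equioscillating_refl_prod\<close>. With \<open>B\<close> oscillating between 0 and \<open>\<mu>\<close>, the relative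
error of \<open>E / O\<close> oscillates between 0 and \<open>2 * \<mu> / (1 - \<mu>)\<close>, and the factor \<open>1 - \<mu>\<close> balances
it to oscillate between \<open>- \<mu>\<close> and \<open>\<mu>\<close>.\<close>

locale zolotarev_system =
  fixes \<alpha> :: real and xs :: "real list" and y :: "nat \<Rightarrow> real" and \<mu> :: real and m l :: nat
  assumes \<alpha>: "0 < \<alpha>" "\<alpha> < 1"
    and ml: "1 \<le> m" "l \<in> {m - 1, m}"
    and len: "length xs = m + l + 1"
    and set_xs: "set xs \<subseteq> {\<alpha>..1}"
    and range: "\<And>x. x \<in> {\<alpha>..1} \<Longrightarrow> refl_prod xs x \<in> {0..\<mu>}"
    and y0: "y 0 = \<alpha>"
    and y: "\<And>i. i \<le> m + l + 1 \<Longrightarrow> y i \<in> {\<alpha>..1} \<and> refl_prod xs (y i) = (if even i then \<mu> else 0)"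
    and y_less: "\<And>i. i < m + l + 1 \<Longrightarrow> y i < y (Suc i)"
    and \<mu>_pos: "0 < \<mu>"
begin

abbreviation "E \<equiv> even_part xs"
abbreviation "O' \<equiv> odd_part xs"

lemma xs_pos: "t \<in> set xs \<Longrightarrow> 0 < t" using set_xs \<alpha> by force

lemma xs_nonempty: "xs \<noteq> []" using len by auto

lemma \<mu>_less: "\<mu> < 1"
  using abs_refl_prod_less_one[of xs \<alpha>] xs_pos \<alpha> y[of 0] y0 len by (force simp: abs_less_iff)

lemma EO_pos: "0 < z \<Longrightarrow> 0 < poly E z" "0 < z \<Longrightarrow> 0 < poly O' z"
  using parts_pos(1)[of xs z] parts_pos(3)[of xs z] xs_pos xs_nonempty by blast+

lemma O_nonzero: "O' \<noteq> 0" using EO_pos(2)[of 1] by auto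

lemma degrees: "degree E \<le> m" "degree O' \<le> l"
proof -
  have "length xs div 2 = m" "(length xs - 1) div 2 = l" using ml len by auto
  then show "degree E \<le> m" "degree O' \<le> l" using degree_parts[of xs] by auto
qed

lemma sq_interval:
  assumes "z \<in> {\<alpha>\<^sup>2..1}"
  shows "0 < z" "sqrt z \<in> {\<alpha>..1}"
  using assms \<alpha> by (auto intro: real_le_rsqrt real_le_lsqrt less_le_trans[of 0 "\<alpha>\<^sup>2"])

lemma eval_scaled:
  assumes "z \<in> {\<alpha>\<^sup>2..1}"
  shows "defined_at (Fract (smult c E) O') z"
    and "rel_err (Fract (smult c E) O') z
       = c * ((1 + refl_prod xs (sqrt z)) / (1 - refl_prod xs (sqrt z))) - 1"
proof -
  note z = sq_interval[OF assms]
  have nz: "poly O' z \<noteq> 0" using EO_pos(2)[OF z(1)] by simp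
  show "defined_at (Fract (smult c E) O') z" by (rule eval_Fract(2)[OF nz])
  have "poly E z / poly O' z = sqrt z * (1 + refl_prod xs (sqrt z)) / (1 - refl_prod xs (sqrt z))"
    using parts_quotient(1)[of xs "sqrt z", OF xs_pos _ xs_nonempty] z by simp
  then have "rat_eval (Fract (smult c E) O') z
      = c * (sqrt z * (1 + refl_prod xs (sqrt z)) / (1 - refl_prod xs (sqrt z)))"
    unfolding eval_Fract(1)[OF nz] poly_smult by (simp flip: times_divide_eq_right)
  then show "rel_err (Fract (smult c E) O') z
       = c * ((1 + refl_prod xs (sqrt z)) / (1 - refl_prod xs (sqrt z))) - 1"
    using z(1) by (simp add: rel_err_def diff_divide_distrib)
qed

definition best :: ratfun where "best = Fract (smult (1 - \<mu>) E) O'"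

lemma best_in: "best \<in> ratfuns m l"
  unfolding best_def ratfuns_def using degrees O_nonzero degree_smult_le[of "1 - \<mu>" E] by force

lemma best_defined: "z \<in> {\<alpha>\<^sup>2..1} \<Longrightarrow> defined_at best z"
  unfolding best_def by (rule eval_scaled(1))

lemma best_err_bound:
  assumes "z \<in> {\<alpha>\<^sup>2..1}"
  shows "\<bar>rel_err best z\<bar> \<le> \<mu>"
proof -
  define B where "B = refl_prod xs (sqrt z)"
  have B: "0 \<le> B" "B \<le> \<mu>" "B < 1"
    using range[OF sq_interval(2)[OF assms]] \<mu>_less by (auto simp: B_def)
  have "1 \<le> (1 + B) / (1 - B)" using B by simp
  then have "(1 - \<mu>) * 1 \<le> (1 - \<mu>) * ((1 + B) / (1 - B))" using \<mu>_less by (intro mult_left_mono) auto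
  moreover have "(1 - \<mu>) * ((1 + B) / (1 - B)) \<le> 1 + \<mu>"
    using B \<mu>_less by (simp add: divide_simps) (simp add: algebra_simps)
  ultimately show ?thesis unfolding best_def eval_scaled(2)[OF assms] by (simp add: abs_le_iff B_def)
qed

lemma y_sq:
  assumes "i \<le> m + l + 1"
  shows "(y i)\<^sup>2 \<in> {\<alpha>\<^sup>2..1}" "0 < y i" "sqrt ((y i)\<^sup>2) = y i"
  using y[OF assms] \<alpha> by (auto intro!: power_mono power_le_one)

lemma best_err_alternates:
  assumes "i \<le> m + l + 1"
  shows "rel_err best ((y i)\<^sup>2) = (- 1) ^ i * \<mu>"
proof -
  have "rel_err best ((y i)\<^sup>2) = (1 - \<mu>) * ((1 + refl_prod xs (y i)) / (1 - refl_prod xs (y i))) - 1"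
    using eval_scaled(2)[OF y_sq(1)[OF assms], of "1 - \<mu>"] unfolding best_def y_sq(3)[OF assms] .
  then show ?thesis using y[OF assms] \<mu>_less by simp
qed

text \<open>For a competitor with error at most \<open>\<mu>\<close>, the difference to the balanced approximant alternates weakly at
the points \<open>(y i)\<^sup>2\<close>. Its numerator has degree at most \<open>m + l\<close>, hence vanishes.\<close>

lemma best_unique:
  assumes s: "s \<in> ratfuns m l" "\<And>z. z \<in> {\<alpha>\<^sup>2..1} \<Longrightarrow> defined_at s z"
    and err: "\<And>z. z \<in> {\<alpha>\<^sup>2..1} \<Longrightarrow> \<bar>rel_err s z\<bar> \<le> \<mu>"
  shows "s = best"
proof -
  \<comment> \<open>The factor \<open>\<sigma>\<close> turns the constant sign of the denominator of \<open>s\<close> on the interval into a positive one.\<close>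
  define P Q \<sigma> p where "P = rat_num s" and "Q = rat_den s" and "\<sigma> = poly Q 1"
    and "p = smult \<sigma> (smult (1 - \<mu>) E * Q - P * O')"
  have Q: "poly Q z \<noteq> 0" if "z \<in> {\<alpha>\<^sup>2..1}" for z using s(2)[OF that] by (simp add: defined_at_def Q_def)
  have one: "1 \<in> {\<alpha>\<^sup>2..1}" using \<alpha> by (simp add: power_le_one)
  have \<sigma>Q: "0 < \<sigma> * poly Q z" if "z \<in> {\<alpha>\<^sup>2..1}" for z
    unfolding \<sigma>_def using Q by (rule poly_no_root_same_sign[OF _ one that])
  have deg: "degree P \<le> m" "degree Q \<le> l" using ratfuns_degrees[OF s(1)] by (auto simp: P_def Q_def)
  have "degree (smult (1 - \<mu>) E * Q) \<le> m + l"
    using degree_mult_le[of "smult (1 - \<mu>) E" Q] degree_smult_le[of "1 - \<mu>" E] degrees deg by linarith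
  moreover have "degree (P * O') \<le> m + l" using degree_mult_le[of P O'] degrees deg by linarith
  ultimately have "degree p \<le> m + l"
    unfolding p_def by (intro order.trans[OF degree_smult_le] degree_diff_le)
  have "p = 0"
  proof (rule alternating_poly_eq_0)
    show "degree p < m + l + 1" using \<open>degree p \<le> m + l\<close> by simp
    show "(y i)\<^sup>2 < (y (Suc i))\<^sup>2" if "i < m + l + 1" for i
      using y_less[OF that] y_sq(2)[of i] that by (intro power_strict_mono) auto
    fix i assume i: "i \<le> m + l + 1"
    define z where "z = (y i)\<^sup>2"
    note z = y_sq(1)[OF i, folded z_def]
    have z0: "0 < z" "0 < poly O' z" using sq_interval[OF z] EO_pos by auto
    have "rat_eval best z = poly (smult (1 - \<mu>) E) z / poly O' z"
      unfolding best_def using z0 by (intro eval_Fract) auto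
    then have b: "poly (smult (1 - \<mu>) E) z = rat_eval best z * poly O' z" using z0 by simp
    have s': "poly P z = rat_eval s z * poly Q z"
      using Q[OF z] by (simp add: rat_eval_def P_def Q_def)
    have "poly p z = \<sigma> * poly Q z * poly O' z * (rat_eval best z - rat_eval s z)"
      unfolding p_def poly_smult[of \<sigma>] poly_diff poly_mult b s' by (simp add: algebra_simps)
    also have "rat_eval best z - rat_eval s z = sqrt z * (rel_err best z - rel_err s z)"
      using z0 by (simp add: rel_err_def field_simps)
    finally have "(- 1) ^ i * poly p z
        = \<sigma> * poly Q z * poly O' z * sqrt z * ((- 1) ^ i * (rel_err best z - rel_err s z))"
      by (simp only: mult_ac)
    also have "(- 1) ^ i * (rel_err best z - rel_err s z) = \<mu> - (- 1) ^ i * rel_err s z"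
      using best_err_alternates[OF i] by (simp add: z_def right_diff_distrib flip: mult.assoc power_mult_distrib)
    also have "0 \<le> \<sigma> * poly Q z * poly O' z * sqrt z * (\<mu> - (- 1) ^ i * rel_err s z)"
    proof -
      have "\<bar>(- 1) ^ i * rel_err s z\<bar> \<le> \<mu>" using err[OF z] by (simp add: abs_mult)
      then have "0 \<le> \<mu> - (- 1) ^ i * rel_err s z" by linarith
      then show ?thesis using \<sigma>Q[OF z] z0 by simp
    qed
    finally show "0 \<le> (- 1) ^ i * poly p ((y i)\<^sup>2)" by (simp add: z_def)
  qed
  moreover have "\<sigma> \<noteq> 0" using Q[OF one] by (simp add: \<sigma>_def)
  ultimately have "P * O' = smult (1 - \<mu>) E * Q" by (simp add: p_def)
  then have "Fract P Q = Fract (smult (1 - \<mu>) E) O'"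
    using O_nonzero by (simp add: eq_fract Q_def)
  then show ?thesis by (simp add: best_def P_def Q_def)
qed

lemma interval_nonempty: "{\<alpha>\<^sup>2..1} \<noteq> {}" "\<alpha>\<^sup>2 \<in> {\<alpha>\<^sup>2..1}"
  using \<alpha> by (auto simp: power_le_one)

lemma abs_rel_err_le_max:
  assumes "\<And>z. z \<in> {\<alpha>\<^sup>2..1} \<Longrightarrow> defined_at s z" "z \<in> {\<alpha>\<^sup>2..1}"
  shows "\<bar>rel_err s z\<bar> \<le> max_rel_err \<alpha> s"
proof -
  have "continuous_on {\<alpha>\<^sup>2..1} (\<lambda>z. \<bar>rel_err s z\<bar>)"
    using assms(1) sq_interval(1) by (intro continuous_intros continuous_on_rel_err) auto
  then have "compact ((\<lambda>z. \<bar>rel_err s z\<bar>) ` {\<alpha>\<^sup>2..1})"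
    by (rule compact_continuous_image) (rule compact_Icc)
  then have "bdd_above ((\<lambda>z. \<bar>rel_err s z\<bar>) ` {\<alpha>\<^sup>2..1})"
    by (intro bounded_imp_bdd_above compact_imp_bounded)
  then show ?thesis unfolding max_rel_err_def by (rule cSUP_upper[OF assms(2)])
qed

lemma max_rel_err_best: "max_rel_err \<alpha> best = \<mu>"
  unfolding max_rel_err_def
proof (rule cSup_eq_maximum)
  have "\<bar>rel_err best (\<alpha>\<^sup>2)\<bar> = \<mu>" using best_err_alternates[of 0] \<mu>_pos by (simp add: y0)
  then show "\<mu> \<in> (\<lambda>z. \<bar>rel_err best z\<bar>) ` {\<alpha>\<^sup>2..1}" using interval_nonempty by (metis image_eqI)
qed (use best_err_bound in auto)

lemma minimax_iff_best: "minimax m l \<alpha> r \<longleftrightarrow> r = best"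
proof -
  have eq: "s = best" if "s \<in> ratfuns m l" "\<And>z. z \<in> {\<alpha>\<^sup>2..1} \<Longrightarrow> defined_at s z" "max_rel_err \<alpha> s \<le> \<mu>" for s
    using that abs_rel_err_le_max by (intro best_unique) (auto intro: order.trans)
  have "minimax m l \<alpha> best"
    unfolding minimax_def max_rel_err_best
  proof (intro conjI ballI impI)
    fix s assume "s \<in> ratfuns m l" "\<forall>z\<in>{\<alpha>\<^sup>2..1}. defined_at s z"
    then show "\<mu> \<le> max_rel_err \<alpha> s" using eq[of s] max_rel_err_best by (cases "max_rel_err \<alpha> s \<le> \<mu>") auto
  qed (use best_in best_defined in auto)
  moreover have "r = best" if "minimax m l \<alpha> r"
  proof (rule eq)
    show "r \<in> ratfuns m l" "\<And>z. z \<in> {\<alpha>\<^sup>2..1} \<Longrightarrow> defined_at r z" using that by (auto simp: minimax_def)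
    have "max_rel_err \<alpha> r \<le> max_rel_err \<alpha> best"
      using that best_in best_defined unfolding minimax_def by blast
    then show "max_rel_err \<alpha> r \<le> \<mu>" by (simp add: max_rel_err_best)
  qed
  ultimately show ?thesis by blast
qed

lemma zolo_eq: "zolo m l \<alpha> = best"
  unfolding zolo_def minimax_iff_best by simp

lemma INF_rel_err_scaled:
  assumes "(INF z\<in>{\<alpha>\<^sup>2..1}. rel_err (Fract (smult c E) O') z) = 0"
  shows "c = 1"
proof -
  let ?f = "\<lambda>z. rel_err (Fract (smult c E) O') z"
  have ge: "1 \<le> (1 + refl_prod xs (sqrt z)) / (1 - refl_prod xs (sqrt z))" if "z \<in> {\<alpha>\<^sup>2..1}" for z
    using range[OF sq_interval(2)[OF that]] \<mu>_less by simp
  have y1: "(y 1)\<^sup>2 \<in> {\<alpha>\<^sup>2..1}" "?f ((y 1)\<^sup>2) = c - 1"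
    using y_sq[of 1] eval_scaled(2)[of "(y 1)\<^sup>2" c] y[of 1] ml by auto
  show "c = 1"
  proof (cases "0 \<le> c")
    case True
    have "(INF z\<in>{\<alpha>\<^sup>2..1}. ?f z) = c - 1"
    proof (rule cInf_eq_minimum)
      show "c - 1 \<in> ?f ` {\<alpha>\<^sup>2..1}" using y1 by (metis image_eqI)
      fix w assume "w \<in> ?f ` {\<alpha>\<^sup>2..1}"
      then show "c - 1 \<le> w" using eval_scaled(2) ge True mult_left_mono[OF ge True] by auto
    qed
    with assms show ?thesis by simp
  next
    case False
    have "continuous_on {\<alpha>\<^sup>2..1} ?f"
      using eval_scaled(1) sq_interval(1) by (intro continuous_on_rel_err) auto
    then have "bdd_below (?f ` {\<alpha>\<^sup>2..1})"
      by (intro bounded_imp_bdd_below compact_imp_bounded compact_continuous_image) auto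
    from cINF_lower[OF this y1(1)] show ?thesis using assms y1(2) False by simp
  qed
qed

lemma INF_rel_err_hat: "(INF z\<in>{\<alpha>\<^sup>2..1}. rel_err (Fract E O') z) = 0"
proof (rule cInf_eq_minimum)
  have "rel_err (Fract E O') ((y 1)\<^sup>2) = 0"
    using eval_scaled(2)[of "(y 1)\<^sup>2" 1] y[of 1] y_sq[of 1] ml by simp
  then show "0 \<in> rel_err (Fract E O') ` {\<alpha>\<^sup>2..1}" using y_sq(1)[of 1] ml by force
  fix w assume "w \<in> rel_err (Fract E O') ` {\<alpha>\<^sup>2..1}"
  then obtain z where z: "z \<in> {\<alpha>\<^sup>2..1}" "w = rel_err (Fract E O') z" by auto
  have "1 \<le> (1 + refl_prod xs (sqrt z)) / (1 - refl_prod xs (sqrt z))"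
    using range[OF sq_interval(2)[OF z(1)]] \<mu>_less by simp
  then show "0 \<le> w" using eval_scaled(2)[OF z(1), of 1] z(2) by simp
qed

lemma zolo_hat_eq: "zolo_hat m l \<alpha> = Fract E O'"
  unfolding zolo_hat_def zolo_eq
proof (rule the_equality)
  have mult: "Fract [:c:] 1 * best = Fract (smult (c * (1 - \<mu>)) E) O'" for c
    by (simp add: best_def mult.commute)
  have "Fract E O' = Fract [:1 / (1 - \<mu>):] 1 * best"
    unfolding mult using \<mu>_less by simp
  then show "(\<exists>c. Fract E O' = Fract [:c:] 1 * best) \<and> (INF z\<in>{\<alpha>\<^sup>2..1}. rel_err (Fract E O') z) = 0"
    using INF_rel_err_hat by blast
  fix s assume "(\<exists>c. s = Fract [:c:] 1 * best) \<and> (INF z\<in>{\<alpha>\<^sup>2..1}. rel_err s z) = 0"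
  then obtain c where c: "s = Fract (smult (c * (1 - \<mu>)) E) O'" "(INF z\<in>{\<alpha>\<^sup>2..1}. rel_err s z) = 0"
    unfolding mult by blast
  have "c * (1 - \<mu>) = 1" by (rule INF_rel_err_scaled) (use c in simp)
  then show "s = Fract E O'" unfolding c(1) by (simp only: smult_1_left)
qed

lemma zolo_h_eq: "zolo_h l m \<alpha> = Fract O' E"
  unfolding zolo_h_def zolo_hat_eq by (rule inverse_fract)

end

text \<open>All that the convergence proof needs to know about the Zolotarev functions. In terms of \<open>x\<close> with
\<open>z = x * x\<close>, one step of the iteration is the map \<open>x \<mapsto> (1 - B) / (1 + B)\<close>, that is,
\<open>w \<mapsto> B\<close> in the coordinate \<open>w = (1 - x) / (1 + x)\<close>.\<close>

theorem zolo_h_structure: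
  assumes "0 < \<alpha>" "\<alpha> < 1" "1 \<le> m" "l \<in> {m - 1, m}"
  obtains xs where "length xs = m + l + 1" "set xs \<subseteq> {\<alpha>..1}"
    "\<And>x. x \<in> {\<alpha>..1} \<Longrightarrow> refl_prod xs x \<in> {0..refl_prod xs \<alpha>}" "0 < refl_prod xs \<alpha>"
    "zolo_h l m \<alpha> = Fract (odd_part xs) (even_part xs)"
proof -
  show ?thesis
  proof (rule equioscillating_refl_prod[OF assms(1,2)])
    show "0 < m + l + 1" by simp
  next
    fix xs y \<mu>
    assume *: "length xs = m + l + 1" "set xs \<subseteq> {\<alpha>..1}" "0 < \<mu>"
      "\<And>x. x \<in> {\<alpha>..1} \<Longrightarrow> refl_prod xs x \<in> {0..\<mu>}" "y 0 = \<alpha>"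
      "\<And>i. i \<le> m + l + 1 \<Longrightarrow> y i \<in> {\<alpha>..1} \<and> refl_prod xs (y i) = (if even i then \<mu> else 0)"
      "\<And>i. i < m + l + 1 \<Longrightarrow> y i < y (Suc i)"
    interpret zolotarev_system \<alpha> xs y \<mu> m l
      using assms * by unfold_locales auto
    have "refl_prod xs \<alpha> = \<mu>" using *(5) *(6)[of 0] by simp
    with * zolo_h_eq show ?thesis using that[of xs] by simp
  qed
qed

section \<open>The Pade approximant\<close>

lemma poly_bigo_power_eq_0:
  fixes p :: "real poly"
  assumes deg: "degree p < n" and bigo: "poly p \<in> O[at a](\<lambda>z. (z - a) ^ n)"
  shows "p = 0"
proof (rule ccontr)
  assume "p \<noteq> 0"
  define k where "k = order a p"
  obtain q where q: "p = [:- a, 1:] ^ k * q" "\<not> [:- a, 1:] dvd q"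
    using order_decomp[OF \<open>p \<noteq> 0\<close>] unfolding k_def by blast
  have "k \<le> degree p" unfolding k_def by (rule order_degree[OF \<open>p \<noteq> 0\<close>])
  then have "k < n" using deg by simp
  obtain c where c: "\<forall>\<^sub>F z in at a. norm (poly p z) \<le> c * norm ((z - a) ^ n)"
    using bigo by (elim landau_o.bigE)
  have ev: "\<forall>\<^sub>F z in at a. norm (poly q z) \<le> norm (c * \<bar>z - a\<bar> ^ (n - k))"
    using c eventually_neq_at_within[of a a UNIV]
  proof eventually_elim
    case (elim z)
    have "\<bar>z - a\<bar> ^ n = \<bar>z - a\<bar> ^ k * \<bar>z - a\<bar> ^ (n - k)" using \<open>k < n\<close> by (simp flip: power_add)
    then have "\<bar>z - a\<bar> ^ k * \<bar>poly q z\<bar> \<le> \<bar>z - a\<bar> ^ k * (c * \<bar>z - a\<bar> ^ (n - k))"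
      using elim(1) by (simp add: q(1) abs_mult power_abs mult_ac)
    then have "\<bar>poly q z\<bar> \<le> c * \<bar>z - a\<bar> ^ (n - k)" using elim(2) by (simp add: mult_le_cancel_left_pos)
    then show ?case by simp
  qed
  have "((\<lambda>z. c * \<bar>z - a\<bar> ^ (n - k)) \<longlongrightarrow> c * \<bar>a - a\<bar> ^ (n - k)) (at a)"
    by (intro tendsto_intros)
  then have "((\<lambda>z. c * \<bar>z - a\<bar> ^ (n - k)) \<longlongrightarrow> 0) (at a)" using \<open>k < n\<close> by (simp add: power_0_left)
  then have "(poly q \<longlongrightarrow> 0) (at a)"
    using Lim_null_comparison[OF ev] tendsto_norm_zero by blast
  moreover have "(poly q \<longlongrightarrow> poly q a) (at a)" using isCont_def poly_isCont by blast
  ultimately have "poly q a = 0" using tendsto_unique[OF at_neq_bot] by blast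
  with q(2) show False by (simp add: poly_eq_0_iff_dvd)
qed

lemma refl_prod_replicate: "refl_prod (replicate n t) x = ((t - x) / (t + x)) ^ n"
  by (induction n) simp_all

text \<open>If all zeros are equal to 1 then \<open>B = w ^ n\<close> with \<open>w = (1 - x) / (1 + x)\<close>, and the error is
\<open>- 2 * x * B / (1 - B)\<close>, of order \<open>(x - 1) ^ n\<close>. The Pade approximant is thus the confluent case of
the Zolotarev construction.\<close>

lemma pade_error:
  fixes n :: nat
  defines "xs \<equiv> replicate n (1::real)"
  assumes "0 < n"
  shows "(\<lambda>z. sqrt z - poly (even_part xs) z / poly (odd_part xs) z) \<in> O[at 1](\<lambda>z. (z - 1) ^ n)"
proof (rule landau_o.bigI)
  show "(6::real) > 0" by simp
  have "\<forall>\<^sub>F z in at 1. z \<in> {1/4<..<4::real}"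
    by (rule eventually_at_in_open') auto
  then show "\<forall>\<^sub>F z in at 1. norm (sqrt z - poly (even_part xs) z / poly (odd_part xs) z)
      \<le> 6 * norm ((z - 1) ^ n)"
  proof eventually_elim
    case (elim z)
    define x w B where "x = sqrt z" and "w = (1 - x) / (1 + x)" and "B = w ^ n"
    have x2: "x\<^sup>2 = z" "0 \<le> x" using elim by (simp_all add: x_def)
    have "(1 / 2)\<^sup>2 < x\<^sup>2" "x\<^sup>2 < 2\<^sup>2" unfolding x2(1) using elim by (simp_all add: power2_eq_square)
    then have x: "1 / 2 < x" "x < 2" "x\<^sup>2 = z"
      using power2_less_imp_less[OF _ x2(2), of "1 / 2"] power2_less_imp_less[of x 2] x2(1) by simp_all
    have w: "\<bar>w\<bar> \<le> 1 / 3" using x by (simp add: w_def divide_simps abs_if)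
    have "w * (1 + x)\<^sup>2 = 1 - z"
      using x by (simp add: w_def power2_eq_square flip: x(3)) (simp add: algebra_simps)
    then have "\<bar>z - 1\<bar> = \<bar>w\<bar> * (1 + x)\<^sup>2" by (metis abs_minus_commute abs_mult abs_power2)
    also have "\<dots> \<ge> \<bar>w\<bar> * 1" using x by (intro mult_left_mono one_le_power) auto
    finally have wz: "\<bar>w\<bar> ^ n \<le> \<bar>z - 1\<bar> ^ n" by (intro power_mono) auto
    have "\<bar>B\<bar> \<le> \<bar>w\<bar> ^ 1" unfolding B_def power_abs using w \<open>0 < n\<close> by (intro power_decreasing) auto
    then have B: "\<bar>B\<bar> \<le> 1 / 3" using w by simp
    have "refl_prod xs x = B" by (simp add: xs_def refl_prod_replicate B_def w_def)
    then have "poly (even_part xs) z / poly (odd_part xs) z = x * (1 + B) / (1 - B)"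
      using parts_quotient(1)[of xs x] x \<open>0 < n\<close> by (auto simp: xs_def)
    then have "sqrt z - poly (even_part xs) z / poly (odd_part xs) z = - (2 * x * B / (1 - B))"
      using B by (simp add: x_def[symmetric] field_simps)
    also have "norm \<dots> = 2 * x * \<bar>B\<bar> / (1 - B)" using x B by (simp add: abs_mult)
    also have "\<dots> \<le> 4 * \<bar>B\<bar> / (2 / 3)" using x B by (intro frac_le mult_right_mono) auto
    also have "\<dots> \<le> 6 * norm ((z - 1) ^ n)" using wz by (simp add: B_def power_abs)
    finally show ?case .
  qed
qed

theorem pade_q_eq:
  assumes "1 \<le> m" "l \<in> {m - 1, m}"
  defines "xs \<equiv> replicate (m + l + 1) (1::real)"
  shows "pade_q l m = Fract (odd_part xs) (even_part xs)"
proof -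
  let ?n = "m + l + 1"
  have pos: "0 < poly (even_part xs) 1" "0 < poly (odd_part xs) 1"
  proof -
    have "\<And>t. t \<in> set xs \<Longrightarrow> 0 < t" "xs \<noteq> []" by (auto simp: xs_def)
    then show "0 < poly (even_part xs) 1" "0 < poly (odd_part xs) 1"
      using parts_pos(1)[of xs 1] parts_pos(3)[of xs 1] by auto
  qed
  have nz: "odd_part xs \<noteq> 0" using pos by auto
  have pade: "(\<lambda>z. sqrt z - poly (even_part xs) z / poly (odd_part xs) z) \<in> O[at 1](\<lambda>z. (z - 1) ^ ?n)"
    unfolding xs_def by (rule pade_error) simp
  have "length xs div 2 = m" "(length xs - 1) div 2 = l" using assms(1,2) by (auto simp: xs_def)
  then have deg: "degree (even_part xs) \<le> m" "degree (odd_part xs) \<le> l" using degree_parts[of xs] by auto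
  have ev: "\<forall>\<^sub>F z in at 1. poly q z \<noteq> 0" if "poly q 1 \<noteq> 0" for q :: "real poly"
  proof -
    have "(poly q \<longlongrightarrow> poly q 1) (at 1)" using isCont_def poly_isCont by blast
    then show ?thesis by (rule tendsto_imp_eventually_ne[OF _ that])
  qed
  have "pade_sqrt m l = Fract (even_part xs) (odd_part xs)"
    unfolding pade_sqrt_def
  proof (rule the_equality, intro conjI)
    show "Fract (even_part xs) (odd_part xs) \<in> ratfuns m l"
      using deg nz by (auto simp: ratfuns_def)
    show "defined_at (Fract (even_part xs) (odd_part xs)) 1" using pos by (intro eval_Fract) auto
    have "\<forall>\<^sub>F z in at 1. sqrt z - poly (even_part xs) z / poly (odd_part xs) z
        = sqrt z - rat_eval (Fract (even_part xs) (odd_part xs)) z"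
      using ev[of "odd_part xs"] pos by (auto elim!: eventually_mono simp: eval_Fract)
    then show "(\<lambda>z. sqrt z - rat_eval (Fract (even_part xs) (odd_part xs)) z) \<in> O[at 1](\<lambda>z. (z - 1) ^ ?n)"
      using pade by (subst landau_o.big.in_cong[symmetric]) auto
  next
    fix s assume "s \<in> ratfuns m l \<and> defined_at s 1 \<and> (\<lambda>z. sqrt z - rat_eval s z) \<in> O[at 1](\<lambda>z. (z - 1) ^ ?n)"
    then have s: "s \<in> ratfuns m l" "poly (rat_den s) 1 \<noteq> 0"
      "(\<lambda>z. sqrt z - rat_eval s z) \<in> O[at 1](\<lambda>z. (z - 1) ^ ?n)"
      by (auto simp: defined_at_def)
    define P Q p where "P = rat_num s" and "Q = rat_den s" and "p = even_part xs * Q - P * odd_part xs"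
    have dPQ: "degree P \<le> m" "degree Q \<le> l" using ratfuns_degrees[OF s(1)] by (auto simp: P_def Q_def)
    have "degree (even_part xs * Q) \<le> m + l" "degree (P * odd_part xs) \<le> m + l"
      using degree_mult_le[of "even_part xs" Q] degree_mult_le[of P "odd_part xs"] deg dPQ by linarith+
    then have "degree p < ?n" unfolding p_def using degree_diff_le by (metis Suc_eq_plus1 le_imp_less_Suc)
    moreover have "poly p \<in> O[at 1](\<lambda>z. (z - 1) ^ ?n)"
    proof -
      let ?D = "\<lambda>z. (sqrt z - rat_eval s z) - (sqrt z - poly (even_part xs) z / poly (odd_part xs) z)"
      have D: "?D \<in> O[at 1](\<lambda>z. (z - 1) ^ ?n)"
        using s(3) pade unfolding xs_def by (rule sum_in_bigo(2))
      have "((\<lambda>z. poly (odd_part xs) z * poly Q z) \<longlongrightarrow> poly (odd_part xs) 1 * poly Q 1) (at 1)"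
        by (intro tendsto_intros)
      then have "(\<lambda>z. poly (odd_part xs) z * poly Q z) \<in> O[at 1](\<lambda>_. 1)"
        by (intro bigoI_tendsto[of _ _ "poly (odd_part xs) 1 * poly Q 1"]) auto
      from landau_o.big_mult[OF this D]
      have "(\<lambda>z. poly (odd_part xs) z * poly Q z * ?D z) \<in> O[at 1](\<lambda>z. (z - 1) ^ ?n)" by simp
      moreover have "\<forall>\<^sub>F z in at 1. poly (odd_part xs) z * poly Q z * ?D z = poly p z"
        using ev[of "odd_part xs"] ev[of Q] pos s(2)
        by (auto simp: Q_def[symmetric] intro: eventually_elim2
              simp: p_def rat_eval_def P_def[symmetric] field_simps)
      ultimately show ?thesis by (subst landau_o.big.in_cong[symmetric]) auto
    qed
    ultimately have "p = 0" by (rule poly_bigo_power_eq_0)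
    then have "Fract P Q = Fract (even_part xs) (odd_part xs)"
      using nz by (simp add: p_def eq_fract Q_def)
    then show "s = Fract (even_part xs) (odd_part xs)" by (simp add: P_def Q_def)
  qed
  then show ?thesis by (simp add: pade_q_def)
qed

section \<open>The scalar iteration\<close>

lemma refl_prod_left_end_le:
  assumes "0 < \<alpha>" "\<alpha> < 1" "set xs \<subseteq> {\<alpha>..1}"
  shows "0 \<le> refl_prod xs \<alpha> \<and> refl_prod xs \<alpha> \<le> ((1 - \<alpha>) / (1 + \<alpha>)) ^ length xs"
  using assms(3)
proof (induction xs)
  case (Cons t ts)
  have "0 \<le> (t - \<alpha>) / (t + \<alpha>)" "(t - \<alpha>) / (t + \<alpha>) \<le> (1 - \<alpha>) / (1 + \<alpha>)"
    using Cons.prems assms(1,2) by (simp_all add: divide_simps) (simp add: algebra_simps)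
  moreover have "0 \<le> refl_prod ts \<alpha>" "refl_prod ts \<alpha> \<le> ((1 - \<alpha>) / (1 + \<alpha>)) ^ length ts"
    using Cons by auto
  ultimately have "0 \<le> (t - \<alpha>) / (t + \<alpha>) * refl_prod ts \<alpha>
      \<and> (t - \<alpha>) / (t + \<alpha>) * refl_prod ts \<alpha> \<le> (1 - \<alpha>) / (1 + \<alpha>) * ((1 - \<alpha>) / (1 + \<alpha>)) ^ length ts"
    using assms(1,2) by (intro conjI mult_nonneg_nonneg mult_mono) auto
  then show ?case by (simp only: refl_prod_simps list.size power_Suc add_0_right add_Suc_right)
qed simp

lemma point_far_from_list:
  fixes p q :: real
  assumes "p < q"
  shows "\<exists>y\<in>{p..q}. \<forall>t\<in>set ts. (q - p) / (2 * 3 ^ length ts) \<le> \<bar>y - t\<bar>"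
  using assms
proof (induction ts arbitrary: p q)
  case Nil
  then show ?case by (auto intro: bexI[of _ p])
next
  case (Cons t ts)
  define h where "h = (q - p) / 3"
  have h: "0 < h" "q = p + 3 * h" using Cons.prems by (auto simp: h_def)
  define p' where "p' = (if t \<le> (p + q) / 2 then q - h else p)"
  have p': "{p'..p' + h} \<subseteq> {p..q}" "\<And>y. y \<in> {p'..p' + h} \<Longrightarrow> h / 2 \<le> \<bar>y - t\<bar>"
    using h by (auto simp: p'_def abs_if split: if_splits)
  obtain y where y: "y \<in> {p'..p' + h}" "\<forall>s\<in>set ts. h / (2 * 3 ^ length ts) \<le> \<bar>y - s\<bar>"
    using Cons.IH[of p' "p' + h"] h(1) by auto
  have "h / (2 * 3 ^ length ts) \<le> h / 2"
    using h(1) by (intro divide_left_mono) auto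
  then have "\<forall>s\<in>set (t # ts). h / (2 * 3 ^ length ts) \<le> \<bar>y - s\<bar>"
    using y p'(2)[OF y(1)] by auto
  moreover have "h / (2 * 3 ^ length ts) = (q - p) / (2 * 3 ^ length (t # ts))" by (simp add: h_def)
  ultimately show ?case using y(1) p'(1) by (metis subsetD)
qed

text \<open>The maximum over the interval is at least the value at any point that keeps a distance proportional
to \<open>1 - \<alpha>\<close> from all zeros. The constant is far from the Chebyshev bound, but only the exponent
matters for the order of convergence.\<close>

lemma refl_prod_left_end_ge:
  assumes "0 < \<alpha>" "\<alpha> < 1" "set xs \<subseteq> {\<alpha>..1}"
    and max: "\<And>x. x \<in> {\<alpha>..1} \<Longrightarrow> refl_prod xs x \<in> {0..refl_prod xs \<alpha>}"
  shows "(1 / (4 * 3 ^ length xs)) ^ length xs * (1 - \<alpha>) ^ length xs \<le> refl_prod xs \<alpha>"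
proof -
  define d where "d = (1 - \<alpha>) / (2 * 3 ^ length xs)"
  obtain y where y: "y \<in> {\<alpha>..1}" "\<forall>t\<in>set xs. d \<le> \<bar>y - t\<bar>"
    using point_far_from_list[OF assms(2), of xs] unfolding d_def by blast
  have d0: "0 \<le> d" using assms by (simp add: d_def)
  have "(d / 2) ^ length ts \<le> \<bar>refl_prod ts y\<bar>" if "set ts \<subseteq> set xs" for ts
    using that
  proof (induction ts)
    case (Cons t ts)
    have t: "t \<in> {\<alpha>..1}" "d \<le> \<bar>y - t\<bar>" using Cons.prems assms(3) y(2) by auto
    have "d / 2 \<le> \<bar>t - y\<bar> / (t + y)"
      using t y(1) assms(1) d0 by (intro frac_le) auto
    then have "d / 2 * (d / 2) ^ length ts \<le> \<bar>(t - y) / (t + y)\<bar> * \<bar>refl_prod ts y\<bar>"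
      using Cons t y(1) assms(1) d0 by (intro mult_mono) auto
    then show ?case by (simp only: list.size refl_prod_simps abs_mult power_Suc add_0_right add_Suc_right)
  qed simp
  then have "(d / 2) ^ length xs \<le> \<bar>refl_prod xs y\<bar>" by blast
  also have "\<dots> \<le> refl_prod xs \<alpha>" using max[OF y(1)] by auto
  also have "d / 2 = 1 / (4 * 3 ^ length xs) * (1 - \<alpha>)" by (simp add: d_def)
  finally show ?thesis by (simp only: power_mult_distrib)
qed

lemma summable_contraction:
  fixes u v :: "nat \<Rightarrow> real"
  assumes "0 \<le> q" "q < 1" "\<And>k. 0 \<le> u k" "\<And>k. 0 \<le> v k" "summable v"
    and step: "\<And>k. u (Suc k) \<le> q * u k + v k"
  shows "summable u"
proof -
  define C where "C = (u 0 + suminf v) / (1 - q)"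
  have C: "u 0 + suminf v = C * (1 - q)" using assms(2) by (simp add: C_def)
  have C0: "0 \<le> C" using assms by (simp add: C_def suminf_nonneg)
  have "(\<Sum>k<n. u k) \<le> C" for n
  proof (induction n)
    case (Suc n)
    have "(\<Sum>k<Suc n. u k) = u 0 + (\<Sum>k<n. u (Suc k))" by (rule sum.lessThan_Suc_shift)
    also have "\<dots> \<le> u 0 + (\<Sum>k<n. q * u k + v k)" by (intro add_left_mono sum_mono step)
    also have "\<dots> = u 0 + (\<Sum>k<n. v k) + q * (\<Sum>k<n. u k)" by (simp add: sum.distrib sum_distrib_left)
    also have "\<dots> \<le> u 0 + suminf v + q * C"
      using Suc assms sum_le_suminf[of v "{..<n}"] by (intro add_mono mult_left_mono) auto
    also have "\<dots> = C" unfolding C by (simp add: algebra_simps)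
    finally show ?case .
  qed (use C0 in simp)
  then show ?thesis using assms(3) by (rule summableI_nonneg_bounded[rotated])
qed

text \<open>The addition theorem of the hyperbolic tangent: the largest modulus that \<open>(w - t) / (1 - t * w)\<close> takes
on the disk of radius \<open>s\<close>.\<close>

definition hypsum :: "real \<Rightarrow> real \<Rightarrow> real" where
  "hypsum s t = (s + t) / (1 + s * t)"

lemma hypsum_props:
  assumes "0 \<le> s" "s < 1" "0 \<le> t" "t < 1"
  shows "0 \<le> hypsum s t" "hypsum s t < 1" "hypsum s t \<le> s + t" "(1 - s) * (1 - t)\<^sup>2 \<le> 1 - hypsum s t"
proof -
  have d: "1 \<le> 1 + s * t" using assms by simp
  have st: "1 - hypsum s t = (1 - s) * (1 - t) / (1 + s * t)"
    using d by (simp add: hypsum_def divide_simps) (simp add: algebra_simps)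
  show "0 \<le> hypsum s t" using assms by (simp add: hypsum_def)
  have "0 < (1 - s) * (1 - t)" using assms by simp
  then have "0 < (1 - s) * (1 - t) / (1 + s * t)" by (rule divide_pos_pos) (rule less_le_trans[OF zero_less_one d])
  then show "hypsum s t < 1" using st by simp
  have "(s + t) / (1 + s * t) \<le> (s + t) / 1"
    using assms less_le_trans[OF zero_less_one d] by (intro divide_left_mono[OF d]) (simp_all only: mult_1_right add_nonneg_nonneg)
  then show "hypsum s t \<le> s + t" by (simp add: hypsum_def)
  have "(1 - t) * (1 + s * t) \<le> (1 - t) * (1 + t)"
    using assms mult_right_mono[of s 1 t] by (intro mult_left_mono) auto
  also have "\<dots> \<le> 1" by (simp add: algebra_simps)
  finally have "1 - t \<le> 1 / (1 + s * t)" using d by (simp add: pos_le_divide_eq)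
  then have "(1 - s) * (1 - t) * (1 - t) \<le> (1 - s) * (1 - t) * (1 / (1 + s * t))"
    using assms by (intro mult_left_mono) auto
  then show "(1 - s) * (1 - t)\<^sup>2 \<le> 1 - hypsum s t" by (simp add: st power2_eq_square mult_ac)
qed

text \<open>First the iterates stay away from 1: each step multiplies \<open>1 - t k\<close> by at least \<open>(1 - \<omega> k)\<^sup>2\<close>, and
the product of these factors is positive because \<open>\<omega>\<close> is summable. With a bound \<open>R < 1\<close> for all
iterates, the exponent 2 already turns the step into a contraction with factor \<open>R\<close> up to a summable
perturbation.\<close>

lemma hypsum_iteration_tendsto_0:
  fixes t \<omega> :: "nat \<Rightarrow> real"
  assumes t0: "0 \<le> t 0" "t 0 < 1" and step: "\<And>k. t (Suc k) = hypsum (t k) (\<omega> k) ^ n" and n: "2 \<le> n"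
    and \<omega>: "\<And>k. 0 \<le> \<omega> k" "\<And>k. \<omega> k \<le> w" "w < 1" "summable \<omega>"
  shows "0 \<le> t k \<and> t k < 1" "t \<longlonglongrightarrow> 0"
proof -
  have \<omega>1: "\<omega> k < 1" for k using \<omega>(2)[of k] \<omega>(3) by linarith
  have range: "0 \<le> t k \<and> t k < 1" for k
  proof (induction k)
    case (Suc k)
    then show ?case using hypsum_props[of "t k" "\<omega> k"] \<omega>(1)[of k] \<omega>1[of k] n step[of k]
      by (auto simp: power_less_one_iff)
  qed (use t0 in simp)
  then show "0 \<le> t k \<and> t k < 1" by blast
  have le_sq: "t (Suc k) \<le> hypsum (t k) (\<omega> k) ^ 2" for k
    unfolding step using hypsum_props[of "t k" "\<omega> k"] range[of k] \<omega>(1)[of k] \<omega>1[of k] n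
    by (intro power_decreasing) auto
  have le_one: "t (Suc k) \<le> hypsum (t k) (\<omega> k)" for k
    unfolding step using hypsum_props[of "t k" "\<omega> k"] range[of k] \<omega>(1)[of k] \<omega>1[of k] n
      power_decreasing[of 1 n "hypsum (t k) (\<omega> k)"] by auto
  have exp_le: "exp (- \<omega> k / (1 - w)) \<le> 1 - \<omega> k" for k
  proof -
    have "1 / (1 - \<omega> k) = 1 + \<omega> k / (1 - \<omega> k)" using \<omega>1[of k] by (simp add: field_simps)
    also have "\<dots> \<le> 1 + \<omega> k / (1 - w)" using \<omega> \<omega>1[of k] by (simp add: divide_left_mono)
    also have "\<dots> \<le> exp (\<omega> k / (1 - w))" by (rule exp_ge_add_one_self)
    finally have "1 \<le> exp (\<omega> k / (1 - w)) * (1 - \<omega> k)" using \<omega>1[of k] by (simp add: pos_divide_le_eq)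
    then have "exp (- (\<omega> k / (1 - w))) * 1 \<le> exp (- (\<omega> k / (1 - w))) * (exp (\<omega> k / (1 - w)) * (1 - \<omega> k))"
      by (intro mult_left_mono) auto
    also have "\<dots> = 1 - \<omega> k" by (simp flip: mult.assoc exp_add)
    finally show ?thesis by simp
  qed
  have lower: "(1 - t 0) * exp (- 2 * (\<Sum>j<k. \<omega> j) / (1 - w)) \<le> 1 - t k" for k
  proof (induction k)
    case (Suc k)
    have "(1 - t 0) * exp (- 2 * (\<Sum>j<Suc k. \<omega> j) / (1 - w))
        = (1 - t 0) * exp (- 2 * (\<Sum>j<k. \<omega> j) / (1 - w)) * (exp (- \<omega> k / (1 - w)))\<^sup>2"
      by (simp add: algebra_simps diff_divide_distrib add_divide_distrib power2_eq_square flip: exp_add)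
    also have "\<dots> \<le> (1 - t k) * (1 - \<omega> k)\<^sup>2"
      using Suc exp_le range[of k] \<omega>1[of k] by (intro mult_mono power_mono) auto
    also have "\<dots> \<le> 1 - t (Suc k)"
      using hypsum_props(4)[of "t k" "\<omega> k"] range[of k] \<omega>(1)[of k] \<omega>1[of k] le_one[of k] by linarith
    finally show ?case .
  qed simp
  define R where "R = 1 - (1 - t 0) * exp (- 2 * suminf \<omega> / (1 - w))"
  have R: "t k \<le> R" for k
  proof -
    have "(\<Sum>j<k. \<omega> j) \<le> suminf \<omega>" using \<omega> by (intro sum_le_suminf) auto
    then have "exp (- 2 * suminf \<omega> / (1 - w)) \<le> exp (- 2 * (\<Sum>j<k. \<omega> j) / (1 - w))"
      using \<omega>(3) by (simp add: divide_right_mono)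
    then have "(1 - t 0) * exp (- 2 * suminf \<omega> / (1 - w)) \<le> (1 - t 0) * exp (- 2 * (\<Sum>j<k. \<omega> j) / (1 - w))"
      using t0 by (intro mult_left_mono) auto
    then show ?thesis using lower[of k] by (simp add: R_def)
  qed
  have "summable t"
  proof (rule summable_contraction)
    show "0 \<le> R" using R[of 0] t0 by simp
    show "R < 1" using t0 by (simp add: R_def)
    show "summable (\<lambda>k. 2 * \<omega> k)" using \<omega>(4) by (rule summable_mult)
    fix k
    have tk: "0 \<le> t k" "t k \<le> R" "t k < 1" using range[of k] R[of k] by auto
    have h: "0 \<le> hypsum (t k) (\<omega> k)" "hypsum (t k) (\<omega> k) \<le> 1" "hypsum (t k) (\<omega> k) \<le> t k + \<omega> k"
      using hypsum_props[of "t k" "\<omega> k"] tk \<omega>(1)[of k] \<omega>1[of k] by auto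
    have "t (Suc k) \<le> hypsum (t k) (\<omega> k) * hypsum (t k) (\<omega> k)" using le_sq[of k] by (simp add: power2_eq_square)
    also have "\<dots> \<le> (t k + \<omega> k) * hypsum (t k) (\<omega> k)" using h by (intro mult_right_mono) auto
    also have "\<dots> = t k * hypsum (t k) (\<omega> k) + \<omega> k * hypsum (t k) (\<omega> k)" by (simp add: algebra_simps)
    also have "\<dots> \<le> t k * (t k + \<omega> k) + \<omega> k * 1" using h tk \<omega>(1)[of k] by (intro add_mono mult_left_mono) auto
    also have "\<dots> \<le> R * t k + 2 * \<omega> k"
      using mult_right_mono[OF tk(2) tk(1)] mult_right_mono[of "t k" 1 "\<omega> k"] tk \<omega>(1)[of k]
      by (simp add: algebra_simps)
    finally show "t (Suc k) \<le> R * t k + 2 * \<omega> k" .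
  qed (use range \<omega>(1) in auto)
  then show "t \<longlonglongrightarrow> 0" by (rule summable_LIMSEQ_zero)
qed

section \<open>The order of convergence\<close>

text \<open>An order above \<open>n\<close> would make the negative logarithms of the errors grow at least like \<open>r ^ k\<close> with some
\<open>r > n\<close>, but those of the lower bounds \<open>\<epsilon>\<close> grow at most like \<open>n ^ k\<close>.\<close>

lemma not_order_bound:
  fixes X :: "nat \<Rightarrow> 'a::metric_space" and \<epsilon> :: "nat \<Rightarrow> real"
  assumes lim: "X \<longlonglongrightarrow> x" and pos: "\<And>k. 0 < \<epsilon> k" and le: "\<And>k. \<epsilon> k \<le> dist (X k) x"
    and c: "0 < c" and step: "\<And>k. c * \<epsilon> k ^ n \<le> \<epsilon> (Suc k)" and n: "2 \<le> n" and q: "real n < q"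
  shows "\<not> order_bound X x q"
proof
  assume "order_bound X x q"
  then obtain C where C: "\<forall>\<^sub>F k in sequentially. dist (X (Suc k)) x \<le> C * dist (X k) x powr q"
    by (auto simp: order_bound_def)
  define r where "r = (real n + q) / 2"
  have r: "real n < r" "r < q" using q by (auto simp: r_def)
  define e where "e k = dist (X k) x" for k
  have e_pos: "0 < e k" for k using pos[of k] le[of k] unfolding e_def by linarith
  have e_lim: "e \<longlonglongrightarrow> 0" unfolding e_def by (rule iffD1[OF tendsto_dist_iff lim])
  have "(\<lambda>k. C * e k powr (q - r)) \<longlonglongrightarrow> C * 0"
    using e_lim e_pos r by (intro tendsto_mult tendsto_const tendsto_zero_powrI[where b="q - r"])
      (auto intro: always_eventually less_imp_le)
  then have "\<forall>\<^sub>F k in sequentially. C * e k powr (q - r) < 1" by (intro order_tendstoD(2)) auto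
  moreover have "\<forall>\<^sub>F k in sequentially. e k < 1" using e_lim by (rule order_tendstoD(2)) simp
  ultimately have "\<forall>\<^sub>F k in sequentially. e k < 1 \<and> e (Suc k) \<le> e k powr r"
    using C
  proof eventually_elim
    case (elim k)
    have "e (Suc k) \<le> C * e k powr (q - r) * e k powr r"
      using elim(3) by (simp add: e_def mult.assoc flip: powr_add)
    also have "\<dots> \<le> 1 * e k powr r" using elim(1) by (intro mult_right_mono) auto
    finally show ?case using elim(2) by simp
  qed
  then obtain K where K: "\<And>k. K \<le> k \<Longrightarrow> e k < 1 \<and> e (Suc k) \<le> e k powr r"
    by (auto simp: eventually_sequentially)
  \<comment> \<open>Adding \<open>d\<close> absorbs the constant \<open>c\<close>, since \<open>2 * d \<le> n * d\<close>.\<close>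
  define d where "d = max 0 (- ln c)"
  define L where "L = - ln (e K)"
  have "0 < L" using K[of K] e_pos[of K] by (simp add: L_def)
  have up: "r ^ j * L \<le> - ln (e (K + j))" for j
  proof (induction j)
    case (Suc j)
    have "ln (e (K + Suc j)) \<le> ln (e (K + j) powr r)"
      using K[of "K + j"] e_pos[of "K + j"] e_pos[of "K + Suc j"] by (subst ln_le_cancel_iff) auto
    also have "\<dots> = r * ln (e (K + j))" using e_pos by (simp add: ln_powr)
    finally have "r * - ln (e (K + j)) \<le> - ln (e (K + Suc j))" by simp
    moreover have "r ^ Suc j * L \<le> r * - ln (e (K + j))"
      using Suc r n by (simp only: power_Suc mult.assoc) (intro mult_left_mono, auto)
    ultimately show ?case by linarith
  qed (simp add: L_def)
  have down: "- ln (\<epsilon> (K + j)) + d \<le> real n ^ j * (- ln (\<epsilon> K) + d)" for j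
  proof (induction j)
    case (Suc j)
    have e: "0 < \<epsilon> (K + j)" "0 < \<epsilon> (K + Suc j)" by (rule pos)+
    have "ln (c * \<epsilon> (K + j) ^ n) \<le> ln (\<epsilon> (K + Suc j))"
      using step[of "K + j"] c e by (subst ln_le_cancel_iff) auto
    then have "- ln (\<epsilon> (K + Suc j)) \<le> - ln c + n * - ln (\<epsilon> (K + j))"
      using c e by (simp add: ln_mult ln_realpow)
    also have "- ln c \<le> d" by (simp add: d_def)
    finally have "- ln (\<epsilon> (K + Suc j)) + d \<le> real n * - ln (\<epsilon> (K + j)) + 2 * d" by simp
    also have "2 * d \<le> real n * d" using n by (intro mult_right_mono) (auto simp: d_def)
    finally have "- ln (\<epsilon> (K + Suc j)) + d \<le> real n * (- ln (\<epsilon> (K + j)) + d)"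
      by (simp add: algebra_simps)
    also have "\<dots> \<le> real n * (real n ^ j * (- ln (\<epsilon> K) + d))" using Suc by (intro mult_left_mono) auto
    finally show ?case by (simp add: mult_ac)
  qed simp
  define D where "D = - ln (\<epsilon> K) + d"
  have "(r / real n) ^ j \<le> D / L" for j
  proof -
    have "ln (\<epsilon> (K + j)) \<le> ln (e (K + j))"
      using le[of "K + j"] pos[of "K + j"] e_pos[of "K + j"] by (subst ln_le_cancel_iff) (simp_all add: e_def)
    then have "- ln (e (K + j)) \<le> - ln (\<epsilon> (K + j)) + d" by (simp add: d_def)
    then have "r ^ j * L \<le> real n ^ j * D" using up[of j] down[of j] by (simp add: D_def)
    then show ?thesis using n \<open>0 < L\<close> by (simp add: power_divide divide_simps mult_ac)
  qed
  moreover obtain j where "D / L < (r / real n) ^ j"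
    using real_arch_pow[of "r / real n" "D / L"] r n by auto
  ultimately show False by (meson not_less)
qed

lemma order_boundI:
  fixes X :: "nat \<Rightarrow> 'a::metric_space"
  assumes "\<forall>\<^sub>F k in sequentially. dist (X (Suc k)) x \<le> c * dist (X k) x ^ n" "0 < n"
  shows "order_bound X x (real n)"
proof -
  have "dist (X k) x ^ n = dist (X k) x powr real n" for k
    using assms(2) by (cases "dist (X k) x = 0") (simp_all add: powr_realpow power_0_left)
  then show ?thesis using assms(1) unfolding order_bound_def by auto
qed

lemma converges_with_orderI:
  fixes X :: "nat \<Rightarrow> 'a::metric_space" and \<epsilon> :: "nat \<Rightarrow> real"
  assumes "X \<longlonglongrightarrow> x" "\<forall>\<^sub>F k in sequentially. dist (X (Suc k)) x \<le> C * dist (X k) x ^ n"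
    and "\<And>k. 0 < \<epsilon> k" "\<And>k. \<epsilon> k \<le> dist (X k) x" "0 < c" "\<And>k. c * \<epsilon> k ^ n \<le> \<epsilon> (Suc k)" "2 \<le> n"
  shows "converges_with_order X x (real n)"
proof -
  have "order_bound X x (real n)" using assms(7) by (intro order_boundI[OF assms(2)]) simp
  moreover have "\<not> order_bound X x q" if "real n < q" for q
    using assms(1,3-7) that by (rule not_order_bound)
  ultimately show ?thesis using assms(1) by (simp add: converges_with_order_def)
qed

lemma converges_with_R_orderI:
  assumes "converges_with_order X x p" "\<And>k. dist (U k) u \<le> dist (X k) x"
  shows "converges_with_R_order U u p"
proof -
  have "order_bound (\<lambda>k. dist (X k) x) 0 q \<longleftrightarrow> order_bound X x q" for q
    by (simp add: order_bound_def)
  moreover have "(\<lambda>k. dist (X k) x) \<longlonglongrightarrow> 0 \<longleftrightarrow> X \<longlonglongrightarrow> x"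
    by (rule tendsto_dist_iff[symmetric])
  ultimately have "converges_with_order (\<lambda>k. dist (X k) x) 0 p"
    using assms(1) unfolding converges_with_order_def by simp
  then show ?thesis unfolding converges_with_R_order_def using assms(2) by blast
qed

section \<open>Polynomials of complex matrices\<close>

lemma mat_eq_scaleC_vector: "mat c *v (v :: complex^'n) = c *s v"
  by (simp add: vec_eq_iff matrix_vector_mult_def mat_def if_distrib[of "\<lambda>x. x * _"] cong: if_cong)

lemma mat_commute: "mat c ** (A :: complex^'n^'n) = A ** mat c"
  by (simp add: vec_eq_iff matrix_matrix_mult_def mat_def if_distrib[of "\<lambda>x. x * _"]
      if_distrib[of "\<lambda>x. _ * x"] cong: if_cong)

lemma mat_add: "mat (a + b) = mat a + (mat b :: complex^'n^'n)"
  by (simp add: vec_eq_iff mat_def)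

lemma mat_mult: "mat (a * b) = mat a ** (mat b :: complex^'n^'n)"
  by (simp add: vec_eq_iff matrix_matrix_mult_def mat_def if_distrib[of "\<lambda>x. x * _"] cong: if_cong)

lemma scaleR_eq_mat: "r *\<^sub>R (A :: complex^'n^'n) = mat (of_real r) ** A"
  by (simp add: vec_eq_iff matrix_matrix_mult_def mat_def if_distrib[of "\<lambda>x. x * _"])
    (simp add: scaleR_conv_of_real if_distribR cong: if_cong)

lemma matrix_add_rdistrib: "(B + C) ** A = B ** A + C ** (A :: complex^'n^'n)"
  by (simp add: vec_eq_iff matrix_matrix_mult_def sum.distrib algebra_simps)

lemma matrix_diff_ldistrib: "A ** (B - C) = A ** B - A ** (C :: complex^'n^'n)"
  by (simp add: vec_eq_iff matrix_matrix_mult_def sum_subtractf algebra_simps)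

lemma matrix_diff_rdistrib: "(B - C) ** A = B ** A - C ** (A :: complex^'n^'n)"
  by (simp add: vec_eq_iff matrix_matrix_mult_def sum_subtractf algebra_simps)

lemma matrix_mul_uminus: "A ** (- B) = - (A ** (B :: complex^'n^'n))" "(- A) ** B = - (A ** (B :: complex^'n^'n))"
  by (simp_all add: vec_eq_iff matrix_matrix_mult_def sum_negf)

lemma matrix_mul_sum_right: "A ** (\<Sum>i\<in>I. B i) = (\<Sum>i\<in>I. A ** (B i :: complex^'n^'n))"
  by (induction I rule: infinite_finite_induct) (simp_all add: matrix_add_ldistrib)

lemma matrix_eq_vectorI: "(\<And>v. A *v v = B *v v) \<Longrightarrow> A = (B :: complex^'n^'n)"
  by (simp add: matrix_eq)

text \<open>Polynomials with complex coefficients in the matrix product, evaluated by Horner's rule; they provide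
the functional calculus for the square root, where real coefficients do not suffice.\<close>

definition cmat_poly :: "complex poly \<Rightarrow> complex^'n^'n \<Rightarrow> complex^'n^'n" where
  "cmat_poly p X = fold_coeffs (\<lambda>a B. mat a + X ** B) p 0"

lemma cmat_poly_0 [simp]: "cmat_poly 0 X = 0"
  by (simp add: cmat_poly_def)

lemma cmat_poly_pCons [simp]: "cmat_poly (pCons a p) X = mat a + X ** cmat_poly p X"
  by (cases "p = 0 \<and> a = 0") (auto simp: cmat_poly_def)

lemma cmat_poly_1 [simp]: "cmat_poly 1 X = mat 1"
  by (simp add: one_pCons)

lemma cmat_poly_X: "cmat_poly [:0, 1:] X = X" by simp

lemma cmat_poly_add: "cmat_poly (p + q) X = cmat_poly p X + cmat_poly q X"
  by (induction p q rule: poly_induct2) (simp_all add: mat_add matrix_add_ldistrib)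

lemma cmat_poly_smult: "cmat_poly (smult c p) X = mat c ** cmat_poly p X"
  by (induction p) (simp_all add: mat_mult matrix_add_ldistrib matrix_mul_assoc mat_commute[of c X])

lemma cmat_poly_mult: "cmat_poly (p * q) X = cmat_poly p X ** cmat_poly q X"
proof (induction p)
  case (pCons a p)
  then show ?case
    by (simp add: cmat_poly_add cmat_poly_smult matrix_add_rdistrib matrix_mul_assoc)
qed simp

lemma cmat_poly_minus: "cmat_poly (- p) X = - cmat_poly p X"
proof -
  have "cmat_poly (p + - p) X = 0" by (simp only: add.right_inverse cmat_poly_0)
  then show ?thesis unfolding cmat_poly_add by (simp add: add_eq_0_iff)
qed

lemma cmat_poly_diff: "cmat_poly (p - q) X = cmat_poly p X - cmat_poly q X"
  using cmat_poly_add[of p "- q" X] by (simp add: cmat_poly_minus)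

lemma cmat_poly_commute: "cmat_poly p X ** cmat_poly q X = cmat_poly q X ** cmat_poly p X"
  by (metis cmat_poly_mult mult.commute)

lemma cmat_poly_commute_matrix:
  assumes "X ** B = B ** X"
  shows "cmat_poly p X ** B = B ** cmat_poly p X"
proof (induction p)
  case (pCons a p)
  have "X ** cmat_poly p X ** B = X ** (B ** cmat_poly p X)" by (simp add: pCons flip: matrix_mul_assoc)
  also have "\<dots> = B ** (X ** cmat_poly p X)" by (simp add: matrix_mul_assoc assms)
  finally show ?case by (simp add: matrix_add_ldistrib matrix_add_rdistrib mat_commute)
qed simp

lemma mat_power_Suc [simp]: "mat_power X (Suc k) = X ** mat_power X k" "mat_power X 0 = mat 1"
  by (simp_all add: mat_power_def)

lemma mat_poly_pCons: "mat_poly (pCons a p) X = a *\<^sub>R mat 1 + X ** mat_poly p X"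
proof (cases "p = 0")
  case False
  have "mat_poly (pCons a p) X = (\<Sum>i\<le>Suc (degree p). coeff (pCons a p) i *\<^sub>R mat_power X i)"
    using False by (simp only: mat_poly_def degree_pCons_eq[OF False])
  also have "\<dots> = a *\<^sub>R mat 1 + (\<Sum>i\<le>degree p. coeff p i *\<^sub>R (X ** mat_power X i))"
    by (subst sum.atMost_Suc_shift) simp
  also have "(\<Sum>i\<le>degree p. coeff p i *\<^sub>R (X ** mat_power X i)) = X ** mat_poly p X"
    by (simp add: mat_poly_def matrix_mul_sum_right matrix_scalar_ac flip: scalar_matrix_assoc)
  finally show ?thesis .
qed (simp add: mat_poly_def)

lemma mat_poly_0 [simp]: "mat_poly 0 X = 0"
  by (simp add: mat_poly_def)

lemma mat_poly_1 [simp]: "mat_poly 1 X = mat 1"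
  by (simp add: one_pCons mat_poly_pCons)

lemma mat_poly_add: "mat_poly (p + q) X = mat_poly p X + mat_poly q X"
  by (induction p q rule: poly_induct2) (simp_all add: mat_poly_pCons matrix_add_ldistrib scaleR_add_left)

lemma mat_poly_smult: "mat_poly (smult c p) X = c *\<^sub>R mat_poly p X"
  by (induction p)
    (simp_all add: mat_poly_pCons scaleR_add_right matrix_scalar_ac flip: scalar_matrix_assoc)

lemma mat_poly_mult: "mat_poly (p * q) X = mat_poly p X ** mat_poly q X"
  by (induction p)
    (simp_all add: mat_poly_pCons mat_poly_add mat_poly_smult matrix_add_rdistrib matrix_mul_assoc
      flip: scalar_matrix_assoc)

lemma mat_poly_commute_matrix:
  assumes "X ** B = B ** X"
  shows "mat_poly p X ** B = B ** mat_poly p X"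
proof (induction p)
  case (pCons a p)
  have "X ** mat_poly p X ** B = X ** (B ** mat_poly p X)" by (simp add: pCons flip: matrix_mul_assoc)
  also have "\<dots> = B ** (X ** mat_poly p X)" by (simp add: matrix_mul_assoc assms)
  finally show ?case
    by (simp add: mat_poly_pCons matrix_add_ldistrib matrix_add_rdistrib matrix_scalar_ac flip: scalar_matrix_assoc)
qed simp

lemma matrix_vector_mult_scaleC: "A *v (c *s v) = c *s (A *v (v :: complex^'n))"
  by (simp add: vec_eq_iff matrix_vector_mult_def sum_distrib_left mult_ac)

lemma cmat_poly_linear_factor: "cmat_poly [:- c, 1:] X *v v = X *v v - c *s v"
proof -
  have "mat (- c) *v v = - (c *s v)" by (simp add: mat_eq_scaleC_vector vec_eq_iff)
  then show ?thesis by (simp add: matrix_vector_mult_add_rdistrib)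
qed

lemma cmat_poly_eigenvector:
  assumes "X *v v = c *s v"
  shows "cmat_poly p X *v v = poly p c *s v"
proof (induction p)
  case (pCons a p)
  have "cmat_poly (pCons a p) X *v v = a *s v + X *v (cmat_poly p X *v v)"
    by (simp add: matrix_vector_mult_add_rdistrib mat_eq_scaleC_vector matrix_vector_mul_assoc)
  also have "\<dots> = a *s v + poly p c *s (c *s v)" by (simp add: pCons matrix_vector_mult_scaleC assms)
  finally show ?case by (simp add: vec_eq_iff algebra_simps)
qed simp

section \<open>Annihilating polynomials and eigenvalues\<close>

lemma invertible_if_kernel_trivial:
  fixes A :: "complex^'n^'n"
  assumes "\<And>v. A *v v = 0 \<Longrightarrow> v = 0"
  shows "invertible A"
  using assms matrix_left_invertible_ker[of A] invertible_left_inverse by blast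

lemma matrix_inv_right_left:
  fixes A :: "complex^'n^'n"
  assumes "invertible A"
  shows "A ** matrix_inv A = mat 1" "matrix_inv A ** A = mat 1"
  using someI_ex[OF assms[unfolded invertible_def]] by (auto simp: matrix_inv_def)

lemma matrix_inv_eqI:
  fixes A :: "complex^'n^'n"
  assumes "A ** B = mat 1"
  shows "invertible A" "matrix_inv A = B"
proof -
  show inv: "invertible A" using assms invertible_right_inverse by blast
  have "matrix_inv A = matrix_inv A ** (A ** B)" by (simp add: assms)
  also have "\<dots> = B" by (simp add: matrix_mul_assoc matrix_inv_right_left[OF inv])
  finally show "matrix_inv A = B" .
qed

lemma annihilating_poly_exists: "\<exists>p. p \<noteq> 0 \<and> cmat_poly p (X :: complex^'n^'n) = 0"
proof -
  define N where "N = DIM(complex^'n^'n)"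
  have monom: "cmat_poly (monom c k) X = mat c ** mat_power X k" for c k
  proof (induction k)
    case (Suc k)
    have "X ** (mat c ** mat_power X k) = mat c ** (X ** mat_power X k)"
      by (metis mat_commute matrix_mul_assoc)
    with Suc show ?case by (simp add: monom_Suc)
  qed (simp add: monom_0)
  show ?thesis
  proof (cases "inj_on (mat_power X) {..N}")
    case False
    then obtain i j where ij: "i \<noteq> j" "mat_power X i = mat_power X j" by (auto simp: inj_on_def)
    have "cmat_poly (monom 1 i - monom 1 j) X = 0" by (simp add: cmat_poly_diff monom ij)
    moreover have "monom 1 i - monom 1 j \<noteq> (0 :: complex poly)" using ij(1) by (simp add: monom_eq_iff')
    ultimately show ?thesis by blast
  next
    case True
    let ?S = "mat_power X ` {..N}"
    have "card ?S > DIM(complex^'n^'n)" using card_image[OF True] by (simp add: N_def)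
    then have "dependent ?S" by (intro dependent_biggerset) auto
    then obtain u where u: "\<exists>v\<in>?S. u v \<noteq> 0" "(\<Sum>v\<in>?S. u v *\<^sub>R v) = 0"
      using dependent_finite[of ?S] by auto
    define p where "p = (\<Sum>k\<le>N. monom (complex_of_real (u (mat_power X k))) k)"
    have sum: "cmat_poly (\<Sum>k\<in>I. f k) X = (\<Sum>k\<in>I. cmat_poly (f k) X)" for f and I :: "nat set"
      by (induction I rule: infinite_finite_induct) (simp_all add: cmat_poly_add)
    have "cmat_poly p X = (\<Sum>k\<le>N. u (mat_power X k) *\<^sub>R mat_power X k)"
      by (simp add: p_def sum monom flip: scaleR_eq_mat)
    also have "\<dots> = (\<Sum>v\<in>?S. u v *\<^sub>R v)" by (simp add: sum.reindex[OF True])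
    finally have "cmat_poly p X = 0" using u(2) by simp
    moreover have "p \<noteq> 0"
    proof -
      obtain k where k: "k \<le> N" "u (mat_power X k) \<noteq> 0" using u(1) by auto
      have "coeff p k = of_real (u (mat_power X k))"
        using k(1) by (simp add: p_def coeff_sum)
      with k(2) show ?thesis by auto
    qed
    ultimately show ?thesis by blast
  qed
qed

abbreviation roots_poly :: "complex list \<Rightarrow> complex poly" where
  "roots_poly cs \<equiv> (\<Prod>c\<leftarrow>cs. [:- c, 1:])"

text \<open>In an annihilating product of linear factors of least length, every factor is singular: an
invertible one could be cancelled.\<close>

lemma annihilating_eigenvalue_list:
  fixes X :: "complex^'n^'n"
  obtains cs where "cmat_poly (roots_poly cs) X = 0" "\<And>c. c \<in> set cs \<Longrightarrow> eigenvalue X c"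
proof -
  obtain p where p: "p \<noteq> 0" "cmat_poly p X = 0" using annihilating_poly_exists by blast
  obtain rs where rs: "mset rs = proots p" using ex_mset by blast
  have "smult (lead_coeff p) (roots_poly rs) = p"
    using complex_poly_decompose_multiset[of p] unfolding rs[symmetric]
    by (metis mset_map prod_mset_prod_list)
  then have "mat (lead_coeff p) ** cmat_poly (roots_poly rs) X = 0" using p(2) by (metis cmat_poly_smult)
  then have "mat (inverse (lead_coeff p)) ** (mat (lead_coeff p) ** cmat_poly (roots_poly rs) X) = 0" by simp
  then have "cmat_poly (roots_poly rs) X = 0"
    using p(1) by (simp add: matrix_mul_assoc flip: mat_mult)
  then obtain cs where cs: "cmat_poly (roots_poly cs) X = 0"
    "\<And>ds. cmat_poly (roots_poly ds) X = 0 \<Longrightarrow> length cs \<le> length ds"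
    using ex_has_least_nat[of "\<lambda>cs. cmat_poly (roots_poly cs) X = 0" rs length] by blast
  show ?thesis
  proof (rule that[OF cs(1)], rule ccontr)
    fix c assume "c \<in> set cs" and no: "\<not> eigenvalue X c"
    then obtain as bs where split: "cs = as @ c # bs" by (meson split_list)
    have "roots_poly cs = [:- c, 1:] * roots_poly (as @ bs)"
      by (simp only: split map_append list.map prod_list.append prod_list.Cons mult_ac)
    then have "cmat_poly [:- c, 1:] X ** cmat_poly (roots_poly (as @ bs)) X = 0"
      using cs(1) by (metis cmat_poly_mult)
    then have z: "cmat_poly [:- c, 1:] X *v (cmat_poly (roots_poly (as @ bs)) X *v v) = 0" for v
      by (metis matrix_vector_mul_assoc matrix_vector_mult_0)
    have "cmat_poly (roots_poly (as @ bs)) X *v v = 0" for v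
      using z[of v] no unfolding cmat_poly_linear_factor by (auto simp: eigenvalue_def)
    then have "cmat_poly (roots_poly (as @ bs)) X = 0" by (intro matrix_eq_vectorI) simp
    from cs(2)[OF this] show False by (simp add: split)
  qed
qed

text \<open>Applying the factors of an annihilating product one after the other to \<open>v\<close>, the last nonzero vector is
an eigenvector. It lies in every subspace that contains \<open>v\<close> and is invariant under \<open>X\<close>.\<close>

lemma eigenvector_in_cyclic_subspace:
  fixes X :: "complex^'n^'n"
  assumes "v \<noteq> 0"
  obtains p c where "cmat_poly p X *v v \<noteq> 0" "X *v (cmat_poly p X *v v) = c *s (cmat_poly p X *v v)"
proof -
  obtain cs where "cmat_poly (roots_poly cs) X = 0" by (rule annihilating_eigenvalue_list)
  then have "cmat_poly (roots_poly cs) X *v v = 0" by simp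
  then have "\<exists>p c. cmat_poly p X *v v \<noteq> 0 \<and> X *v (cmat_poly p X *v v) = c *s (cmat_poly p X *v v)"
  proof (induction cs)
    case (Cons c cs)
    let ?u = "cmat_poly (roots_poly cs) X *v v"
    have "cmat_poly [:- c, 1:] X *v ?u = 0"
      using Cons.prems by (simp only: list.map prod_list.Cons cmat_poly_mult matrix_vector_mul_assoc)
    then have "X *v ?u = c *s ?u" by (simp only: cmat_poly_linear_factor right_minus_eq)
    then show ?case using Cons.IH by (cases "?u = 0") blast+
  qed (use assms in simp)
  then show ?thesis using that by blast
qed

lemma cmat_poly_vec_commute: "cmat_poly p X *v (cmat_poly q X *v v) = cmat_poly q X *v (cmat_poly p X *v v)"
  by (simp add: matrix_vector_mul_assoc cmat_poly_commute)

lemma eigenvalue_cmat_poly: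
  assumes "eigenvalue (cmat_poly q X) \<mu>"
  obtains c where "eigenvalue X c" "\<mu> = poly q c"
proof -
  obtain v where v: "v \<noteq> 0" "cmat_poly q X *v v = \<mu> *s v" using assms by (auto simp: eigenvalue_def)
  obtain p c where pc: "cmat_poly p X *v v \<noteq> 0" "X *v (cmat_poly p X *v v) = c *s (cmat_poly p X *v v)"
    using eigenvector_in_cyclic_subspace[OF v(1)] by metis
  let ?u = "cmat_poly p X *v v"
  have "cmat_poly q X *v ?u = \<mu> *s ?u"
    by (simp add: cmat_poly_vec_commute[of q] v(2) matrix_vector_mult_scaleC)
  then have "(poly q c - \<mu>) *s ?u = 0"
    by (simp add: cmat_poly_eigenvector[OF pc(2)] vector_sub_rdistrib)
  then have "\<mu> = poly q c" using pc(1) by (simp add: vector_mul_eq_0)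
  moreover have "eigenvalue X c" using pc by (auto simp: eigenvalue_def)
  ultimately show ?thesis using that by blast
qed

section \<open>The principal square root\<close>

text \<open>Newton's method one root at a time: \<open>q\<close> is corrected by a multiple of the polynomial \<open>p\<close> of the roots treated
so far. A new root fixes the multiple by interpolation, a repeated root \<open>c\<close> by Hensel lifting, which
divides by \<open>2 * csqrt c\<close>.\<close>

lemma sqrt_modulo_roots_poly:
  assumes "\<And>c. c \<in> set cs \<Longrightarrow> c \<noteq> 0"
  shows "\<exists>q. roots_poly cs dvd q * q - [:0, 1:] \<and> (\<forall>c\<in>set cs. poly q c = csqrt c)"
  using assms
proof (induction cs)
  case (Cons c cs)
  define p where "p = roots_poly cs"
  obtain q s where q: "q * q - [:0, 1:] = p * s" "\<And>d. d \<in> set cs \<Longrightarrow> poly q d = csqrt d"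
    using Cons unfolding p_def by (fastforce elim!: dvdE)
  have roots: "poly p d = 0 \<longleftrightarrow> d \<in> set cs" for d
    unfolding p_def by (induction cs) auto
  have sq: "csqrt c * csqrt c = c" using power2_csqrt[of c] by (simp add: power2_eq_square)
  have csqrt0: "csqrt c \<noteq> 0" using Cons.prems by simp
  define b where "b = (if c \<in> set cs then - poly s c / (2 * csqrt c) else (csqrt c - poly q c) / poly p c)"
  define q' where "q' = q + smult b p"
  define s' where "s' = s + smult (2 * b) q + smult (b * b) p"
  have q': "q' * q' - [:0, 1:] = p * s'"
  proof -
    have "smult (2 * b) (q * p) = smult b (q * p) + smult b (q * p)" by (simp flip: smult_add_left)
    then have "q' * q' - [:0, 1:] = (q * q - [:0, 1:]) + smult (2 * b) (q * p) + smult (b * b) (p * p)"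
      by (simp add: q'_def distrib_left distrib_right mult.commute)
    also have "\<dots> = p * s'" unfolding q(1) by (simp add: s'_def algebra_simps)
    finally show ?thesis .
  qed
  have c: "poly q' c = csqrt c"
    using q(2)[of c] roots[of c] by (auto simp: q'_def b_def)
  have "poly s' c = 0"
  proof (cases "c \<in> set cs")
    case True
    then show ?thesis using q(2)[of c] roots[of c] csqrt0 by (simp add: s'_def b_def)
  next
    case False
    have "poly p c * poly s' c = poly (q' * q' - [:0, 1:]) c" by (simp only: q' poly_mult)
    also have "\<dots> = 0" by (simp add: c sq)
    finally show ?thesis using False roots[of c] by simp
  qed
  then have "[:- c, 1:] dvd s'" by (simp add: poly_eq_0_iff_dvd)
  then have "roots_poly (c # cs) dvd q' * q' - [:0, 1:]"
    unfolding q' list.map prod_list.Cons p_def[symmetric] mult.commute[of p s']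
    by (rule mult_dvd_mono) simp
  moreover have "poly q' d = csqrt d" if "d \<in> set cs" for d
    using that q(2) roots[of d] by (simp add: q'_def)
  ultimately show ?case using c by auto
qed simp

lemma Re_csqrt_pos:
  assumes "z \<notin> \<real>\<^sub>\<le>\<^sub>0"
  shows "0 < Re (csqrt z)"
proof (rule ccontr)
  assume "\<not> ?thesis"
  then have "Re (csqrt z) = 0" using csqrt_principal[of z] by linarith
  then have "csqrt z = \<i> * of_real (Im (csqrt z))" by (simp add: complex_eq_iff)
  then have "(csqrt z)\<^sup>2 = of_real (- (Im (csqrt z))\<^sup>2)"
    by (metis mult_minus1 of_real_minus of_real_power power2_i power_mult_distrib)
  then have "z = of_real (- (Im (csqrt z))\<^sup>2)" by simp
  then have "z \<in> \<real>\<^sub>\<le>\<^sub>0" by (metis nonpos_Reals_of_real_iff neg_le_0_iff_le zero_le_power2)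
  with assms show False by simp
qed

text \<open>Since \<open>X\<close> and \<open>X'\<close> commute, a kernel vector of \<open>X + X'\<close> would lead to a common eigenvector with eigenvalues
\<open>c\<close> and \<open>- c\<close>, which cannot both lie in the open right half-plane. So \<open>X + X'\<close> can be cancelled
in \<open>(X + X') ** (X - X') = 0\<close>.\<close>

lemma principal_sqrt_unique:
  fixes X X' :: "complex^'n^'n"
  assumes "X ** X = X' ** X'" "X ** X' = X' ** X"
    and "\<And>\<mu>. eigenvalue X \<mu> \<Longrightarrow> 0 < Re \<mu>" "\<And>\<mu>. eigenvalue X' \<mu> \<Longrightarrow> 0 < Re \<mu>"
  shows "X = X'"
proof -
  have "v = 0" if v: "(X + X') *v v = 0" for v
  proof (rule ccontr)
    assume "v \<noteq> 0"
    then obtain p c where pc: "cmat_poly p X *v v \<noteq> 0" "X *v (cmat_poly p X *v v) = c *s (cmat_poly p X *v v)"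
      using eigenvector_in_cyclic_subspace by metis
    let ?u = "cmat_poly p X *v v"
    have "(X + X') *v ?u = cmat_poly p X *v ((X + X') *v v)"
      unfolding matrix_vector_mul_assoc
      by (subst cmat_poly_commute_matrix) (simp_all add: matrix_add_ldistrib matrix_add_rdistrib assms(2))
    then have "X' *v ?u = (- c) *s ?u"
      using pc(2) v by (simp add: matrix_vector_mult_add_rdistrib add_eq_0_iff)
    then have "0 < Re (- c)" using pc(1) assms(4) eigenvalue_def by blast
    moreover have "0 < Re c" using pc assms(3) eigenvalue_def by blast
    ultimately show False by simp
  qed
  then have "invertible (X + X')" by (rule invertible_if_kernel_trivial)
  moreover have "(X + X') ** (X - X') = 0"
    by (simp add: matrix_diff_ldistrib matrix_add_rdistrib assms(1,2))
  ultimately have "X - X' = 0"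
    by (metis matrix_inv_right_left(2) matrix_mul_assoc matrix_mul_lid times0_right)
  then show ?thesis by simp
qed

theorem principal_sqrt_props:
  fixes A :: "complex^'n^'n"
  assumes "\<And>\<mu>. eigenvalue A \<mu> \<Longrightarrow> \<mu> \<notin> \<real>\<^sub>\<le>\<^sub>0"
  shows "principal_sqrt A ** principal_sqrt A = A"
    and "\<And>\<mu>. eigenvalue (principal_sqrt A) \<mu> \<Longrightarrow> 0 < Re \<mu>"
proof -
  obtain cs where cs: "cmat_poly (roots_poly cs) A = 0" "\<And>c. c \<in> set cs \<Longrightarrow> eigenvalue A c"
    using annihilating_eigenvalue_list by blast
  have "c \<noteq> 0" if "c \<in> set cs" for c using assms[OF cs(2)[OF that]] by auto
  then obtain q where q: "roots_poly cs dvd q * q - [:0, 1:]" "\<And>c. c \<in> set cs \<Longrightarrow> poly q c = csqrt c"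
    using sqrt_modulo_roots_poly by blast
  define X where "X = cmat_poly q A"
  from q(1) obtain r where "q * q - [:0, 1:] = roots_poly cs * r" by (rule dvdE)
  then have "cmat_poly (q * q - [:0, 1:]) A = 0" by (simp only: cmat_poly_mult cs(1) times0_left)
  then have sq: "X ** X = A" by (simp only: cmat_poly_diff cmat_poly_mult cmat_poly_X X_def right_minus_eq)
  have roots: "c \<in> set cs" if "eigenvalue A c" for c
  proof -
    obtain v where v: "v \<noteq> 0" "A *v v = c *s v" using \<open>eigenvalue A c\<close> by (auto simp: eigenvalue_def)
    have "poly (roots_poly cs) c *s v = 0" using cmat_poly_eigenvector[OF v(2), of "roots_poly cs"] cs(1) by simp
    then have "poly (roots_poly cs) c = 0" using v(1) by (simp add: vector_mul_eq_0)
    then show ?thesis by (induction cs) auto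
  qed
  have Re: "0 < Re \<mu>" if "eigenvalue X \<mu>" for \<mu>
  proof -
    obtain c where c: "eigenvalue A c" "\<mu> = poly q c"
      using eigenvalue_cmat_poly[of q A \<mu>] \<open>eigenvalue X \<mu>\<close> unfolding X_def by blast
    then have "\<mu> = csqrt c" using q(2) roots by metis
    with Re_csqrt_pos[OF assms[OF c(1)]] show ?thesis by (simp only:)
  qed
  have "principal_sqrt A = X"
    unfolding principal_sqrt_def
  proof (rule the_equality)
    fix X' assume X': "X' ** X' = A \<and> (\<forall>\<mu>. eigenvalue X' \<mu> \<longrightarrow> 0 < Re \<mu>)"
    have "A ** X' = X' ** A" using X' by (metis matrix_mul_assoc)
    then have "X ** X' = X' ** X" unfolding X_def by (rule cmat_poly_commute_matrix)
    then have "X' ** X = X ** X'" by (rule sym)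
    moreover have "X' ** X' = X ** X" using X' sq by (simp only:)
    ultimately show "X' = X" using X' Re by (metis principal_sqrt_unique)
  qed (use sq Re in blast)
  then show "principal_sqrt A ** principal_sqrt A = A"
    and "\<And>\<mu>. eigenvalue (principal_sqrt A) \<mu> \<Longrightarrow> 0 < Re \<mu>" using sq Re by auto
qed

section \<open>Norms of complex matrices\<close>

lemma scaleR_matrix_vector: "(r *\<^sub>R A) *v x = r *\<^sub>R (A *v (x :: complex^'n))"
  by (simp add: vec_eq_iff matrix_vector_mult_def scaleR_sum_right)

lemma matrix_vector_scaleR: "A *v (r *\<^sub>R x) = r *\<^sub>R (A *v (x :: complex^'n))"
  by (simp add: vec_eq_iff matrix_vector_mult_def scaleR_sum_right)

lemma bounded_bilinear_matrix_mult: "bounded_bilinear ((**) :: complex^'n^'n \<Rightarrow> complex^'n^'n \<Rightarrow> complex^'n^'n)"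
  unfolding bilinear_conv_bounded_bilinear[symmetric] bilinear_def
  by (auto intro!: linearI simp: matrix_add_ldistrib matrix_add_rdistrib matrix_scalar_ac simp flip: scalar_matrix_assoc)

lemma bounded_bilinear_matrix_vector_mult: "bounded_bilinear ((*v) :: complex^'n^'n \<Rightarrow> complex^'n \<Rightarrow> complex^'n)"
proof -
  have "(r *\<^sub>R A) *v x = r *\<^sub>R (A *v x)" for r and A :: "complex^'n^'n" and x
    by (simp add: vec_eq_iff matrix_vector_mult_def scaleR_sum_right)
  then show ?thesis
    unfolding bilinear_conv_bounded_bilinear[symmetric] bilinear_def
    by (auto intro!: linearI simp: matrix_vector_mult_add_rdistrib matrix_vector_right_distrib)
qed

lemma norm_mat_mult: "norm (mat c ** (A :: complex^'n^'n)) = cmod c * norm A"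
proof -
  have "(mat c ** A) $ i = c *s (A $ i)" for i
    by (simp add: vec_eq_iff matrix_matrix_mult_def mat_def if_distrib[of "\<lambda>x. x * _"] cong: if_cong)
  moreover have "norm (c *s v) = cmod c * norm v" for v :: "complex^'n"
    by (simp add: norm_vec_def norm_mult L2_set_right_distrib)
  ultimately show ?thesis by (simp add: norm_vec_def[of "mat c ** A"] norm_vec_def[of A] L2_set_right_distrib)
qed

lemma mat_power_commute: "X ** mat_power X k = mat_power X k ** X"
proof (induction k)
  case (Suc k)
  then show ?case unfolding mat_power_Suc by (metis matrix_mul_assoc)
qed simp

text \<open>Peel off one annihilating factor \<open>W - c\<close> at a time: with \<open>S' = (W - c) S\<close>, the powers satisfy
\<open>W ^ (k + 1) S = c W ^ k S + W ^ k S'\<close>, so summability passes from \<open>S'\<close> to \<open>S\<close> because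
\<open>|c| < 1\<close>.\<close>

lemma mat_power_tendsto_0:
  fixes W :: "complex^'n^'n"
  assumes "\<And>c. eigenvalue W c \<Longrightarrow> cmod c < 1"
  shows "mat_power W \<longlonglongrightarrow> 0"
proof -
  obtain cs where cs: "cmat_poly (roots_poly cs) W = 0" "\<And>c. c \<in> set cs \<Longrightarrow> eigenvalue W c"
    using annihilating_eigenvalue_list by blast
  have "summable (\<lambda>k. norm (mat_power W k ** S))"
    if "cmat_poly (roots_poly ds) W ** S = 0" "set ds \<subseteq> set cs" for ds and S :: "complex^'n^'n"
    using that
  proof (induction ds arbitrary: S)
    case (Cons c ds)
    have "cmat_poly (roots_poly ds) W ** (cmat_poly [:- c, 1:] W ** S) = 0"
      using Cons.prems(1)
      by (simp only: list.map prod_list.Cons matrix_mul_assoc mult.commute[of "[:- c, 1:]"] flip: cmat_poly_mult)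
    then have summ: "summable (\<lambda>k. norm (mat_power W k ** (cmat_poly [:- c, 1:] W ** S)))"
      using Cons.IH Cons.prems(2) by simp
    have c: "cmod c < 1" using Cons.prems(2) cs(2) assms by simp
    have step: "mat_power W (Suc k) ** S = mat c ** (mat_power W k ** S) + mat_power W k ** (cmat_poly [:- c, 1:] W ** S)" for k
    proof -
      have "cmat_poly [:- c, 1:] W ** S = W ** S - mat c ** S"
      proof -
        have "mat (- c) = - (mat c :: complex^'n^'n)" by (simp add: vec_eq_iff mat_def)
        then show ?thesis by (simp add: matrix_diff_rdistrib)
      qed
      moreover have "mat c ** (mat_power W k ** S) = mat_power W k ** (mat c ** S)"
        by (metis mat_commute matrix_mul_assoc)
      ultimately show ?thesis by (simp add: mat_power_commute matrix_diff_ldistrib flip: matrix_mul_assoc)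
    qed
    show ?case
    proof (rule summable_contraction[OF _ c _ _ summ])
      fix k
      show "norm (mat_power W (Suc k) ** S)
          \<le> cmod c * norm (mat_power W k ** S) + norm (mat_power W k ** (cmat_poly [:- c, 1:] W ** S))"
        unfolding step using norm_triangle_ineq by (metis norm_mat_mult)
    qed auto
  qed simp
  from this[of cs "mat 1"] cs(1) have "summable (\<lambda>k. norm (mat_power W k))" by simp
  then have "(\<lambda>k. norm (mat_power W k)) \<longlonglongrightarrow> 0" by (rule summable_LIMSEQ_zero)
  then show ?thesis by (simp only: tendsto_norm_zero_iff)
qed

section \<open>Quadratic forms adapted to a matrix\<close>

text \<open>A real inner product on complex vectors, equivalent to the standard one. Convergence needs a norm in
which the Cayley transform of the principal square root is a contraction, and von Neumann's inequality
for Moebius maps needs that norm to come from an inner product.\<close>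

locale energy_form =
  fixes \<beta> :: "complex^'n \<Rightarrow> complex^'n \<Rightarrow> real" and K :: real
  assumes add_left: "\<beta> (u + v) w = \<beta> u w + \<beta> v w"
    and scale_left: "\<beta> (r *\<^sub>R u) w = r * \<beta> u w"
    and symmetric: "\<beta> u v = \<beta> v u"
    and lower: "(norm u)\<^sup>2 \<le> \<beta> u u"
    and upper: "\<beta> u u \<le> K * (norm u)\<^sup>2"
begin

abbreviation "en u \<equiv> \<beta> u u"

lemma add_right: "\<beta> w (u + v) = \<beta> w u + \<beta> w v"
  using add_left symmetric by metis

lemma scale_right: "\<beta> w (r *\<^sub>R u) = r * \<beta> w u"
  using scale_left symmetric by metis

lemma diff_left: "\<beta> (u - v) w = \<beta> u w - \<beta> v w"
  using add_left[of "u - v" v w] by simp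

lemma diff_right: "\<beta> w (u - v) = \<beta> w u - \<beta> w v"
  using diff_left symmetric by metis

lemma nonneg: "0 \<le> en u"
  using lower[of u] zero_le_power2 order_trans by blast

lemma en_0: "en u = 0 \<Longrightarrow> u = 0"
  using lower[of u] by simp

lemma en_zero [simp]: "en 0 = 0"
  using scale_left[of 0 0 0] by simp

lemma en_scale: "en (r *\<^sub>R u) = r\<^sup>2 * en u"
  by (simp add: scale_left scale_right power2_eq_square)

text \<open>Von Neumann's inequality for a single disk automorphism, with \<open>a = W b\<close>: if \<open>W\<close> has norm at most \<open>t\<close>
then the Moebius transform of \<open>W\<close> with zero \<open>w\<close> has norm at most \<open>hypsum t w\<close>. The cross term is estimated by the
nonnegative energy of \<open>a + t b\<close>, the combination for which equality holds in the extremal case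
\<open>a = - t b\<close>.\<close>

lemma en_moebius:
  assumes "0 < t" "t < 1" "0 \<le> w" "w < 1" and ab: "en a \<le> t\<^sup>2 * en b"
  shows "en (a - w *\<^sub>R b) \<le> (hypsum t w)\<^sup>2 * en (b - w *\<^sub>R a)"
proof -
  define \<rho> A B C where "\<rho> = hypsum t w" and "A = en a" and "B = en b" and "C = \<beta> a b"
  have \<rho>: "0 \<le> \<rho>" "\<rho> < 1" using hypsum_props[of t w] assms by (auto simp: \<rho>_def)
  have tw: "0 < 1 + t * w" using assms by (simp add: add_pos_nonneg)
  have AB: "A \<le> t\<^sup>2 * B" using ab by (simp add: A_def B_def)
  have e1: "en (a - w *\<^sub>R b) = A - 2 * w * C + w\<^sup>2 * B"
    by (simp add: diff_left diff_right scale_left scale_right symmetric[of b a] A_def B_def C_def algebra_simps power2_eq_square)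
  have e2: "en (b - w *\<^sub>R a) = B - 2 * w * C + w\<^sup>2 * A"
    by (simp add: diff_left diff_right scale_left scale_right symmetric[of b a] A_def B_def C_def algebra_simps power2_eq_square)
  have "0 \<le> en (a + t *\<^sub>R b)" by (rule nonneg)
  also have "\<dots> = A + 2 * t * C + t\<^sup>2 * B"
    by (simp add: add_left add_right scale_left scale_right symmetric[of b a] A_def B_def C_def algebra_simps power2_eq_square)
  finally have "t * (- 2 * C) \<le> t * (A / t + t * B)"
    using assms(1) by (simp add: algebra_simps power2_eq_square)
  then have C: "- 2 * C \<le> A / t + t * B" using assms(1) by (simp only: mult_le_cancel_left_pos)
  have \<rho>2: "0 \<le> 1 - \<rho>\<^sup>2" using \<rho> by (simp add: power_le_one)
  have w2: "0 \<le> 1 - \<rho>\<^sup>2 * w\<^sup>2"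
  proof -
    have "\<rho>\<^sup>2 * w\<^sup>2 \<le> 1 * 1" using \<rho> assms by (intro mult_mono power_le_one) auto
    then show ?thesis by simp
  qed
  have "en (a - w *\<^sub>R b) - \<rho>\<^sup>2 * en (b - w *\<^sub>R a)
      = A * (1 - \<rho>\<^sup>2 * w\<^sup>2) + B * (w\<^sup>2 - \<rho>\<^sup>2) + w * (1 - \<rho>\<^sup>2) * (- 2 * C)"
    unfolding e1 e2 by (simp add: algebra_simps)
  also have "\<dots> \<le> A * (1 - \<rho>\<^sup>2 * w\<^sup>2) + B * (w\<^sup>2 - \<rho>\<^sup>2) + w * (1 - \<rho>\<^sup>2) * (A / t + t * B)"
    using C assms(3) \<rho>2 by (intro add_left_mono mult_left_mono) auto
  also have "\<dots> = A * (1 - \<rho>\<^sup>2 * w\<^sup>2 + w * (1 - \<rho>\<^sup>2) / t) + B * (w\<^sup>2 - \<rho>\<^sup>2 + w * (1 - \<rho>\<^sup>2) * t)"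
    by (simp add: algebra_simps add_divide_distrib diff_divide_distrib)
  also have "\<dots> \<le> t\<^sup>2 * B * (1 - \<rho>\<^sup>2 * w\<^sup>2 + w * (1 - \<rho>\<^sup>2) / t) + B * (w\<^sup>2 - \<rho>\<^sup>2 + w * (1 - \<rho>\<^sup>2) * t)"
    using AB w2 \<rho>2 assms by (intro add_right_mono mult_right_mono) auto
  also have "\<dots> = B * ((t + w)\<^sup>2 - (\<rho> * (1 + t * w))\<^sup>2)"
    using assms(1) by (simp add: field_simps power2_eq_square)
  also have "\<rho> * (1 + t * w) = t + w" using tw by (simp add: \<rho>_def hypsum_def)
  finally show ?thesis by (simp add: \<rho>_def)
qed

text \<open>The Cayley transform of \<open>V\<close> has norm at most \<open>t\<close>; stated without the inverse of \<open>1 + V\<close>, whose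
existence is a consequence.\<close>

definition cayley_le :: "complex^'n^'n \<Rightarrow> real \<Rightarrow> bool" where
  "cayley_le V t \<longleftrightarrow> (\<forall>u. en (u - V *v u) \<le> t\<^sup>2 * en (u + V *v u))"

lemma cayley_le_factor:
  assumes V: "cayley_le V t" "0 < t" "t < 1" and \<alpha>: "0 < \<alpha>" and c: "c \<in> {\<alpha>..1}"
  shows "en (c *\<^sub>R u - V *v u) \<le> (hypsum t ((1 - \<alpha>) / (1 + \<alpha>)))\<^sup>2 * en (c *\<^sub>R u + V *v u)"
proof -
  define w w' a b where "w = (1 - c) / (1 + c)" and "w' = (1 - \<alpha>) / (1 + \<alpha>)"
    and "a = u - V *v u" and "b = u + V *v u"
  have w: "0 \<le> w" "w \<le> w'" "w' < 1"
    using c \<alpha> by (simp_all add: w_def w'_def divide_simps) (simp add: algebra_simps)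
  have wc: "(1 + c) * w = 1 - c" using c \<alpha> by (simp add: w_def)
  have c1: "(1 + c) / 2 * (1 - w) = c" "(1 + c) / 2 * (1 + w) = 1"
    using wc by (simp_all add: field_simps)
  have "a - w *\<^sub>R b = (1 - w) *\<^sub>R u - (1 + w) *\<^sub>R (V *v u)"
    by (simp add: a_def b_def algebra_simps)
  then have sub: "c *\<^sub>R u - V *v u = ((1 + c) / 2) *\<^sub>R (a - w *\<^sub>R b)"
    by (simp only: scaleR_diff_right scaleR_scaleR c1 scaleR_one)
  have "b - w *\<^sub>R a = (1 - w) *\<^sub>R u + (1 + w) *\<^sub>R (V *v u)"
    by (simp add: a_def b_def algebra_simps)
  then have add: "c *\<^sub>R u + V *v u = ((1 + c) / 2) *\<^sub>R (b - w *\<^sub>R a)"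
    by (simp only: scaleR_add_right scaleR_scaleR c1 scaleR_one)
  have "en (a - w *\<^sub>R b) \<le> (hypsum t w)\<^sup>2 * en (b - w *\<^sub>R a)"
    using V w unfolding cayley_le_def a_def b_def by (intro en_moebius) auto
  also have "hypsum t w \<le> hypsum t w'"
  proof -
    have "0 < 1 + t * w" "0 < 1 + t * w'" using V w by (simp_all add: add_pos_nonneg)
    moreover have "(t + w) * (1 + t * w') \<le> (t + w') * (1 + t * w)"
    proof -
      have "(t + w') * (1 + t * w) - (t + w) * (1 + t * w') = (1 - t\<^sup>2) * (w' - w)"
        by (simp add: algebra_simps power2_eq_square)
      also have "\<dots> \<ge> 0" using V w by (intro mult_nonneg_nonneg) (auto simp: power_le_one)
      finally show ?thesis by simp
    qed
    ultimately show ?thesis unfolding hypsum_def by (simp add: frac_le_eq divide_le_0_iff pos_divide_le_eq pos_le_divide_eq)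
  qed
  then have "(hypsum t w)\<^sup>2 * en (b - w *\<^sub>R a) \<le> (hypsum t w')\<^sup>2 * en (b - w *\<^sub>R a)"
    using hypsum_props(1)[of t w] V w by (intro mult_right_mono power_mono nonneg) auto
  finally have "en (a - w *\<^sub>R b) \<le> (hypsum t w')\<^sup>2 * en (b - w *\<^sub>R a)" .
  then have "((1 + c) / 2)\<^sup>2 * en (a - w *\<^sub>R b) \<le> ((1 + c) / 2)\<^sup>2 * ((hypsum t w')\<^sup>2 * en (b - w *\<^sub>R a))"
    by (rule mult_left_mono) simp
  then show ?thesis unfolding sub add en_scale w'_def[symmetric] by (simp only: mult_ac)
qed

end

abbreviation even_mat :: "real list \<Rightarrow> complex^'n^'n \<Rightarrow> complex^'n^'n" where
  "even_mat xs V \<equiv> mat_poly (even_part xs) (V ** V)"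

abbreviation odd_mat :: "real list \<Rightarrow> complex^'n^'n \<Rightarrow> complex^'n^'n" where
  "odd_mat xs V \<equiv> mat_poly (odd_part xs) (V ** V)"

text \<open>These are \<open>G(- V)\<close> and \<open>G(V)\<close> for the product \<open>G\<close> of the factors \<open>t + V\<close>.\<close>

definition diff_mat :: "real list \<Rightarrow> complex^'n^'n \<Rightarrow> complex^'n^'n" where
  "diff_mat xs V = even_mat xs V - V ** odd_mat xs V"

definition sum_mat :: "real list \<Rightarrow> complex^'n^'n \<Rightarrow> complex^'n^'n" where
  "sum_mat xs V = even_mat xs V + V ** odd_mat xs V"

lemma mat_poly_square_commute: "mat_poly p (V ** V) ** V = V ** mat_poly p (V ** V)"
  by (rule mat_poly_commute_matrix) (simp add: matrix_mul_assoc)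

lemma even_odd_mat_Cons:
  "even_mat (c # cs) V = c *\<^sub>R even_mat cs V + V ** (V ** odd_mat cs V)"
  "odd_mat (c # cs) V = even_mat cs V + c *\<^sub>R odd_mat cs V"
  by (simp_all add: mat_poly_add mat_poly_smult mat_poly_pCons matrix_mul_assoc)

lemma diff_sum_mat_commute: "V ** diff_mat cs V = diff_mat cs V ** V" "V ** sum_mat cs V = sum_mat cs V ** V"
  by (simp_all add: diff_mat_def sum_mat_def matrix_diff_ldistrib matrix_diff_rdistrib matrix_add_ldistrib
      matrix_add_rdistrib mat_poly_square_commute flip: matrix_mul_assoc)

lemma diff_sum_mat_Cons:
  "diff_mat (c # cs) V = c *\<^sub>R diff_mat cs V - V ** diff_mat cs V"
  "sum_mat (c # cs) V = c *\<^sub>R sum_mat cs V + V ** sum_mat cs V"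
  unfolding diff_mat_def sum_mat_def even_odd_mat_Cons
  by (simp_all add: matrix_diff_ldistrib matrix_add_ldistrib
      matrix_scalar_ac scaleR_add_right scaleR_diff_right flip: scalar_matrix_assoc)

lemma diff_sum_mat_Cons_vec:
  "diff_mat (c # cs) V *v u = diff_mat cs V *v (c *\<^sub>R u - V *v u)"
  "sum_mat (c # cs) V *v u = sum_mat cs V *v (c *\<^sub>R u + V *v u)"
  by (simp_all add: diff_sum_mat_Cons diff_sum_mat_commute matrix_vector_mult_diff_rdistrib
      matrix_vector_mult_add_rdistrib matrix_vector_mult_diff_distrib matrix_vector_right_distrib
      scaleR_matrix_vector matrix_vector_scaleR matrix_vector_mul_assoc)

context energy_form
begin

text \<open>The factors commute, so they can be reflected one at a time; the zero closest to \<open>\<alpha>\<close> is the worst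
case for the bound on a single factor.\<close>

lemma cayley_le_parts:
  assumes V: "cayley_le V t" "0 < t" "t < 1" and \<alpha>: "0 < \<alpha>" and xs: "set xs \<subseteq> {\<alpha>..1}"
  defines "\<rho> \<equiv> hypsum t ((1 - \<alpha>) / (1 + \<alpha>))"
  shows "en (diff_mat xs V *v u) \<le> (\<rho> ^ length xs)\<^sup>2 * en (sum_mat xs V *v u)"
  using xs
proof (induction xs arbitrary: u)
  case Nil
  then show ?case by (simp add: diff_mat_def sum_mat_def)
next
  case (Cons c cs)
  let ?u = "c *\<^sub>R u - V *v u"
  have move: "sum_mat cs V *v ?u = c *\<^sub>R (sum_mat cs V *v u) - V *v (sum_mat cs V *v u)"
    "sum_mat (c # cs) V *v u = c *\<^sub>R (sum_mat cs V *v u) + V *v (sum_mat cs V *v u)"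
    by (simp_all add: diff_sum_mat_Cons diff_sum_mat_commute matrix_vector_mult_diff_distrib
        matrix_vector_mult_add_rdistrib scaleR_matrix_vector matrix_vector_scaleR matrix_vector_mul_assoc)
  have "en (diff_mat (c # cs) V *v u) = en (diff_mat cs V *v ?u)" by (simp only: diff_sum_mat_Cons_vec)
  also have "\<dots> \<le> (\<rho> ^ length cs)\<^sup>2 * en (sum_mat cs V *v ?u)" using Cons by auto
  also have "\<dots> \<le> (\<rho> ^ length cs)\<^sup>2 * (\<rho>\<^sup>2 * en (sum_mat (c # cs) V *v u))"
    unfolding move \<rho>_def using Cons.prems by (intro mult_left_mono cayley_le_factor V \<alpha>) auto
  finally show ?case by (simp add: power_mult_distrib mult_ac)
qed

lemma sum_mat_kernel:
  assumes V: "cayley_le V t" "0 < t" "t < 1" and \<alpha>: "0 < \<alpha>" and xs: "set xs \<subseteq> {\<alpha>..1}"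
    and "sum_mat xs V *v u = 0"
  shows "u = 0"
  using xs assms(6)
proof (induction xs arbitrary: u)
  case Nil
  then show ?case by (simp add: sum_mat_def)
next
  case (Cons c cs)
  then have "c *\<^sub>R u + V *v u = 0" by (simp add: diff_sum_mat_Cons_vec)
  moreover from this have "en (c *\<^sub>R u - V *v u) \<le> 0"
    using cayley_le_factor[OF V \<alpha>, of c u] Cons.prems(1) by simp
  then have "c *\<^sub>R u - V *v u = 0" using nonneg[of "c *\<^sub>R u - V *v u"] en_0 by force
  ultimately have "(c *\<^sub>R u + V *v u) + (c *\<^sub>R u - V *v u) = 0" by (simp only: add_0_left)
  moreover have "2 *\<^sub>R (c *\<^sub>R u) = (c *\<^sub>R u + V *v u) + (c *\<^sub>R u - V *v u)"
    unfolding scaleR_2 by simp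
  ultimately have "2 *\<^sub>R (c *\<^sub>R u) = 0" by (simp only:)
  then show ?case using Cons.prems(1) \<alpha> by simp
qed

text \<open>One step of the iteration replaces \<open>V\<close> by \<open>V'\<close> with \<open>V' E = V O\<close>, so that \<open>1 - V'\<close> and \<open>1 + V'\<close> are \<open>G(- V)\<close> and
\<open>G(V)\<close> up to the same right factor: the Cayley transform is mapped by the Blaschke product. A kernel
vector of \<open>E\<close> would satisfy \<open>G(- V) u = - G(V) u\<close>, which a contraction excludes; so there is no pole.\<close>

theorem cayley_le_step:
  fixes V :: "complex^'n^'n"
  assumes V: "cayley_le V t" "0 < t" "t < 1" and \<alpha>: "0 < \<alpha>" "\<alpha> < 1" and xs: "set xs \<subseteq> {\<alpha>..1}" "xs \<noteq> []"
  shows "invertible (even_mat xs V)"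
    and "cayley_le (V ** (odd_mat xs V ** matrix_inv (even_mat xs V)))
           (hypsum t ((1 - \<alpha>) / (1 + \<alpha>)) ^ length xs)"
proof -
  define \<rho> where "\<rho> = hypsum t ((1 - \<alpha>) / (1 + \<alpha>))"
  have w: "0 \<le> (1 - \<alpha>) / (1 + \<alpha>)" "(1 - \<alpha>) / (1 + \<alpha>) < 1" using \<alpha> by (auto simp: divide_simps)
  have \<rho>: "0 \<le> \<rho>" "\<rho> < 1" using hypsum_props[of t "(1 - \<alpha>) / (1 + \<alpha>)"] V w by (auto simp: \<rho>_def)
  then have \<rho>n: "(\<rho> ^ length xs)\<^sup>2 < 1" using xs(2) by (simp add: power_less_one_iff abs_if flip: power_mult)
  note bound = cayley_le_parts[OF V \<alpha>(1) xs(1), folded \<rho>_def]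
  show inv: "invertible (even_mat xs V)"
  proof (rule invertible_if_kernel_trivial)
    fix u assume "even_mat xs V *v u = 0"
    then have "diff_mat xs V *v u = (- 1) *\<^sub>R (sum_mat xs V *v u)"
      by (simp add: diff_mat_def sum_mat_def matrix_vector_mult_diff_rdistrib matrix_vector_mult_add_rdistrib)
    then have "en (sum_mat xs V *v u) \<le> (\<rho> ^ length xs)\<^sup>2 * en (sum_mat xs V *v u)"
      using bound[of u] by (simp only: en_scale) simp
    then have "(1 - (\<rho> ^ length xs)\<^sup>2) * en (sum_mat xs V *v u) \<le> 0" by (simp add: algebra_simps)
    then have "en (sum_mat xs V *v u) \<le> 0" using \<rho>n by (simp add: mult_le_0_iff)
    then have "sum_mat xs V *v u = 0" using nonneg[of "sum_mat xs V *v u"] by (intro en_0) simp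
    then show "u = 0" by (rule sum_mat_kernel[OF V \<alpha>(1) xs(1)])
  qed
  let ?V' = "V ** (odd_mat xs V ** matrix_inv (even_mat xs V))"
  show "cayley_le ?V' (\<rho> ^ length xs)"
    unfolding cayley_le_def
  proof
    fix y
    define u where "u = matrix_inv (even_mat xs V) *v y"
    have y: "even_mat xs V *v u = y"
      by (simp add: u_def matrix_vector_mul_assoc matrix_inv_right_left[OF inv])
    have V': "?V' *v y = (V ** odd_mat xs V) *v u"
      by (simp add: u_def matrix_vector_mul_assoc matrix_mul_assoc)
    have "y - ?V' *v y = diff_mat xs V *v u" "y + ?V' *v y = sum_mat xs V *v u"
      unfolding V' by (simp_all add: diff_mat_def sum_mat_def y matrix_vector_mult_diff_rdistrib matrix_vector_mult_add_rdistrib)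
    then show "en (y - ?V' *v y) \<le> (\<rho> ^ length xs)\<^sup>2 * en (y + ?V' *v y)" using bound[of u] by simp
  qed
qed

text \<open>In terms of \<open>p = (V - 1) u\<close> the hypothesis bounds the energy of \<open>p\<close> by that of \<open>2 u + p\<close>, which is at
most 8 times the energy of \<open>u\<close> plus twice that of \<open>p\<close>; for small \<open>t\<close> the latter is absorbed.\<close>

lemma cayley_le_imp_near_1:
  assumes "cayley_le V t" "0 \<le> t" "t \<le> 1 / 2"
  shows "(norm (V *v u - u))\<^sup>2 \<le> 16 * K * t\<^sup>2 * (norm u)\<^sup>2"
proof -
  define p where "p = V *v u - u"
  have "en (u - V *v u) = en p" using en_scale[of "- 1" p] by (simp add: p_def)
  then have "en p \<le> t\<^sup>2 * en (2 *\<^sub>R u + p)"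
    using assms(1)[unfolded cayley_le_def, rule_format, of u] by (simp add: p_def scaleR_2 algebra_simps)
  also have "en (2 *\<^sub>R u + p) \<le> 8 * en u + 2 * en p"
    using nonneg[of "2 *\<^sub>R u - p"]
    by (simp add: add_left add_right diff_left diff_right scale_left scale_right symmetric[of p u])
  then have "t\<^sup>2 * en (2 *\<^sub>R u + p) \<le> t\<^sup>2 * (8 * en u + 2 * en p)" by (rule mult_left_mono) simp
  finally have 1: "en p \<le> 8 * t\<^sup>2 * en u + 2 * (t\<^sup>2 * en p)" by (simp add: algebra_simps)
  have "t\<^sup>2 \<le> (1 / 2)\<^sup>2" using assms by (intro power_mono)
  then have "t\<^sup>2 * en p \<le> (1 / 4) * en p" using nonneg[of p] by (intro mult_right_mono) (auto simp: power2_eq_square)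
  with 1 have "en p \<le> 16 * t\<^sup>2 * en u" by linarith
  also have "\<dots> \<le> 16 * t\<^sup>2 * (K * (norm u)\<^sup>2)" by (intro mult_left_mono upper) auto
  finally show ?thesis using lower[of p] by (simp add: p_def mult_ac)
qed

end

text \<open>Stein's construction cut off after finitely many terms: if \<open>W ^ N\<close> has norm at most \<open>1 / 2 = r ^ N\<close>, then
in the sum of the energies of \<open>W ^ k u\<close> over \<open>k < N\<close>, weighted by \<open>r\<close> to the power \<open>- 2 k\<close>, the
term that enters when \<open>u\<close> is replaced by \<open>W u\<close> is at most the one that leaves.\<close>

lemma adapted_energy_form:
  fixes W :: "complex^'n^'n"
  assumes "\<And>c. eigenvalue W c \<Longrightarrow> cmod c < 1"
  obtains \<beta> K r where "energy_form \<beta> K" "0 < r" "r < 1" "\<And>u. \<beta> (W *v u) (W *v u) \<le> r\<^sup>2 * \<beta> u u"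
proof -
  obtain C where C: "0 < C" "\<And>(A :: complex^'n^'n) (u :: complex^'n). norm (A *v u) \<le> norm A * norm u * C"
    using bounded_bilinear.pos_bounded[OF bounded_bilinear_matrix_vector_mult] by blast
  have "\<forall>\<^sub>F N in sequentially. norm (mat_power W N) < 1 / (2 * C)"
    using tendsto_norm_zero[OF mat_power_tendsto_0[OF assms]] C(1) by (intro order_tendstoD(2)) auto
  then obtain N0 where N0: "\<And>N. N0 \<le> N \<Longrightarrow> norm (mat_power W N) < 1 / (2 * C)"
    by (auto simp: eventually_sequentially)
  define N where "N = Suc N0"
  have N: "0 < N" "norm (mat_power W N) < 1 / (2 * C)" using N0[of N] by (simp_all add: N_def)
  have WN: "norm (mat_power W N *v u) \<le> 1 / 2 * norm u" for u
  proof -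
    have "norm (mat_power W N *v u) \<le> (norm (mat_power W N) * C) * norm u" using C(2)[of "mat_power W N" u] by (simp add: mult_ac)
    also have "\<dots> \<le> 1 / 2 * norm u"
      using N(2) C(1) by (intro mult_right_mono) (auto simp: field_simps)
    finally show ?thesis .
  qed
  define r where "r = root N (1 / 2)"
  have r: "0 < r" "r < 1" "r ^ N = 1 / 2" using N(1) by (auto simp: r_def)
  define c where "c k = inverse (r\<^sup>2) ^ k" for k
  define \<beta> where "\<beta> u v = (\<Sum>k<N. c k * inner (mat_power W k *v u) (mat_power W k *v v))" for u v
  define K where "K = (\<Sum>k<N. c k * (norm (mat_power W k) * C)\<^sup>2)"
  have c: "0 < c k" for k using r by (simp add: c_def)
  have \<beta>_norm: "\<beta> u u = (\<Sum>k<N. c k * (norm (mat_power W k *v u))\<^sup>2)" for u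
    by (simp add: \<beta>_def power2_norm_eq_inner)
  have "energy_form \<beta> K"
  proof
    show "\<beta> (u + v) w = \<beta> u w + \<beta> v w" for u v w
      by (simp add: \<beta>_def matrix_vector_right_distrib inner_add_left distrib_left sum.distrib)
    show "\<beta> (s *\<^sub>R u) w = s * \<beta> u w" for s u w
      by (simp add: \<beta>_def matrix_vector_scaleR sum_distrib_left mult_ac)
    show "\<beta> u v = \<beta> v u" for u v by (simp add: \<beta>_def inner_commute)
    show "(norm u)\<^sup>2 \<le> \<beta> u u" for u
    proof -
      have "(norm u)\<^sup>2 = c 0 * (norm (mat_power W 0 *v u))\<^sup>2" by (simp add: c_def)
      also have "\<dots> \<le> \<beta> u u"
        unfolding \<beta>_norm using N(1) less_imp_le[OF c] by (intro member_le_sum mult_nonneg_nonneg) auto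
      finally show ?thesis .
    qed
    show "\<beta> u u \<le> K * (norm u)\<^sup>2" for u
    proof -
      have "c k * (norm (mat_power W k *v u))\<^sup>2 \<le> c k * (norm (mat_power W k) * C)\<^sup>2 * (norm u)\<^sup>2" for k
      proof -
        have "(norm (mat_power W k *v u))\<^sup>2 \<le> ((norm (mat_power W k) * C) * norm u)\<^sup>2"
          using C(2)[of "mat_power W k" u] by (intro power_mono) (auto simp: mult_ac)
        then show ?thesis using c[of k] by (simp add: power_mult_distrib)
      qed
      then show ?thesis unfolding \<beta>_norm K_def sum_distrib_right by (intro sum_mono)
    qed
  qed
  moreover have "\<beta> (W *v u) (W *v u) \<le> r\<^sup>2 * \<beta> u u" for u
  proof -
    define f where "f k = c k * (norm (mat_power W k *v u))\<^sup>2" for k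
    have "\<beta> (W *v u) (W *v u) = (\<Sum>k<N. r\<^sup>2 * f (Suc k))"
      unfolding \<beta>_norm f_def using r(1)
      by (intro sum.cong refl) (simp add: c_def matrix_vector_mul_assoc mat_power_commute)
    also have "\<dots> = r\<^sup>2 * ((\<Sum>k<N. f k) + f N - f 0)"
      using sum.lessThan_Suc_shift[of f N] by (simp flip: sum_distrib_left)
    also have "f N \<le> f 0"
    proof -
      have "f N = (norm (mat_power W N *v u) / r ^ N)\<^sup>2"
        by (simp add: f_def c_def power_divide power_inverse field_simps flip: power_mult)
      also have "\<dots> \<le> (norm u)\<^sup>2"
        using WN[of u] unfolding r(3) by (intro power_mono) auto
      finally show ?thesis by (simp add: f_def c_def)
    qed
    then have "r\<^sup>2 * ((\<Sum>k<N. f k) + f N - f 0) \<le> r\<^sup>2 * (\<Sum>k<N. f k)" by (intro mult_left_mono) auto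
    finally show ?thesis by (simp add: \<beta>_norm f_def)
  qed
  ultimately show ?thesis using that r by blast
qed

lemma standard_energy_form: "energy_form (inner :: complex^'n \<Rightarrow> _) 1"
  by standard (auto simp: inner_add_left inner_add_right inner_commute power2_norm_eq_inner)

text \<open>An eigenvalue \<open>c\<close> of the Cayley transform of \<open>X\<close> belongs to the eigenvalue \<open>(1 - c) / (1 + c)\<close> of \<open>X\<close>,
whose real part is positive exactly if \<open>|c| < 1\<close>.\<close>

lemma initial_cayley_le:
  fixes X :: "complex^'n^'n"
  assumes "\<And>\<mu>. eigenvalue X \<mu> \<Longrightarrow> 0 < Re \<mu>"
  obtains \<beta> K t where "energy_form \<beta> K" "0 < t" "t < 1" "energy_form.cayley_le \<beta> X t"
proof -
  have inv: "invertible (mat 1 + X)"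
  proof (rule invertible_if_kernel_trivial, rule ccontr)
    fix v assume "(mat 1 + X) *v v = 0" "v \<noteq> 0"
    then have "X *v v = (- 1) *s v" by (simp add: matrix_vector_mult_add_rdistrib add_eq_0_iff vec_eq_iff)
    with \<open>v \<noteq> 0\<close> have "0 < Re (- 1)" using assms eigenvalue_def by blast
    then show False by simp
  qed
  define W where "W = (mat 1 - X) ** matrix_inv (mat 1 + X)"
  have W: "W *v (u + X *v u) = u - X *v u" for u
  proof -
    have "W *v ((mat 1 + X) *v u) = (mat 1 - X) *v u"
      by (simp add: W_def matrix_vector_mul_assoc matrix_inv_right_left[OF inv] flip: matrix_mul_assoc)
    then show ?thesis by (simp add: matrix_vector_mult_add_rdistrib matrix_vector_mult_diff_rdistrib)
  qed
  have "cmod c < 1" if c: "eigenvalue W c" for c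
  proof -
    obtain v where v: "v \<noteq> 0" "W *v v = c *s v" using c by (auto simp: eigenvalue_def)
    define u where "u = matrix_inv (mat 1 + X) *v v"
    have uv: "u + X *v u = v"
    proof -
      have "(mat 1 + X) *v u = v" by (simp add: u_def matrix_vector_mul_assoc matrix_inv_right_left[OF inv])
      then show ?thesis by (simp add: matrix_vector_mult_add_rdistrib)
    qed
    have u0: "u \<noteq> 0" using uv v(1) by auto
    have eq: "u - X *v u = c *s (u + X *v u)" using W[of u] v(2) by (simp add: uv)
    then have eq': "(1 - c) *s u = (1 + c) *s (X *v u)"
      by (simp add: vec_eq_iff) (simp add: algebra_simps)
    have c1: "1 + c \<noteq> 0"
    proof
      assume "1 + c = 0"
      then have "(1 - c) *s u = 0" using eq' by (simp only: vector_smult_lzero)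
      then have "c = 1" using u0 by (simp only: vector_mul_eq_0 right_minus_eq simp_thms)
      with \<open>1 + c = 0\<close> show False by simp
    qed
    define \<mu> where "\<mu> = (1 - c) / (1 + c)"
    have "X *v u = \<mu> *s u" using eq' c1 by (simp add: vec_eq_iff \<mu>_def field_simps)
    then have "0 < Re \<mu>" using u0 assms eigenvalue_def by blast
    have c\<mu>: "c * (1 + \<mu>) = 1 - \<mu>" using c1 by (simp add: \<mu>_def field_simps)
    have "cmod (1 - \<mu>) < cmod (1 + \<mu>)"
      using \<open>0 < Re \<mu>\<close> by (simp add: cmod_def power2_eq_square algebra_simps)
    then have "cmod c * cmod (1 + \<mu>) < 1 * cmod (1 + \<mu>)" by (simp add: c\<mu> flip: norm_mult)
    then show ?thesis by (rule mult_right_less_imp_less) simp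
  qed
  then obtain \<beta> K r where r: "energy_form \<beta> K" "0 < r" "r < 1" "\<And>u. \<beta> (W *v u) (W *v u) \<le> r\<^sup>2 * \<beta> u u"
    using adapted_energy_form[of W] by metis
  have "energy_form.cayley_le \<beta> X r"
    unfolding energy_form.cayley_le_def[OF r(1)]
  proof
    fix u
    show "\<beta> (u - X *v u) (u - X *v u) \<le> r\<^sup>2 * \<beta> (u + X *v u) (u + X *v u)"
      using r(4)[of "u + X *v u"] by (simp only: W)
  qed
  with r show ?thesis using that by blast
qed

section \<open>Rational functions of matrices\<close>

text \<open>Evaluation in lowest terms agrees with any representation whose denominator is regular at \<open>X\<close>: the common
factor is then regular as well and cancels.\<close>

lemma mat_eval_Fract:
  fixes X :: "complex^'n^'n"
  assumes "invertible (mat_poly q X)"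
  shows "mat_eval (Fract p q) X = mat_poly p X ** matrix_inv (mat_poly q X)" "mat_defined_at (Fract p q) X"
proof -
  have "q \<noteq> 0"
  proof
    assume "q = 0"
    then have "0 ** matrix_inv (mat_poly q X) = (mat 1 :: complex^'n^'n)"
      using matrix_inv_right_left(1)[OF assms] by simp
    then have "(mat 1 :: complex^'n^'n) = 0" by simp
    then show False by (simp add: vec_eq_iff mat_def) (metis zero_neq_one)
  qed
  then obtain d where d: "p = rat_num (Fract p q) * d" "q = rat_den (Fract p q) * d"
    using Fract_eq_coprime_times by blast
  let ?N = "mat_poly (rat_num (Fract p q)) X" and ?D = "mat_poly (rat_den (Fract p q)) X" and ?d = "mat_poly d X"
  have N: "mat_poly p X = ?N ** ?d" and D: "mat_poly q X = ?D ** ?d"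
    using d by (metis mat_poly_mult)+
  have dD: "?d ** ?D = ?D ** ?d" by (simp add: mult.commute flip: mat_poly_mult)
  have "?D ** (?d ** matrix_inv (mat_poly q X)) = mat 1"
    using matrix_inv_right_left(1)[OF assms] D by (metis matrix_mul_assoc)
  note inv = matrix_inv_eqI[OF this]
  show "mat_defined_at (Fract p q) X" unfolding mat_defined_at_def by (rule inv(1))
  show "mat_eval (Fract p q) X = mat_poly p X ** matrix_inv (mat_poly q X)"
    unfolding mat_eval_def inv(2) N by (simp add: matrix_mul_assoc)
qed

lemma matrix_inv_commute:
  fixes A :: "complex^'n^'n"
  assumes "invertible A" "A ** B = B ** A"
  shows "matrix_inv A ** B = B ** matrix_inv A"
proof -
  have "matrix_inv A ** B = matrix_inv A ** (B ** A) ** matrix_inv A"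
    by (simp add: matrix_inv_right_left[OF assms(1)] flip: matrix_mul_assoc)
  also have "\<dots> = matrix_inv A ** A ** B ** matrix_inv A" by (simp add: matrix_mul_assoc flip: assms(2))
  also have "\<dots> = B ** matrix_inv A" by (simp add: matrix_inv_right_left[OF assms(1)])
  finally show ?thesis .
qed

text \<open>Everything follows from the smallness of \<open>g = matrix_inv L ** (L - f x)\<close>: it excludes kernel vectors of
\<open>f x\<close>, it bounds the inverse, and it controls the difference of the inverses, which is
\<open>g ** matrix_inv (f x)\<close>.\<close>

lemma tendsto_matrix_inv:
  fixes f :: "'a \<Rightarrow> complex^'n^'n"
  assumes lim: "(f \<longlongrightarrow> L) F" and L: "invertible L"
  shows "\<forall>\<^sub>F x in F. invertible (f x)" "((\<lambda>x. matrix_inv (f x)) \<longlongrightarrow> matrix_inv L) F"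
proof -
  interpret mm: bounded_bilinear "(**) :: complex^'n^'n \<Rightarrow> complex^'n^'n \<Rightarrow> complex^'n^'n"
    by (rule bounded_bilinear_matrix_mult)
  obtain C where C: "0 < C" "\<And>(A :: complex^'n^'n) (B :: complex^'n^'n). norm (A ** B) \<le> norm A * norm B * C"
    using mm.pos_bounded by blast
  obtain C' where C': "0 < C'" "\<And>(A :: complex^'n^'n) (v :: complex^'n). norm (A *v v) \<le> norm A * norm v * C'"
    using bounded_bilinear.pos_bounded[OF bounded_bilinear_matrix_vector_mult] by blast
  let ?Li = "matrix_inv L"
  have "((\<lambda>x. ?Li ** (L - f x)) \<longlongrightarrow> ?Li ** (L - L)) F"
    by (intro mm.tendsto tendsto_intros lim)
  then have G: "((\<lambda>x. ?Li ** (L - f x)) \<longlongrightarrow> 0) F" by simp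
  have "\<forall>\<^sub>F x in F. norm (?Li ** (L - f x)) < 1 / (2 * (C + C'))"
    using tendsto_norm_zero[OF G] C C' by (intro order_tendstoD(2)) auto
  then have ev: "\<forall>\<^sub>F x in F. norm (?Li ** (L - f x)) * C \<le> 1 / 2 \<and> norm (?Li ** (L - f x)) * C' \<le> 1 / 2"
  proof eventually_elim
    case (elim x)
    have "norm (?Li ** (L - f x)) * (C + C') \<le> 1 / 2"
      using elim C C' by (simp add: field_simps)
    moreover have "0 \<le> norm (?Li ** (L - f x)) * C" "0 \<le> norm (?Li ** (L - f x)) * C'" using C C' by simp_all
    ultimately show ?case by (simp only: distrib_left) linarith
  qed
  have Lf: "?Li ** (L - f x) = mat 1 - ?Li ** f x" for x
    by (simp add: matrix_diff_ldistrib matrix_inv_right_left[OF L])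
  show inv: "\<forall>\<^sub>F x in F. invertible (f x)"
    using ev
  proof eventually_elim
    case (elim x)
    show ?case
    proof (rule invertible_if_kernel_trivial)
      fix v assume "f x *v v = 0"
      then have "(?Li ** (L - f x)) *v v = v"
        unfolding Lf by (simp add: matrix_vector_mult_diff_rdistrib flip: matrix_vector_mul_assoc)
      then have "norm v \<le> (norm (?Li ** (L - f x)) * C') * norm v" using C'(2)[of "?Li ** (L - f x)" v] by (simp add: mult_ac)
      also have "\<dots> \<le> 1 / 2 * norm v" using elim by (intro mult_right_mono) auto
      finally show "v = 0" by simp
    qed
  qed
  have "\<forall>\<^sub>F x in F. norm (matrix_inv (f x) - ?Li) \<le> norm (?Li ** (L - f x)) * (2 * norm ?Li * C)"
    using ev inv
  proof eventually_elim
    case (elim x)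
    let ?S = "matrix_inv (f x)" and ?g = "?Li ** (L - f x)"
    have eq: "?S - ?Li = ?g ** ?S"
      unfolding Lf by (simp add: matrix_diff_rdistrib matrix_inv_right_left[OF elim(2)] flip: matrix_mul_assoc)
    have "norm (?S - ?Li) \<le> (norm ?g * C) * norm ?S" unfolding eq using C(2)[of ?g ?S] by (simp add: mult_ac)
    also have "\<dots> \<le> 1 / 2 * norm ?S" using elim(1) by (intro mult_right_mono) auto
    finally have S: "norm ?S \<le> 2 * norm ?Li" using norm_triangle_ineq2[of ?S ?Li] by linarith
    have "norm (?S - ?Li) \<le> norm ?g * norm ?S * C" unfolding eq by (rule C(2))
    also have "\<dots> \<le> norm ?g * (2 * norm ?Li) * C" using S C by (intro mult_right_mono mult_left_mono) auto
    finally show ?case by (simp add: mult_ac)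
  qed
  moreover have "((\<lambda>x. norm (?Li ** (L - f x)) * (2 * norm ?Li * C)) \<longlongrightarrow> 0) F"
    using tendsto_mult_left_zero[OF tendsto_norm_zero[OF G]] by blast
  ultimately have "((\<lambda>x. matrix_inv (f x) - ?Li) \<longlongrightarrow> 0) F" by (rule Lim_null_comparison)
  then show "((\<lambda>x. matrix_inv (f x)) \<longlongrightarrow> ?Li) F" by (simp only: Lim_null[symmetric])
qed

section \<open>The limiting map and its derivative\<close>

lemma mat_poly_at_1: "mat_poly p (mat 1) = poly p 1 *\<^sub>R mat 1"
  by (induction p) (simp_all add: mat_poly_pCons scaleR_add_left)

lemma has_derivative_mat_poly_at_1:
  "(mat_poly p has_derivative (\<lambda>H. poly (pderiv p) 1 *\<^sub>R H)) (at (mat 1 :: complex^'n^'n))"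
proof (induction p)
  case 0
  have "mat_poly 0 = (\<lambda>X :: complex^'n^'n. 0)" by (rule ext) simp
  then show ?case by simp
next
  case (pCons a p)
  have "((\<lambda>X. a *\<^sub>R mat 1 + X ** mat_poly p X) has_derivative
      (\<lambda>H. 0 + (mat 1 ** (poly (pderiv p) 1 *\<^sub>R H) + H ** mat_poly p (mat 1)))) (at (mat 1 :: complex^'n^'n))"
    by (intro has_derivative_add has_derivative_const bounded_bilinear.FDERIV[OF bounded_bilinear_matrix_mult]
        has_derivative_ident pCons.IH)
  moreover have "0 + (mat 1 ** (poly (pderiv p) 1 *\<^sub>R H) + H ** mat_poly p (mat 1))
      = poly (pderiv (pCons a p)) 1 *\<^sub>R H" for H :: "complex^'n^'n"
    by (simp add: mat_poly_at_1 matrix_scalar_ac pderiv_pCons scaleR_add_left flip: scalar_matrix_assoc)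
  moreover have "mat_poly (pCons a p) = (\<lambda>X :: complex^'n^'n. a *\<^sub>R mat 1 + X ** mat_poly p X)"
    by (rule ext) (rule mat_poly_pCons)
  ultimately show ?case by simp
qed

text \<open>A product rule that asks the second factor only for continuity, since the first one vanishes. It
allows the inverse of the denominator to be treated without differentiating it.\<close>

lemma has_derivative_vanishing_times:
  fixes R S :: "complex^'n^'n \<Rightarrow> complex^'n^'n"
  assumes R: "(R has_derivative R') (at x)" and R0: "R x = 0" and S: "(S \<longlongrightarrow> S x) (at x)"
  shows "((\<lambda>X. R X ** S X) has_derivative (\<lambda>H. R' H ** S x)) (at x)"
proof -
  interpret mm: bounded_bilinear "(**) :: complex^'n^'n \<Rightarrow> complex^'n^'n \<Rightarrow> complex^'n^'n"
    by (rule bounded_bilinear_matrix_mult)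
  have R'lin: "bounded_linear R'" using R by (rule has_derivative_bounded_linear)
  obtain C where C: "0 < C" "\<And>(A :: complex^'n^'n) (B :: complex^'n^'n). norm (A ** B) \<le> norm A * norm B * C"
    using mm.pos_bounded by blast
  obtain C' where C': "0 < C'" "\<And>H. norm (R' H) \<le> norm H * C'"
    using bounded_linear.pos_bounded[OF R'lin] by blast
  have lin: "bounded_linear (\<lambda>H. R' H ** S x)"
    by (rule bounded_linear_compose[OF mm.bounded_linear_left R'lin])
  have lim0: "((\<lambda>y. (1 / norm (y - x)) *\<^sub>R (R y - (R x + R' (y - x)))) \<longlongrightarrow> 0) (at x)"
    using R by (simp add: has_derivative_within)
  have "((\<lambda>y. ((1 / norm (y - x)) *\<^sub>R (R y - (R x + R' (y - x)))) ** S y) \<longlongrightarrow> 0 ** S x) (at x)"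
    by (intro mm.tendsto lim0 S)
  moreover have "((\<lambda>y. ((1 / norm (y - x)) *\<^sub>R R' (y - x)) ** (S y - S x)) \<longlongrightarrow> 0) (at x)"
  proof (rule Lim_null_comparison)
    show "\<forall>\<^sub>F y in at x. norm (((1 / norm (y - x)) *\<^sub>R R' (y - x)) ** (S y - S x)) \<le> C' * C * norm (S y - S x)"
      unfolding eventually_at_filter
    proof (intro always_eventually allI impI)
      fix y assume "y \<noteq> x"
      then have "norm ((1 / norm (y - x)) *\<^sub>R R' (y - x)) \<le> C'"
        using C'(2)[of "y - x"] by (simp add: divide_simps mult.commute)
      then have "norm ((1 / norm (y - x)) *\<^sub>R R' (y - x)) * norm (S y - S x) * C \<le> C' * norm (S y - S x) * C"
        using C by (intro mult_right_mono) auto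
      with C(2)[of "(1 / norm (y - x)) *\<^sub>R R' (y - x)" "S y - S x"]
      show "norm (((1 / norm (y - x)) *\<^sub>R R' (y - x)) ** (S y - S x)) \<le> C' * C * norm (S y - S x)"
        by (simp add: mult_ac)
    qed
    have "((\<lambda>y. norm (S y - S x)) \<longlongrightarrow> 0) (at x)"
      using S by (intro tendsto_norm_zero) (simp only: Lim_null[symmetric])
    from tendsto_mult_right_zero[OF this] show "((\<lambda>y. C' * C * norm (S y - S x)) \<longlongrightarrow> 0) (at x)" by simp
  qed
  ultimately have "((\<lambda>y. ((1 / norm (y - x)) *\<^sub>R (R y - (R x + R' (y - x)))) ** S y
      + ((1 / norm (y - x)) *\<^sub>R R' (y - x)) ** (S y - S x)) \<longlongrightarrow> 0 ** S x + 0) (at x)"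
    by (rule tendsto_add)
  moreover have "((1 / norm (y - x)) *\<^sub>R (R y - (R x + R' (y - x)))) ** S y
      + ((1 / norm (y - x)) *\<^sub>R R' (y - x)) ** (S y - S x)
      = (1 / norm (y - x)) *\<^sub>R (R y ** S y - (R x ** S x + R' (y - x) ** S x))" for y
    by (simp add: R0 matrix_diff_ldistrib matrix_diff_rdistrib scaleR_diff_right flip: scalar_matrix_assoc)
  ultimately show ?thesis using lin by (simp add: has_derivative_within)
qed

lemma poly_parts_diff:
  "poly (even_part xs) (x\<^sup>2) - x * poly (odd_part xs) (x\<^sup>2) = (\<Prod>t\<leftarrow>xs. t - x)"
proof (induction xs)
  case (Cons t ts)
  have "poly (even_part (t # ts)) (x\<^sup>2) - x * poly (odd_part (t # ts)) (x\<^sup>2)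
      = (t - x) * (poly (even_part ts) (x\<^sup>2) - x * poly (odd_part ts) (x\<^sup>2))"
    by (simp add: algebra_simps power2_eq_square)
  with Cons show ?case by simp
qed simp

text \<open>The identity \<open>E(x * x) - x * O(x * x) = (1 - x) ^ n\<close> and its derivative at 1 give the values and the first
derivatives that enter the derivative of \<open>O / E\<close>.\<close>

lemma pade_parts_at_1:
  fixes n :: nat
  defines "xs \<equiv> replicate n (1::real)"
  assumes "2 \<le> n"
  shows "poly (even_part xs) 1 = poly (odd_part xs) 1" "0 < poly (even_part xs) 1"
    "poly (pderiv (odd_part xs)) 1 - poly (pderiv (even_part xs)) 1 = - poly (even_part xs) 1 / 2"
proof -
  let ?E = "even_part xs" and ?O = "odd_part xs"
  have eq: "poly ?E (x\<^sup>2) - x * poly ?O (x\<^sup>2) = (1 - x) ^ n" for x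
    by (simp add: poly_parts_diff xs_def)
  show EO: "poly ?E 1 = poly ?O 1" using eq[of 1] assms(2) by (simp add: power_0_left)
  have "\<And>t. t \<in> set xs \<Longrightarrow> 0 < t" by (auto simp: xs_def)
  then show "0 < poly ?E 1" by (intro parts_pos(1)) auto
  have "((\<lambda>x. poly ?E (x\<^sup>2) - x * poly ?O (x\<^sup>2)) has_real_derivative
      (poly (pderiv ?E) (1\<^sup>2) * 2 - (1 * (poly (pderiv ?O) (1\<^sup>2) * 2) + poly ?O (1\<^sup>2)))) (at 1)"
    by (auto intro!: derivative_eq_intros DERIV_chain2[OF poly_DERIV])
  moreover have "((\<lambda>x::real. (1 - x) ^ n) has_real_derivative 0) (at 1)"
    using assms(2) by (auto intro!: derivative_eq_intros simp: power_0_left)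
  ultimately have "poly (pderiv ?E) (1\<^sup>2) * 2 - (1 * (poly (pderiv ?O) (1\<^sup>2) * 2) + poly ?O (1\<^sup>2)) = 0"
    unfolding eq by (rule DERIV_unique)
  then show "poly (pderiv ?O) 1 - poly (pderiv ?E) 1 = - poly ?E 1 / 2" using EO by (simp add: field_simps)
qed

lemma pade_q_derivative:
  assumes "1 \<le> m" "l \<in> {m - 1, m}"
  shows "mat_eval (pade_q l m) (mat 1) = (mat 1 :: complex^'n^'n)"
    and "(mat_eval (pade_q l m) has_derivative (\<lambda>H. (- 1 / 2) *\<^sub>R H)) (at (mat 1 :: complex^'n^'n))"
proof -
  define xs where "xs = replicate (m + l + 1) (1::real)"
  let ?E = "even_part xs" and ?O = "odd_part xs"
  define d where "d = poly ?E 1"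
  have n: "2 \<le> m + l + 1" using assms by auto
  note at1 = pade_parts_at_1[OF n, folded xs_def d_def]
  have q: "pade_q l m = Fract ?O ?E" unfolding xs_def by (rule pade_q_eq[OF assms])
  define D N where "D = (mat_poly ?E :: complex^'n^'n \<Rightarrow> _)" and "N = (mat_poly ?O :: complex^'n^'n \<Rightarrow> _)"
  have D1: "D (mat 1) = d *\<^sub>R mat 1" and N1: "N (mat 1) = d *\<^sub>R mat 1"
    by (simp_all add: D_def N_def mat_poly_at_1 d_def[symmetric] at1(1)[symmetric])
  have "(d *\<^sub>R mat 1) ** ((1 / d) *\<^sub>R mat 1) = (mat 1 :: complex^'n^'n)"
    using at1(2) by (simp add: matrix_scalar_ac flip: scalar_matrix_assoc)
  note invd = matrix_inv_eqI[OF this]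
  have D': "(D has_derivative (\<lambda>H. poly (pderiv ?E) 1 *\<^sub>R H)) (at (mat 1))"
    and N': "(N has_derivative (\<lambda>H. poly (pderiv ?O) 1 *\<^sub>R H)) (at (mat 1))"
    unfolding D_def N_def by (rule has_derivative_mat_poly_at_1)+
  have Dlim: "(D \<longlongrightarrow> d *\<^sub>R mat 1) (at (mat 1))"
    using has_derivative_continuous[OF D'] unfolding isCont_def D1 .
  note S = tendsto_matrix_inv[OF Dlim invd(1)]
  have eval: "mat_eval (pade_q l m) X = mat 1 + (N X - D X) ** matrix_inv (D X)" if "invertible (D X)" for X
    using mat_eval_Fract(1)[of ?E X ?O] that
    by (simp add: q D_def N_def matrix_diff_rdistrib matrix_inv_right_left)
  show *: "mat_eval (pade_q l m) (mat 1) = (mat 1 :: complex^'n^'n)"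
    using eval[of "mat 1"] invd(1) by (simp add: D1 N1)
  have "((\<lambda>X. (N X - D X) ** matrix_inv (D X)) has_derivative
      (\<lambda>H. (poly (pderiv ?O) 1 *\<^sub>R H - poly (pderiv ?E) 1 *\<^sub>R H) ** matrix_inv (D (mat 1)))) (at (mat 1))"
    by (rule has_derivative_vanishing_times) (intro has_derivative_diff N' D', simp add: N1 D1, use S(2) in \<open>simp add: D1\<close>)
  moreover have "(poly (pderiv ?O) 1 *\<^sub>R H - poly (pderiv ?E) 1 *\<^sub>R H) ** matrix_inv (D (mat 1)) = (- 1 / 2) *\<^sub>R H"
    for H :: "complex^'n^'n"
  proof -
    have "poly (pderiv ?O) 1 *\<^sub>R H - poly (pderiv ?E) 1 *\<^sub>R H = (- d / 2) *\<^sub>R H"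
      by (simp only: at1(3) flip: scaleR_diff_left)
    then show ?thesis
      using at1(2) by (simp add: D1 invd(2) matrix_scalar_ac flip: scalar_matrix_assoc)
  qed
  ultimately have "((\<lambda>X. mat 1 + (N X - D X) ** matrix_inv (D X)) has_derivative (\<lambda>H. 0 + (- 1 / 2) *\<^sub>R H)) (at (mat 1))"
    by (intro has_derivative_add has_derivative_const) simp
  then have der: "((\<lambda>X. mat 1 + (N X - D X) ** matrix_inv (D X)) has_derivative (\<lambda>H. (- 1 / 2) *\<^sub>R H)) (at (mat 1))" by simp
  show "(mat_eval (pade_q l m) has_derivative (\<lambda>H. (- 1 / 2) *\<^sub>R H)) (at (mat 1 :: complex^'n^'n))"
  proof (rule has_derivative_transform_eventually[OF der])
    show "\<forall>\<^sub>F X in at (mat 1). mat 1 + (N X - D X) ** matrix_inv (D X) = mat_eval (pade_q l m) X"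
      using S(1) by (rule eventually_mono) (simp add: eval)
    show "mat 1 + (N (mat 1) - D (mat 1)) ** matrix_inv (D (mat 1)) = mat_eval (pade_q l m) (mat 1)"
      by (simp add: * D1 N1)
  qed simp
qed

text \<open>The derivative is \<open>L (H, H') = ((H - X H' X) / 2, (H' - Xi H Xi) / 2)\<close>. It is idempotent, so all its powers
are equal.\<close>

theorem pade_map_stable:
  fixes X Xi :: "complex^'n^'n"
  assumes ml: "1 \<le> m" "l \<in> {m - 1, m}" and inv: "X ** Xi = mat 1" "Xi ** X = mat 1"
  shows "stable_at (pade_map l m) (X, Xi)"
proof -
  let ?q = "mat_eval (pade_q l m) :: complex^'n^'n \<Rightarrow> _"
  note q = pade_q_derivative[OF ml, where 'n = 'n]
  define M where "M W = snd W ** fst W" for W :: "(complex^'n^'n) \<times> (complex^'n^'n)"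
  define M' where "M' H = Xi ** fst H + snd H ** X" for H :: "(complex^'n^'n) \<times> (complex^'n^'n)"
  define L where "L H = ((1 / 2) *\<^sub>R (fst H - X ** (snd H ** X)), (1 / 2) *\<^sub>R (snd H - Xi ** (fst H ** Xi)))"
    for H :: "(complex^'n^'n) \<times> (complex^'n^'n)"
  have M1: "M (X, Xi) = mat 1" by (simp add: M_def inv)
  have M_der: "(M has_derivative M') (at (X, Xi))"
  proof -
    have "((\<lambda>W. snd W ** fst W) has_derivative (\<lambda>H. snd (X, Xi) ** fst H + snd H ** fst (X, Xi)))
        (at (X, Xi :: complex^'n^'n))"
      by (intro bounded_bilinear.FDERIV[OF bounded_bilinear_matrix_mult] has_derivative_fst has_derivative_snd has_derivative_ident)
    then show ?thesis by (simp add: M_def[abs_def] M'_def[abs_def])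
  qed
  have qM: "((\<lambda>W. ?q (M W)) has_derivative (\<lambda>H. (- 1 / 2) *\<^sub>R M' H)) (at (X, Xi))"
    by (rule has_derivative_compose[OF M_der]) (use q(2) M1 in simp)
  have map: "pade_map l m = (\<lambda>W. (fst W ** ?q (M W), ?q (M W) ** snd W))"
    by (simp add: pade_map_def M_def case_prod_unfold)
  have "(pade_map l m has_derivative (\<lambda>H.
      (fst (X, Xi) ** ((- 1 / 2) *\<^sub>R M' H) + fst H ** ?q (M (X, Xi)),
       ?q (M (X, Xi)) ** snd H + ((- 1 / 2) *\<^sub>R M' H) ** snd (X, Xi)))) (at (X, Xi))"
    unfolding map
    by (intro has_derivative_Pair bounded_bilinear.FDERIV[OF bounded_bilinear_matrix_mult] qM
        has_derivative_fst has_derivative_snd has_derivative_ident)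
  moreover have "(fst (X, Xi) ** ((- 1 / 2) *\<^sub>R M' H) + fst H ** ?q (M (X, Xi)),
       ?q (M (X, Xi)) ** snd H + ((- 1 / 2) *\<^sub>R M' H) ** snd (X, Xi)) = L H" for H
  proof -
    have half: "A - (1 / 2) *\<^sub>R A = (1 / 2) *\<^sub>R A" for A :: "complex^'n^'n"
      using scaleR_left_diff_distrib[of 1 "1/2" A] by simp
    have 1: "X ** ((- 1 / 2) *\<^sub>R M' H) + fst H ** mat 1 = (1 / 2) *\<^sub>R (fst H - X ** (snd H ** X))"
    proof -
      have "X ** M' H = fst H + X ** (snd H ** X)"
        by (simp add: M'_def matrix_add_ldistrib matrix_mul_assoc inv)
      then have "X ** ((- 1 / 2) *\<^sub>R M' H) = - ((1 / 2) *\<^sub>R fst H) - (1 / 2) *\<^sub>R (X ** (snd H ** X))"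
        by (simp add: matrix_mul_uminus matrix_scalar_ac scaleR_add_right flip: scalar_matrix_assoc)
      then show ?thesis using half[of "fst H"] by (simp add: scaleR_diff_right)
    qed
    have 2: "mat 1 ** snd H + ((- 1 / 2) *\<^sub>R M' H) ** Xi = (1 / 2) *\<^sub>R (snd H - Xi ** (fst H ** Xi))"
    proof -
      have "M' H ** Xi = Xi ** (fst H ** Xi) + snd H"
        by (simp add: M'_def matrix_add_rdistrib inv flip: matrix_mul_assoc)
      then have "((- 1 / 2) *\<^sub>R M' H) ** Xi = - ((1 / 2) *\<^sub>R snd H) - (1 / 2) *\<^sub>R (Xi ** (fst H ** Xi))"
        by (simp add: matrix_mul_uminus scaleR_add_right flip: scalar_matrix_assoc)
      then show ?thesis using half[of "snd H"] by (simp add: scaleR_diff_right)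
    qed
    show ?thesis using 1 2 by (simp add: L_def M1 q(1))
  qed
  ultimately have der: "(pade_map l m has_derivative L) (at (X, Xi))" by simp
  have LL: "L (L H) = L H" for H
  proof -
    have cancel: "X ** (Xi ** B) = B" "Xi ** (X ** B) = B" "B ** Xi ** X = B" "B ** X ** Xi = B" for B
      by (simp_all add: matrix_mul_assoc inv) (simp_all add: inv flip: matrix_mul_assoc)
    have half: "(1 / 2) *\<^sub>R (A - B) - (1 / 2) *\<^sub>R (B - A) = A - B" for A B :: "complex^'n^'n"
      using scaleR_left_distrib[of "1/2" "1/2" "A - B"] by (simp add: scaleR_diff_right)
    have 1: "X ** ((1 / 2) *\<^sub>R (snd H - Xi ** (fst H ** Xi)) ** X) = (1 / 2) *\<^sub>R (X ** (snd H ** X) - fst H)"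
    proof -
      have "X ** (Xi ** (fst H ** Xi) ** X) = fst H"
        by (simp add: cancel inv flip: matrix_mul_assoc)
      then show ?thesis
        by (simp add: matrix_diff_ldistrib matrix_diff_rdistrib matrix_scalar_ac scaleR_diff_right
            flip: scalar_matrix_assoc)
    qed
    have 2: "Xi ** ((1 / 2) *\<^sub>R (fst H - X ** (snd H ** X)) ** Xi) = (1 / 2) *\<^sub>R (Xi ** (fst H ** Xi) - snd H)"
    proof -
      have "Xi ** (X ** (snd H ** X) ** Xi) = snd H"
        by (simp add: cancel inv flip: matrix_mul_assoc)
      then show ?thesis
        by (simp add: matrix_diff_ldistrib matrix_diff_rdistrib matrix_scalar_ac scaleR_diff_right
            flip: scalar_matrix_assoc)
    qed
    show ?thesis unfolding L_def[of "L H"] unfolding L_def fst_conv snd_conv 1 2 half ..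
  qed
  have pow: "L ^^ i = L" if "1 \<le> i" for i
    using that
  proof (induction i rule: dec_induct)
    case (step i)
    then show ?case by (simp add: fun_eq_iff LL)
  qed simp
  have "pade_map l m (X, Xi) = (X, Xi)" by (simp add: map M1 q(1))
  then show ?thesis unfolding stable_at_def using der pow by (intro conjI exI[of _ L] exI[of _ "onorm L"]) simp_all
qed

section \<open>The coupled iteration\<close>

lemma norm_matrix_le:
  fixes B :: "complex^'n^'n"
  assumes "\<And>u. norm (B *v u) \<le> d * norm u"
  shows "norm B \<le> (real CARD('n))\<^sup>2 * d"
proof -
  have entry: "cmod (B $ i $ j) \<le> d" for i j
  proof -
    have "B $ i $ j = (B *v axis j 1) $ i" 
      by (simp add: matrix_vector_mult_def axis_def if_distrib[of "\<lambda>x. _ * x"] cong: if_cong)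
    then have "cmod (B $ i $ j) \<le> norm (B *v axis j 1)"
      by (simp only: Finite_Cartesian_Product.norm_nth_le)
    also have "\<dots> \<le> d * norm (axis j (1::complex))" by (rule assms)
    finally show ?thesis by (simp add: norm_axis_1)
  qed
  have row: "norm (B $ i) \<le> real CARD('n) * d" for i
  proof -
    have "norm (B $ i) \<le> (\<Sum>j\<in>UNIV. cmod (B $ i $ j))" unfolding norm_vec_def by (rule L2_set_le_sum) simp
    also have "\<dots> \<le> (\<Sum>j\<in>(UNIV::'n set). d)" by (intro sum_mono entry)
    finally show ?thesis by simp
  qed
  have "norm B \<le> (\<Sum>i\<in>UNIV. norm (B $ i))" unfolding norm_vec_def[of B] by (rule L2_set_le_sum) simp
  also have "\<dots> \<le> (\<Sum>i\<in>(UNIV::'n set). real CARD('n) * d)" by (intro sum_mono row)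
  finally show ?thesis by (simp add: power2_eq_square mult_ac)
qed

context energy_form
begin

lemma cayley_le_norm:
  fixes V :: "complex^'n^'n"
  assumes "cayley_le V t" "0 \<le> t" "t \<le> 1 / 2"
  shows "norm (V - mat 1) \<le> (real CARD('n))\<^sup>2 * (4 * sqrt K * t)"
proof (rule norm_matrix_le)
  fix u :: "complex^'n"
  have "1 \<le> K"
    using lower[of "axis undefined 1"] upper[of "axis undefined 1"] by (simp add: norm_axis_1)
  then have "16 * K * t\<^sup>2 * (norm u)\<^sup>2 = (4 * sqrt K * t * norm u)\<^sup>2" by (simp add: power_mult_distrib)
  then have "(norm (V *v u - u))\<^sup>2 \<le> (4 * sqrt K * t * norm u)\<^sup>2"
    using cayley_le_imp_near_1[OF assms, of u] by (simp only:)
  then have "norm (V *v u - u) \<le> 4 * sqrt K * t * norm u"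
    using \<open>1 \<le> K\<close> assms(2) by (elim power2_le_imp_le) simp
  then show "norm ((V - mat 1) *v u) \<le> 4 * sqrt K * t * norm u"
    by (simp add: matrix_vector_mult_diff_rdistrib)
qed

end

lemma near_1_imp_cayley_le:
  assumes "\<And>u. norm ((V - mat 1) *v u) \<le> d * norm (u :: complex^'n)" "0 \<le> d" "d \<le> 1"
  shows "energy_form.cayley_le inner V d"
  unfolding energy_form.cayley_le_def[OF standard_energy_form]
proof
  fix u :: "complex^'n"
  have *: "norm (V *v u - u) \<le> d * norm u"
    using assms(1)[of u] by (simp add: matrix_vector_mult_diff_rdistrib)
  have "2 *\<^sub>R u + (V *v u - u) = u + V *v u" by (simp add: scaleR_2)
  then have "norm (2 *\<^sub>R u) \<le> norm (u + V *v u) + norm (V *v u - u)"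
    using norm_triangle_ineq4[of "u + V *v u" "V *v u - u"] by (simp only: add_diff_cancel_right' flip: \<open>2 *\<^sub>R u + (V *v u - u) = u + V *v u\<close>)
  then have "2 * norm u \<le> norm (u + V *v u) + norm (V *v u - u)" by simp
  moreover have "d * norm u \<le> norm u" using assms(2,3) by (simp add: mult_left_le_one_le)
  ultimately have "norm u \<le> norm (u + V *v u)" using * by linarith
  then have "norm (u - V *v u) \<le> d * norm (u + V *v u)"
    using * assms(2) mult_left_mono[of "norm u" "norm (u + V *v u)" d] by (simp add: norm_minus_commute)
  then have "(norm (u - V *v u))\<^sup>2 \<le> (d * norm (u + V *v u))\<^sup>2" by (intro power_mono) auto
  then show "inner (u - V *v u) (u - V *v u) \<le> d\<^sup>2 * inner (u + V *v u) (u + V *v u)"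
    by (simp add: power2_norm_eq_inner power_mult_distrib)
qed

text \<open>All matrices involved commute, and with \<open>V = X ** Z\<close> the argument \<open>Z ** Y\<close> of the rational function is
\<open>V ** V\<close>. The coupled iteration is therefore the iteration of \<open>V\<close> by the odd map
\<open>x \<mapsto> x * O(x * x) / E(x * x)\<close>.\<close>

lemma coupled_step:
  fixes X Y Z :: "complex^'n^'n" and xs :: "real list"
  defines "V \<equiv> X ** Z" and "H \<equiv> mat_eval (Fract (odd_part xs) (even_part xs)) (Z ** Y)"
  assumes XZ: "X ** Z = Z ** X" and Y: "Y = X ** V" and inv: "invertible (even_mat xs V)"
  shows "mat_defined_at (Fract (odd_part xs) (even_part xs)) (Z ** Y)"
    and "X ** (H ** Z) = H ** Z ** X" and "Y ** H = X ** (X ** (H ** Z))"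
    and "X ** (H ** Z) = V ** (odd_mat xs V ** matrix_inv (even_mat xs V))"
proof -
  have ZY: "Z ** Y = V ** V"
    unfolding Y V_def by (simp add: matrix_mul_assoc XZ) (simp add: XZ flip: matrix_mul_assoc)
  show "mat_defined_at (Fract (odd_part xs) (even_part xs)) (Z ** Y)"
    unfolding ZY by (rule mat_eval_Fract(2)[OF inv])
  have H: "H = odd_mat xs V ** matrix_inv (even_mat xs V)"
    unfolding H_def ZY by (rule mat_eval_Fract(1)[OF inv])
  have H_commute: "H ** B = B ** H" if "V ** B = B ** V" for B
  proof -
    have VV: "V ** V ** B = B ** (V ** V)" using that by (metis matrix_mul_assoc)
    have "matrix_inv (even_mat xs V) ** B = B ** matrix_inv (even_mat xs V)"
      by (rule matrix_inv_commute[OF inv mat_poly_commute_matrix[OF VV]])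
    moreover have "odd_mat xs V ** B = B ** odd_mat xs V" by (rule mat_poly_commute_matrix[OF VV])
    ultimately show ?thesis unfolding H by (metis matrix_mul_assoc)
  qed
  have HX: "H ** X = X ** H" by (rule H_commute) (metis V_def XZ matrix_mul_assoc)
  have HZ: "H ** Z = Z ** H" by (rule H_commute) (metis V_def XZ matrix_mul_assoc)
  show 1: "X ** (H ** Z) = V ** (odd_mat xs V ** matrix_inv (even_mat xs V))"
    unfolding HZ by (simp add: V_def H matrix_mul_assoc)
  show "X ** (H ** Z) = H ** Z ** X" using HX XZ by (metis matrix_mul_assoc)
  show "Y ** H = X ** (X ** (H ** Z))"
    unfolding 1 Y by (simp add: H matrix_mul_assoc)
qed

lemma scalar_step:
  assumes "0 < \<alpha>" "\<alpha> < 1" "1 \<le> m" "l \<in> {m - 1, m}"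
  obtains xs \<beta> where "length xs = m + l + 1" "set xs \<subseteq> {\<alpha>..1}"
    "zolo_h l m \<alpha> = Fract (odd_part xs) (even_part xs)"
    "defined_at (zolo_h l m \<alpha>) (\<alpha>\<^sup>2)" "\<alpha> * rat_eval (zolo_h l m \<alpha>) (\<alpha>\<^sup>2) = (1 - \<beta>) / (1 + \<beta>)"
    "0 < \<beta>" "\<beta> \<le> ((1 - \<alpha>) / (1 + \<alpha>)) ^ (m + l + 1)"
    "(1 / (4 * 3 ^ (m + l + 1))) ^ (m + l + 1) * (1 - \<alpha>) ^ (m + l + 1) \<le> \<beta>"
proof -
  obtain xs where xs: "length xs = m + l + 1" "set xs \<subseteq> {\<alpha>..1}"
    "\<And>x. x \<in> {\<alpha>..1} \<Longrightarrow> refl_prod xs x \<in> {0..refl_prod xs \<alpha>}" "0 < refl_prod xs \<alpha>"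
    "zolo_h l m \<alpha> = Fract (odd_part xs) (even_part xs)"
    using zolo_h_structure[OF assms] by blast
  have pos: "0 < t" if "t \<in> set xs" for t using that xs(2) assms(1) by force
  have ne: "xs \<noteq> []" using xs(1) by auto
  have "0 < poly (even_part xs) (\<alpha>\<^sup>2)" using parts_pos(1)[of xs "\<alpha>\<^sup>2"] pos assms(1) by simp
  then have ev: "rat_eval (zolo_h l m \<alpha>) (\<alpha>\<^sup>2) = poly (odd_part xs) (\<alpha>\<^sup>2) / poly (even_part xs) (\<alpha>\<^sup>2)"
    "defined_at (zolo_h l m \<alpha>) (\<alpha>\<^sup>2)"
    unfolding xs(5) by (intro eval_Fract, simp)+
  show ?thesis
  proof (rule that[OF xs(1,2,5) ev(2) _ xs(4)])
    show "\<alpha> * rat_eval (zolo_h l m \<alpha>) (\<alpha>\<^sup>2) = (1 - refl_prod xs \<alpha>) / (1 + refl_prod xs \<alpha>)"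
      unfolding ev(1) by (rule parts_quotient(2)[OF pos assms(1) ne])
    show "refl_prod xs \<alpha> \<le> ((1 - \<alpha>) / (1 + \<alpha>)) ^ (m + l + 1)"
      using refl_prod_left_end_le[OF assms(1,2) xs(2)] xs(1) by simp
    show "(1 / (4 * 3 ^ (m + l + 1))) ^ (m + l + 1) * (1 - \<alpha>) ^ (m + l + 1) \<le> refl_prod xs \<alpha>"
      using refl_prod_left_end_ge[OF assms(1,2) xs(2,3)] unfolding xs(1) .
  qed
qed

text \<open>In the coordinate \<open>\<omega>\<close> the recurrence reads \<open>\<omega> (Suc k) = \<beta> k\<close>, and as \<open>\<beta> k \<le> \<omega> k ^ n\<close> the errors
decrease at least geometrically.\<close>

lemma scalar_iteration:
  fixes a \<omega> \<beta> :: "nat \<Rightarrow> real"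
  assumes a: "\<And>k. 0 < a k \<and> a k < 1" and step: "\<And>k. a (Suc k) = (1 - \<beta> k) / (1 + \<beta> k)"
    and \<beta>: "\<And>k. 0 < \<beta> k" "\<And>k. \<beta> k \<le> ((1 - a k) / (1 + a k)) ^ n" and n: "2 \<le> n"
  defines "\<omega> \<equiv> \<lambda>k. (1 - a k) / (1 + a k)"
  shows "0 < \<omega> k" "\<omega> k \<le> \<omega> 0" "\<omega> 0 < 1" "\<omega> k \<le> 1 - a k" "summable \<omega>" "a \<longlonglongrightarrow> 1"
    "\<beta> k \<le> 1 - a (Suc k)" "1 - a (Suc k) \<le> 2 * (1 - a k) ^ n"
proof -
  have pos: "0 < \<omega> k" for k using a[of k] by (simp add: \<omega>_def)
  have lt: "\<omega> k < 1" for k using a[of k] by (simp add: \<omega>_def)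
  have \<omega>S: "\<omega> (Suc k) = \<beta> k" for k
    using \<beta>(1)[of k] by (simp add: \<omega>_def step divide_simps)
  have \<omega>_sq: "\<omega> (Suc k) \<le> \<omega> k * \<omega> k" for k
  proof -
    have "\<omega> (Suc k) \<le> \<omega> k ^ n" using \<beta>(2)[of k] by (simp add: \<omega>S) (simp add: \<omega>_def)
    also have "\<dots> \<le> \<omega> k ^ 2" using pos[of k] lt[of k] n by (intro power_decreasing) auto
    finally show ?thesis by (simp add: power2_eq_square)
  qed
  have le0: "\<omega> k \<le> \<omega> 0" for k
  proof (induction k)
    case (Suc k)
    have "\<omega> k * \<omega> k \<le> \<omega> k * 1" using pos[of k] lt[of k] by (intro mult_left_mono) auto
    then show ?case using \<omega>_sq[of k] Suc by linarith
  qed simp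
  have \<omega>_le: "\<omega> k \<le> 1 - a k" for k
  proof -
    have "(1 - a k) / (1 + a k) \<le> (1 - a k) / 1" using a[of k] by (intro divide_left_mono) auto
    then show ?thesis by (simp add: \<omega>_def)
  qed
  have le_\<omega>: "1 - a k \<le> 2 * \<omega> k" for k
  proof -
    have "(1 - a k) * (1 + a k) \<le> (1 - a k) * 2" using a[of k] by (intro mult_left_mono) auto
    then show ?thesis using a[of k] by (simp add: \<omega>_def pos_le_divide_eq mult.commute)
  qed
  show summ: "summable \<omega>"
  proof (rule summable_contraction)
    show "\<omega> (Suc k) \<le> \<omega> 0 * \<omega> k + 0" for k
      using \<omega>_sq[of k] mult_right_mono[OF le0[of k] less_imp_le[OF pos[of k]]] by simp
  qed (use pos lt in \<open>auto intro: less_imp_le\<close>)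
  have "(\<lambda>k. 1 - a k) \<longlonglongrightarrow> 0"
  proof (rule tendsto_sandwich[OF _ _ tendsto_const])
    show "(\<lambda>k. 2 * \<omega> k) \<longlonglongrightarrow> 0" using tendsto_mult_right_zero[OF summable_LIMSEQ_zero[OF summ]] .
    show "\<forall>\<^sub>F k in sequentially. 0 \<le> 1 - a k" using a by (auto intro!: always_eventually less_imp_le)
    show "\<forall>\<^sub>F k in sequentially. 1 - a k \<le> 2 * \<omega> k" using le_\<omega> by (intro always_eventually) auto
  qed
  from tendsto_diff[OF tendsto_const[of 1] this] show "a \<longlonglongrightarrow> 1" by simp
  show "0 < \<omega> k" "\<omega> k \<le> \<omega> 0" "\<omega> 0 < 1" "\<omega> k \<le> 1 - a k" using pos le0 lt \<omega>_le by auto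
  show "\<beta> k \<le> 1 - a (Suc k)" using \<omega>_le[of "Suc k"] by (simp add: \<omega>S)
  have "1 - a (Suc k) \<le> 2 * \<beta> k" using le_\<omega>[of "Suc k"] by (simp add: \<omega>S)
  also have "\<beta> k \<le> \<omega> k ^ n" using \<beta>(2)[of k] by (simp add: \<omega>_def)
  also have "\<omega> k ^ n \<le> (1 - a k) ^ n" using pos[of k] \<omega>_le[of k] by (intro power_mono) auto
  finally show "1 - a (Suc k) \<le> 2 * (1 - a k) ^ n" by simp
qed

theorem theorem2p5:
  fixes A :: "complex^'n^'n"
    and Y Z :: "nat \<Rightarrow> complex^'n^'n"
    and a :: "nat \<Rightarrow> real"
    and \<alpha> :: real
    and m l :: nat
  assumes "m \<ge> 1" and "l \<in> {m - 1, m}" and "0 < \<alpha>" and "\<alpha> < 1"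
    and "\<And>\<mu>. eigenvalue A \<mu> \<Longrightarrow> \<mu> \<notin> \<real>\<^sub>\<le>\<^sub>0"
    and "Y 0 = A" and "\<And>k. Y (Suc k) = Y k ** mat_eval (zolo_h l m (a k)) (Z k ** Y k)"
    and "Z 0 = mat 1" and "\<And>k. Z (Suc k) = mat_eval (zolo_h l m (a k)) (Z k ** Y k) ** Z k"
    and "a 0 = \<alpha>" and "\<And>k. a (Suc k) = a k * rat_eval (zolo_h l m (a k)) ((a k)\<^sup>2)"
  shows "(\<forall>k. a k \<in> {0<..<1} \<and> mat_defined_at (zolo_h l m (a k)) (Z k ** Y k)
                \<and> defined_at (zolo_h l m (a k)) ((a k)\<^sup>2)) \<and>
         stable_at (pade_map l m) (principal_sqrt A, matrix_inv (principal_sqrt A)) \<and>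
         Y \<longlonglongrightarrow> principal_sqrt A \<and>
         Z \<longlonglongrightarrow> matrix_inv (principal_sqrt A) \<and>
         a \<longlonglongrightarrow> 1 \<and>
         converges_with_order a 1 (m + l + 1) \<and>
         converges_with_order (\<lambda>k. (Y k, Z k, a k))
           (principal_sqrt A, matrix_inv (principal_sqrt A), 1) (m + l + 1) \<and>
         converges_with_R_order Y (principal_sqrt A) (m + l + 1) \<and>
         converges_with_R_order Z (matrix_inv (principal_sqrt A)) (m + l + 1)"
proof -
  define n where "n = m + l + 1"
  have n: "2 \<le> n" using assms(1,2) by (auto simp: n_def)
  define X where "X = principal_sqrt A"
  define Xi where "Xi = matrix_inv X"
  have XX: "X ** X = A" and Re: "\<And>\<mu>. eigenvalue X \<mu> \<Longrightarrow> 0 < Re \<mu>"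
    using principal_sqrt_props[of A] assms(5) by (auto simp: X_def)
  have invX: "invertible X"
  proof (rule invertible_if_kernel_trivial, rule ccontr)
    fix v assume "X *v v = 0" "v \<noteq> 0"
    then have "X *v v = 0 *s v" by simp
    with \<open>v \<noteq> 0\<close> have "eigenvalue X 0" unfolding eigenvalue_def by blast
    from Re[OF this] show False by simp
  qed
  note Xi = matrix_inv_right_left[OF invX, folded Xi_def]

  have a_range: "0 < a k \<and> a k < 1" for k
  proof (induction k)
    case (Suc k)
    then obtain \<beta> where "a (Suc k) = (1 - \<beta>) / (1 + \<beta>)" "0 < \<beta>" "\<beta> \<le> ((1 - a k) / (1 + a k)) ^ n"
      using scalar_step[of "a k" m l] assms(1,2) unfolding assms(11) n_def by metis
    moreover have "((1 - a k) / (1 + a k)) ^ n < 1"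
      using Suc n by (simp add: power_less_one_iff)
    ultimately show ?case by simp
  qed (use assms in simp)
  define P where "P k xs \<beta> \<longleftrightarrow> length xs = n \<and> set xs \<subseteq> {a k..1} \<and>
      zolo_h l m (a k) = Fract (odd_part xs) (even_part xs) \<and> defined_at (zolo_h l m (a k)) ((a k)\<^sup>2) \<and>
      a (Suc k) = (1 - \<beta>) / (1 + \<beta>) \<and> 0 < \<beta> \<and> \<beta> \<le> ((1 - a k) / (1 + a k)) ^ n \<and>
      (1 / (4 * 3 ^ n)) ^ n * (1 - a k) ^ n \<le> \<beta>" for k xs \<beta>
  have "\<exists>xs \<beta>. P k xs \<beta>" for k
    using scalar_step[of "a k" m l] a_range[of k] assms(1,2) unfolding P_def assms(11) n_def by metis
  then obtain xs \<beta> where "\<And>k. P k (xs k) (\<beta> k)" by metis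
  then have xs: "\<And>k. length (xs k) = n" "\<And>k. set (xs k) \<subseteq> {a k..1}"
      "\<And>k. zolo_h l m (a k) = Fract (odd_part (xs k)) (even_part (xs k))"
      "\<And>k. defined_at (zolo_h l m (a k)) ((a k)\<^sup>2)"
    and \<beta>: "\<And>k. a (Suc k) = (1 - \<beta> k) / (1 + \<beta> k)" "\<And>k. 0 < \<beta> k"
      "\<And>k. \<beta> k \<le> ((1 - a k) / (1 + a k)) ^ n" "\<And>k. (1 / (4 * 3 ^ n)) ^ n * (1 - a k) ^ n \<le> \<beta> k"
    unfolding P_def by blast+
  have xs_ne: "xs k \<noteq> []" for k using xs(1)[of k] n by auto
  define \<omega> where "\<omega> k = (1 - a k) / (1 + a k)" for k
  note scalar = scalar_iteration[of a \<beta> n, OF a_range \<beta>(1,2,3) n, folded \<omega>_def]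
  define c where "c = (1 / (4 * 3 ^ n) :: real) ^ n"
  have c: "0 < c" by (simp add: c_def)
  have a_lower: "c * (1 - a k) ^ n \<le> 1 - a (Suc k)" for k
    using \<beta>(4)[of k] scalar(7)[of k] unfolding c_def by linarith
  have a_order: "converges_with_order a 1 (real n)"
  proof (rule converges_with_orderI)
    show "\<forall>\<^sub>F k in sequentially. dist (a (Suc k)) 1 \<le> 2 * dist (a k) 1 ^ n"
    proof (intro always_eventually allI)
      fix k
      have "dist (a k) 1 = 1 - a k" "dist (a (Suc k)) 1 = 1 - a (Suc k)"
        using a_range[of k] a_range[of "Suc k"] by (simp_all add: dist_real_def)
      then show "dist (a (Suc k)) 1 \<le> 2 * dist (a k) 1 ^ n" using scalar(8)[of k] by simp
    qed
    show "0 < 1 - a k" "1 - a k \<le> dist (a k) 1" "c * (1 - a k) ^ n \<le> 1 - a (Suc k)" for k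
      using a_range[of k] a_lower[of k] by (simp_all add: dist_real_def)
  qed (use scalar(6) c n in auto)

  obtain \<beta>' K t0 where form: "energy_form \<beta>' K" and t0: "0 < t0" "t0 < 1" and init: "energy_form.cayley_le \<beta>' X t0"
    using initial_cayley_le[of X] Re by metis
  interpret E: energy_form \<beta>' K by (rule form)
  interpret S: energy_form "inner :: complex^'n \<Rightarrow> _" 1 by (rule standard_energy_form)
  \<comment> \<open>A bound for the norm of the Cayley transform of \<open>V k\<close>, which controls the matrix iteration through a scalar one.\<close>
  define t where "t = rec_nat t0 (\<lambda>k s. hypsum s (\<omega> k) ^ n)"
  have t_simps: "t 0 = t0" "t (Suc k) = hypsum (t k) (\<omega> k) ^ n" for k by (simp_all add: t_def)
  have t_range: "0 \<le> t k \<and> t k < 1" and t_lim: "t \<longlonglongrightarrow> 0" for k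
    using hypsum_iteration_tendsto_0[of t \<omega> n "\<omega> 0"] t0 t_simps n scalar(1,2,3,5) by (auto intro: less_imp_le)
  have hyp_pos: "0 < hypsum s w" if "0 < s" "0 \<le> w" for s w
    using that by (simp add: hypsum_def add_pos_nonneg)
  have t_pos: "0 < t k" for k
    by (induction k) (use t0 hyp_pos scalar(1) in \<open>auto simp: t_simps less_imp_le\<close>)
  define V where "V k = X ** Z k" for k
  have inv: "X ** Z k = Z k ** X \<and> Y k = X ** V k \<and> E.cayley_le (V k) (t k)" for k
  proof (induction k)
    case 0
    then show ?case using init XX by (simp add: V_def assms(6,8) t_simps)
  next
    case (Suc k)
    have ak: "0 < a k" "a k < 1" using a_range[of k] by auto
    have V: "E.cayley_le (V k) (t k)" using Suc by blast
    note step = E.cayley_le_step[OF V t_pos _ ak xs(2) xs_ne, unfolded xs(1)]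
    have tk: "t k < 1" using t_range by blast
    have VX: "V k = Z k ** X" "Y k = X ** V k" using Suc by (auto simp only: V_def)
    note cs = coupled_step[of X "Z k" "Y k" "xs k", folded xs(3) V_def, OF VX step(1)[OF tk]]
    have 1: "X ** Z (Suc k) = V k ** (odd_mat (xs k) (V k) ** matrix_inv (even_mat (xs k) (V k)))"
      unfolding assms(9) by (rule cs(4))
    have "E.cayley_le (V (Suc k)) (t (Suc k))"
      using step(2)[OF tk] by (simp only: V_def[of "Suc k"] 1 t_simps \<omega>_def)
    moreover have "X ** Z (Suc k) = Z (Suc k) ** X" unfolding assms(9) by (rule cs(2))
    moreover have "Y (Suc k) = X ** V (Suc k)" unfolding V_def[of "Suc k"] assms(7,9) by (rule cs(3))
    ultimately show ?case by blast
  qed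
  have V_step: "V (Suc k) = V k ** (odd_mat (xs k) (V k) ** matrix_inv (even_mat (xs k) (V k)))"
    and defined: "mat_defined_at (zolo_h l m (a k)) (Z k ** Y k)" for k
  proof -
    have ak: "0 < a k" "a k < 1" using a_range[of k] by auto
    have even_inv: "invertible (even_mat (xs k) (V k))"
      using E.cayley_le_step(1)[OF _ t_pos _ ak xs(2) xs_ne] inv[of k] t_range[of k] by blast
    have VX: "V k = Z k ** X" "Y k = X ** V k" using inv[of k] by (auto simp only: V_def)
    note cs = coupled_step[of X "Z k" "Y k" "xs k", folded xs(3) V_def, OF VX even_inv]
    show "V (Suc k) = V k ** (odd_mat (xs k) (V k) ** matrix_inv (even_mat (xs k) (V k)))"
      and "mat_defined_at (zolo_h l m (a k)) (Z k ** Y k)"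
      unfolding V_def[of "Suc k"] assms(9) by (rule cs(4), rule cs(1))
  qed
  have Y_eq: "Y k = X ** V k" for k using inv[of k] by blast
  have Z_eq: "Z k = Xi ** V k" for k by (simp add: V_def matrix_mul_assoc Xi)

  define D where "D = (real CARD('n))\<^sup>2"
  have "\<forall>\<^sub>F k in sequentially. t k < 1 / 2" using t_lim by (rule order_tendstoD(2)) simp
  then have "\<forall>\<^sub>F k in sequentially. norm (V k - mat 1) \<le> D * (4 * sqrt K * t k)"
  proof eventually_elim
    case (elim k)
    then show ?case using E.cayley_le_norm[of "V k" "t k"] inv[of k] t_range[of k] by (simp add: D_def)
  qed
  moreover have "(\<lambda>k. D * (4 * sqrt K * t k)) \<longlonglongrightarrow> 0"
    using tendsto_mult_right_zero[OF t_lim, of "D * (4 * sqrt K)"] by (simp add: mult.assoc)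
  ultimately have "(\<lambda>k. V k - mat 1) \<longlonglongrightarrow> 0" by (rule Lim_null_comparison)
  then have V_lim: "V \<longlonglongrightarrow> mat 1" by (simp only: Lim_null[symmetric])
  have Y_lim: "Y \<longlonglongrightarrow> X"
    using bounded_bilinear.tendsto[OF bounded_bilinear_matrix_mult tendsto_const[of X] V_lim]
    by (simp add: Y_eq[abs_def])
  have Z_lim: "Z \<longlonglongrightarrow> Xi"
    using bounded_bilinear.tendsto[OF bounded_bilinear_matrix_mult tendsto_const[of Xi] V_lim]
    by (simp add: Z_eq[abs_def])

  obtain C0 where C0: "0 < C0" "\<And>(A :: complex^'n^'n) (B :: complex^'n^'n). norm (A ** B) \<le> norm A * norm B * C0"
    using bounded_bilinear.pos_bounded[OF bounded_bilinear_matrix_mult] by blast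
  obtain C1 where C1: "0 < C1" "\<And>(A :: complex^'n^'n) (u :: complex^'n). norm (A *v u) \<le> norm A * norm u * C1"
    using bounded_bilinear.pos_bounded[OF bounded_bilinear_matrix_vector_mult] by blast
  define e where "e k = dist (Y k, Z k, a k) (X, Xi, 1 :: real)" for k
  have e_lim: "e \<longlonglongrightarrow> 0"
    unfolding e_def by (rule iffD1[OF tendsto_dist_iff]) (intro tendsto_Pair Y_lim Z_lim scalar(6))
  have e_Y: "dist (Y k) X \<le> e k" and e_Z: "dist (Z k) Xi \<le> e k" and e_a: "1 - a k \<le> e k" for k
  proof -
    have tail: "dist (Z k, a k) (Xi, 1 :: real) \<le> e k"
      unfolding e_def using dist_snd_le[of "(Y k, Z k, a k)" "(X, Xi, 1 :: real)"] by simp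
    show "dist (Y k) X \<le> e k"
      unfolding e_def using dist_fst_le[of "(Y k, Z k, a k)" "(X, Xi, 1 :: real)"] by simp
    show "dist (Z k) Xi \<le> e k"
      using order_trans[OF dist_fst_le tail] by simp
    have "dist (a k) 1 \<le> e k" using order_trans[OF dist_snd_le tail] by simp
    then show "1 - a k \<le> e k" using a_range[of k] by (simp add: dist_real_def)
  qed
  have e_pos: "0 < e k" for k using e_a[of k] a_range[of k] by linarith
  have e_sum: "e k \<le> dist (Y k) X + dist (Z k) Xi + (1 - a k)" for k
  proof -
    have "e k \<le> dist (Y k) X + dist (Z k, a k) (Xi, 1)"
      unfolding e_def dist_Pair_Pair[of "Y k"] by (rule sqrt_sum_squares_le_sum) simp_all
    also have "dist (Z k, a k) (Xi, 1) \<le> dist (Z k) Xi + dist (a k) 1"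
      unfolding dist_Pair_Pair by (rule sqrt_sum_squares_le_sum) simp_all
    finally show ?thesis using a_range[of k] by (simp add: dist_real_def)
  qed
  define L where "L = norm X * C0 * C1"
  have L: "0 \<le> L" using C0(1) C1(1) by (simp add: L_def)
  have V_near: "norm ((V k - mat 1) *v u) \<le> (L + 1) * e k * norm u" for k u
  proof -
    have "V k - mat 1 = X ** (Z k - Xi)" by (simp add: V_def matrix_diff_ldistrib Xi)
    then have "norm (V k - mat 1) \<le> norm X * dist (Z k) Xi * C0" using C0(2)[of X "Z k - Xi"] by (simp add: dist_norm)
    also have "\<dots> \<le> norm X * e k * C0" using e_Z[of k] C0(1) by (intro mult_right_mono mult_left_mono) auto
    finally have "norm (V k - mat 1) * norm u * C1 \<le> norm X * e k * C0 * norm u * C1"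
      using C1(1) by (intro mult_right_mono) auto
    also have "\<dots> = L * e k * norm u" by (simp add: L_def)
    also have "\<dots> \<le> (L + 1) * e k * norm u" using e_pos[of k] by (intro mult_right_mono) auto
    finally show ?thesis using C1(2)[of "V k - mat 1" u] by linarith
  qed
  define C where "C = (norm X + norm Xi) * (D * (4 * (L + 2) ^ n)) * C0 + 2"
  have "(\<lambda>k. (L + 2) * e k) \<longlonglongrightarrow> 0" by (rule tendsto_mult_right_zero[OF e_lim])
  then have "\<forall>\<^sub>F k in sequentially. (L + 2) * e k < 1 / 2" by (rule order_tendstoD(2)) simp
  then have e_step: "\<forall>\<^sub>F k in sequentially. e (Suc k) \<le> C * e k ^ n"
  proof eventually_elim
    case (elim k)
    \<comment> \<open>Near the limit the bound is restarted in the standard norm, where it is proportional to the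
      current error; \<open>L + 1\<close> instead of \<open>L\<close> keeps it positive.\<close>
    define s where "s = (L + 1) * e k"
    have s: "0 < s" "s < 1" and sw: "s + \<omega> k \<le> (L + 2) * e k"
    proof -
      show "0 < s" using L e_pos[of k] by (simp add: s_def)
      show "s + \<omega> k \<le> (L + 2) * e k" using scalar(4)[of k] e_a[of k] by (simp add: s_def algebra_simps)
      then show "s < 1" using elim scalar(1)[of k] by linarith
    qed
    have ak: "0 < a k" "a k < 1" using a_range[of k] by auto
    have "S.cayley_le (V k) s"
      by (rule near_1_imp_cayley_le) (use V_near[of k] s in \<open>simp_all add: s_def\<close>)
    from S.cayley_le_step(2)[OF this s ak xs(2) xs_ne]
    have V': "S.cayley_le (V (Suc k)) (hypsum s (\<omega> k) ^ n)" by (simp only: V_step xs(1) \<omega>_def)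
    have "\<omega> k < 1" using scalar(2)[of k] scalar(3) by linarith
    note h = hypsum_props[of s "\<omega> k", OF less_imp_le[OF s(1)] s(2) less_imp_le[OF scalar(1)] this]
    have hn: "hypsum s (\<omega> k) ^ n \<le> ((L + 2) * e k) ^ n" using h(1,3) sw by (intro power_mono) auto
    also have "\<dots> \<le> ((L + 2) * e k) ^ 1" using L e_pos[of k] elim n by (intro power_decreasing) auto
    finally have "hypsum s (\<omega> k) ^ n \<le> 1 / 2" using elim by simp
    then have "norm (V (Suc k) - mat 1) \<le> D * (4 * sqrt 1 * hypsum s (\<omega> k) ^ n)"
      unfolding D_def using h(1) by (intro S.cayley_le_norm[OF V']) auto
    also have "\<dots> \<le> D * (4 * sqrt 1 * ((L + 2) * e k) ^ n)"
      using hn by (intro mult_left_mono) (auto simp: D_def)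
    finally have V1: "norm (V (Suc k) - mat 1) \<le> D * (4 * (L + 2) ^ n) * e k ^ n"
      by (simp add: power_mult_distrib mult_ac)
    have dist_bound: "dist (B ** V (Suc k)) B \<le> norm B * (D * (4 * (L + 2) ^ n)) * C0 * e k ^ n"
      for B :: "complex^'n^'n"
    proof -
      have "dist (B ** V (Suc k)) B = norm (B ** (V (Suc k) - mat 1))"
        by (simp add: dist_norm matrix_diff_ldistrib)
      also have "\<dots> \<le> norm B * norm (V (Suc k) - mat 1) * C0" by (rule C0(2))
      also have "\<dots> \<le> norm B * (D * (4 * (L + 2) ^ n) * e k ^ n) * C0"
        using V1 C0(1) by (intro mult_right_mono mult_left_mono) auto
      finally show ?thesis by (simp add: mult_ac)
    qed
    have "(1 - a k) ^ n \<le> e k ^ n" using e_a[of k] ak by (intro power_mono) auto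
    then have "1 - a (Suc k) \<le> 2 * e k ^ n" using scalar(8)[of k] by linarith
    then have "e (Suc k) \<le> norm X * (D * (4 * (L + 2) ^ n)) * C0 * e k ^ n
        + norm Xi * (D * (4 * (L + 2) ^ n)) * C0 * e k ^ n + 2 * e k ^ n"
      using e_sum[of "Suc k"] dist_bound[where B = X] dist_bound[where B = Xi] unfolding Y_eq Z_eq by linarith
    also have "\<dots> = C * e k ^ n" by (simp add: C_def algebra_simps)
    finally show ?case .
  qed
  have triple: "converges_with_order (\<lambda>k. (Y k, Z k, a k)) (X, Xi, 1) (real n)"
  proof (rule converges_with_orderI)
    show "(\<lambda>k. (Y k, Z k, a k)) \<longlonglongrightarrow> (X, Xi, 1)" by (intro tendsto_Pair Y_lim Z_lim scalar(6))
    show "\<forall>\<^sub>F k in sequentially. dist (Y (Suc k), Z (Suc k), a (Suc k)) (X, Xi, 1)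
        \<le> C * dist (Y k, Z k, a k) (X, Xi, 1) ^ n"
      using e_step unfolding e_def .
    show "0 < 1 - a k" "1 - a k \<le> dist (Y k, Z k, a k) (X, Xi, 1)" "c * (1 - a k) ^ n \<le> 1 - a (Suc k)" for k
      using a_range[of k] e_a[of k] a_lower[of k] by (simp_all add: e_def)
  qed (use c n in auto)
  have "converges_with_R_order Y X (real n)" "converges_with_R_order Z Xi (real n)"
    using e_Y e_Z by (auto intro!: converges_with_R_orderI[OF triple] simp: e_def)
  moreover have "stable_at (pade_map l m) (X, Xi)" using assms(1,2) Xi by (intro pade_map_stable) auto
  ultimately show ?thesis
    using a_range defined xs(4) Y_lim Z_lim scalar(6) a_order triple
    unfolding X_def[symmetric] Xi_def[symmetric] n_def by simp
qed

end
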